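(* There does not exist a Lagrangian submanifold of the nearly Kähler $(\mathbb{C}P^3,g,J)$ whose induced metric has constant sectional curvature.
   Context: Identify $\mathbb{R}^8\cong\mathbb{C}^4\cong\mathbb{H}^2$ via $(z_1,z_2,z_3,z_4)\leftrightarrow(z_1+z_2j,\,z_3+z_4j)$ and let $i,j,k$ act by left multiplication. Let $\pi:\mathbb{S}^7\subset\mathbb{C}^4\to\mathbb{C}P^3$ be the Hopf fibration (vertical space at $q$ spanned by $iq$), $g_1$ the Fubini–Study metric for which $\pi$ is a Riemannian submersion from the round sphere of constant curvature $1$, $J_1$ the standard complex structure. Define $\mathcal{D}_1^2(\pi(q))=d\pi_q(\mathrm{span}\{jq,kq\})$, $\mathcal{D}_2^4(\pi(q))=d\pi_q(\mathrm{span}\{iq,jq,kq\}^\perp)$ (complement in $T_q\mathbb{S}^7$); these are well defined and $T\mathbb{C}P^3=\mathcal{D}_1^2\oplus\mathcal{D}_2^4$ is $g_1$-orthogonal. Let $J=-J_1$ on $\mathcal{D}_1^2$, $J=J_1$ on $\mathcal{D}_2^4$. The nearly Kähler metric is $g=g_2$, equal to $g_1$ on $\mathcal{D}_1^2\times\mathcal{D}_1^2$, $2g_1$ on $\mathcal{D}_2^4\times\mathcal{D}_2^4$ and $0$ on $\mathcal{D}_1^2\times\mathcal{D}_2^4$. A three-dimensional submanifold is Lagrangian if $g(X,JY)=0$ for all tangent $X,Y$, i.e. $J$ maps its tangent spaces onto its normal spaces. *)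

theory Defs
  imports "HOL-Analysis.Analysis"
begin

section \<open>Smooth manifolds\<close>

fun Ck_on :: "nat \<Rightarrow> ('a::euclidean_space \<Rightarrow> 'b::real_normed_vector) \<Rightarrow> 'a set \<Rightarrow> bool" where
  "Ck_on 0 f S \<longleftrightarrow> continuous_on S f"
| "Ck_on (Suc k) f S \<longleftrightarrow>
     (\<forall>x\<in>S. f differentiable (at x)) \<and> (\<forall>v. Ck_on k (\<lambda>x. frechet_derivative f (at x) v) S)"

text \<open>The derivatives are taken in the ambient space, so this is meant for open \<open>S\<close>.\<close>
definition smooth_on :: "'a::euclidean_space set \<Rightarrow> ('a \<Rightarrow> 'b::real_normed_vector) \<Rightarrow> bool" where
  "smooth_on S f \<longleftrightarrow> (\<forall>k. Ck_on k f S)"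

text \<open>
  A smooth structure is given by an atlas of local parametrizations \<open>(V, \<psi>)\<close>, where \<open>\<psi>\<close> maps the
  open set \<open>V\<close> of \<open>\<real>\<^sup>n\<close> homeomorphically onto an open set of the space; tangent vectors are
  represented by their coordinates in \<open>\<real>\<^sup>n\<close>.
\<close>
type_synonym ('n, 'm) atlas = "((real^'n) set \<times> (real^'n \<Rightarrow> 'm)) set"

definition smooth_manifold :: "'m topology \<Rightarrow> ('n::finite, 'm) atlas \<Rightarrow> bool" where
  "smooth_manifold T A \<longleftrightarrow>
     Hausdorff_space T \<and> second_countable T \<and>
     topspace T = (\<Union>(V, \<psi>)\<in>A. \<psi> ` V) \<and>
     (\<forall>(V, \<psi>)\<in>A. open V \<and> openin T (\<psi> ` V) \<and>
        homeomorphic_map (top_of_set V) (subtopology T (\<psi> ` V)) \<psi>) \<and>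
     (\<forall>(V, \<psi>)\<in>A. \<forall>(W, \<phi>)\<in>A.
        smooth_on (V \<inter> \<psi> -` (\<phi> ` W)) (\<lambda>x. the_inv_into W \<phi> (\<psi> x)))"

section \<open>Curvature of a Riemannian metric in coordinates\<close>

text \<open>In this section \<open>h x\<close> is the Gram matrix of the coordinate vector fields at \<open>x\<close>.\<close>

definition partial :: "'n::finite \<Rightarrow> (real^'n \<Rightarrow> real) \<Rightarrow> real^'n \<Rightarrow> real" where
  "partial i u x = frechet_derivative u (at x) (axis i 1)"

text \<open>\<open>christoffel h l i j\<close> is \<open>\<Gamma>\<^sup>l\<^sub>i\<^sub>j\<close>.\<close>
definition christoffel ::
  "(real^'n \<Rightarrow> real^'n^'n) \<Rightarrow> 'n::finite \<Rightarrow> 'n \<Rightarrow> 'n \<Rightarrow> real^'n \<Rightarrow> real" where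
  "christoffel h l i j x = (\<Sum>m\<in>UNIV. matrix_inv (h x) $ l $ m *
     (partial i (\<lambda>y. h y $ j $ m) x + partial j (\<lambda>y. h y $ i $ m) x
        - partial m (\<lambda>y. h y $ i $ j) x)) / 2"

text \<open>The \<open>l\<close>-th component of \<open>R(\<partial>\<^sub>i, \<partial>\<^sub>j) \<partial>\<^sub>k\<close>, where
  \<open>R(X, Y) Z = \<nabla>\<^sub>X \<nabla>\<^sub>Y Z - \<nabla>\<^sub>Y \<nabla>\<^sub>X Z - \<nabla>\<^bsub>[X, Y]\<^esub> Z\<close>.\<close>
definition riemann ::
  "(real^'n \<Rightarrow> real^'n^'n) \<Rightarrow> 'n::finite \<Rightarrow> 'n \<Rightarrow> 'n \<Rightarrow> 'n \<Rightarrow> real^'n \<Rightarrow> real" where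
  "riemann h l i j k x =
     partial i (christoffel h l j k) x - partial j (christoffel h l i k) x
     + (\<Sum>m\<in>UNIV. christoffel h l i m x * christoffel h m j k x
                - christoffel h l j m x * christoffel h m i k x)"

definition curvature ::
  "(real^'n \<Rightarrow> real^'n^'n) \<Rightarrow> real^'n \<Rightarrow> real^'n \<Rightarrow> real^'n \<Rightarrow> real^'n \<Rightarrow> real^'n::finite" where
  "curvature h x X Y Z =
     (\<chi> l. \<Sum>i\<in>UNIV. \<Sum>j\<in>UNIV. \<Sum>k\<in>UNIV. riemann h l i j k x * X $ i * Y $ j * Z $ k)"

definition metric_at :: "(real^'n \<Rightarrow> real^'n^'n) \<Rightarrow> real^'n \<Rightarrow> real^'n \<Rightarrow> real^'n::finite \<Rightarrow> real" where
  "metric_at h x X Y = X \<bullet> (h x *v Y)"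

definition sectional_curvature ::
  "(real^'n \<Rightarrow> real^'n^'n) \<Rightarrow> real^'n \<Rightarrow> real^'n \<Rightarrow> real^'n::finite \<Rightarrow> real" where
  "sectional_curvature h x X Y =
     metric_at h x (curvature h x X Y Y) X /
     (metric_at h x X X * metric_at h x Y Y - (metric_at h x X Y)\<^sup>2)"

text \<open>\<open>G \<psi>\<close> is the coordinate expression of the metric in the parametrization \<open>\<psi>\<close>.\<close>
definition constant_sectional_curvature ::
  "('n::finite, 'm) atlas \<Rightarrow> ((real^'n \<Rightarrow> 'm) \<Rightarrow> real^'n \<Rightarrow> real^'n^'n) \<Rightarrow> bool" where
  "constant_sectional_curvature A G \<longleftrightarrow>
     (\<exists>c. \<forall>(V, \<psi>)\<in>A. \<forall>x\<in>V. \<forall>X Y. X \<noteq> Y \<and> independent {X, Y} \<longrightarrow>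
        sectional_curvature (G \<psi>) x X Y = c)"

section \<open>The nearly Kaehler \<open>\<complex>P\<^sup>3\<close>\<close>

text \<open>
  \<open>\<complex>\<^sup>4\<close> with the real inner product \<open>\<bullet>\<close> of \<open>complex^4\<close> is \<open>\<real>\<^sup>8\<close>. Left multiplication by \<open>i\<close> is
  \<open>\<i> *s q\<close>; since \<open>j (z\<^sub>1 + z\<^sub>2 j) = - cnj z\<^sub>2 + cnj z\<^sub>1 j\<close>, left multiplication by \<open>j\<close> is
  the following map, and \<open>k = i j\<close>.
\<close>
definition jmul :: "complex^4 \<Rightarrow> complex^4" where
  "jmul q = vector [- cnj (q $ 2), cnj (q $ 1), - cnj (q $ 4), cnj (q $ 3)]"

definition kmul :: "complex^4 \<Rightarrow> complex^4" where
  "kmul q = \<i> *s jmul q"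

abbreviation S7 :: "(complex^4) set" where
  "S7 \<equiv> sphere 0 1"

text \<open>
  The manifold \<open>\<complex>P\<^sup>3 = S\<^sup>7 / U(1)\<close> is realized as the submanifold of \<open>complex^4^4\<close> consisting of the
  orthogonal projections onto the complex lines of \<open>\<complex>\<^sup>4\<close>: the projection onto \<open>\<complex> q\<close>,
  \<open>q \<in> S\<^sup>7\<close>, is \<open>q q\<^sup>*\<close>. The lemmas \<open>hopf_eq_iff\<close> and \<open>dhopf_eq_0_iff\<close> below say that the fibres are
  the Hopf circles and that the kernel of the differential on \<open>T\<^sub>q S\<^sup>7\<close> is spanned by \<open>i q\<close>, so that
  smooth maps into the quotient are the smooth matrix-valued maps with values in \<open>CP3\<close>.
\<close>
definition hopf :: "complex^4 \<Rightarrow> complex^4^4" where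
  "hopf q = (\<chi> a b. q $ a * cnj (q $ b))"

definition CP3 :: "(complex^4^4) set" where
  "CP3 = hopf ` S7"

definition tangent_S7 :: "complex^4 \<Rightarrow> (complex^4) set" where
  "tangent_S7 q = {v. v \<bullet> q = 0}"

definition horizontal :: "complex^4 \<Rightarrow> (complex^4) set" where
  "horizontal q = {v \<in> tangent_S7 q. v \<bullet> (\<i> *s q) = 0}"

definition dhopf :: "complex^4 \<Rightarrow> complex^4 \<Rightarrow> complex^4^4" where
  "dhopf q = frechet_derivative hopf (at q)"

text \<open>
  In the following definitions \<open>q\<close> ranges over all points of the fibre over \<open>p\<close>; the results do not
  depend on it, see \<open>D1_hopf\<close>, \<open>D2_hopf\<close>, \<open>g1_hopf\<close>, \<open>J1_hopf\<close>, \<open>J_hopf\<close> and \<open>g_hopf\<close> below.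
\<close>

definition D1 :: "complex^4^4 \<Rightarrow> (complex^4^4) set" where
  "D1 p = {dhopf q v | q v. q \<in> S7 \<and> hopf q = p \<and> v \<in> span {jmul q, kmul q}}"

definition D2 :: "complex^4^4 \<Rightarrow> (complex^4^4) set" where
  "D2 p = {dhopf q v | q v. q \<in> S7 \<and> hopf q = p \<and>
     v \<in> tangent_S7 q \<and> (\<forall>u \<in> span {\<i> *s q, jmul q, kmul q}. v \<bullet> u = 0)}"

text \<open>Fubini--Study metric: \<open>dhopf q\<close> is isometric on horizontal vectors.\<close>
definition g1 :: "complex^4^4 \<Rightarrow> complex^4^4 \<Rightarrow> complex^4^4 \<Rightarrow> real" where
  "g1 p X Y = (THE r. \<exists>q v w. q \<in> S7 \<and> hopf q = p \<and> v \<in> horizontal q \<and> w \<in> horizontal q \<and>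
     X = dhopf q v \<and> Y = dhopf q w \<and> r = v \<bullet> w)"

text \<open>Standard complex structure: \<open>dhopf q\<close> is complex linear on horizontal vectors.\<close>
definition J1 :: "complex^4^4 \<Rightarrow> complex^4^4 \<Rightarrow> complex^4^4" where
  "J1 p X = (THE Y. \<exists>q v. q \<in> S7 \<and> hopf q = p \<and> v \<in> horizontal q \<and>
     X = dhopf q v \<and> Y = dhopf q (\<i> *s v))"

definition J :: "complex^4^4 \<Rightarrow> complex^4^4 \<Rightarrow> complex^4^4" where
  "J p X = (THE Y. \<exists>X1\<in>D1 p. \<exists>X2\<in>D2 p. X = X1 + X2 \<and> Y = - J1 p X1 + J1 p X2)"

definition g :: "complex^4^4 \<Rightarrow> complex^4^4 \<Rightarrow> complex^4^4 \<Rightarrow> real" where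
  "g p X Y = (THE r. \<exists>X1\<in>D1 p. \<exists>X2\<in>D2 p. \<exists>Y1\<in>D1 p. \<exists>Y2\<in>D2 p.
     X = X1 + X2 \<and> Y = Y1 + Y2 \<and> r = g1 p X1 Y1 + 2 * g1 p X2 Y2)"

section \<open>Lagrangian submanifolds\<close>

text \<open>Smooth immersions of an \<open>n\<close>-manifold into \<open>\<complex>P\<^sup>3\<close>; embedded submanifolds are the special case
  of the inclusion map.\<close>
definition immersed_submanifold ::
  "'m topology \<Rightarrow> ('n::finite, 'm) atlas \<Rightarrow> ('m \<Rightarrow> complex^4^4) \<Rightarrow> bool" where
  "immersed_submanifold T A f \<longleftrightarrow>
     smooth_manifold T A \<and> topspace T \<noteq> {} \<and> f ` topspace T \<subseteq> CP3 \<and>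
     (\<forall>(V, \<psi>)\<in>A. smooth_on V (f \<circ> \<psi>) \<and>
        (\<forall>x\<in>V. inj (frechet_derivative (f \<circ> \<psi>) (at x))))"

definition lagrangian_submanifold ::
  "'m topology \<Rightarrow> (3, 'm) atlas \<Rightarrow> ('m \<Rightarrow> complex^4^4) \<Rightarrow> bool" where
  "lagrangian_submanifold T A f \<longleftrightarrow>
     immersed_submanifold T A f \<and>
     (\<forall>(V, \<psi>)\<in>A. \<forall>x\<in>V. \<forall>X \<in> range (frechet_derivative (f \<circ> \<psi>) (at x)).
        \<forall>Y \<in> range (frechet_derivative (f \<circ> \<psi>) (at x)).
          g (f (\<psi> x)) X (J (f (\<psi> x)) Y) = 0)"

definition induced_metric ::
  "('m \<Rightarrow> complex^4^4) \<Rightarrow> (real^'n \<Rightarrow> 'm) \<Rightarrow> real^'n \<Rightarrow> real^'n::finite^'n" where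
  "induced_metric f \<psi> x = (\<chi> i j. g (f (\<psi> x))
     (frechet_derivative (f \<circ> \<psi>) (at x) (axis i 1))
     (frechet_derivative (f \<circ> \<psi>) (at x) (axis j 1)))"

section \<open>The structures are well defined\<close>

lemma jmul_nth [simp]:
  "jmul q $ 1 = - cnj (q $ 2)" "jmul q $ 2 = cnj (q $ 1)"
  "jmul q $ 3 = - cnj (q $ 4)" "jmul q $ 4 = cnj (q $ 3)"
  by (simp_all add: jmul_def vector_def)

definition herm :: "complex^4 \<Rightarrow> complex^4 \<Rightarrow> complex" where
  "herm v q = (\<Sum>a\<in>UNIV. v $ a * cnj (q $ a))"

lemma inner_herm: "v \<bullet> q = Re (herm v q)"
  by (simp add: herm_def inner_vec_def inner_complex_def)

lemma inner_i_herm: "v \<bullet> (\<i> *s q) = Im (herm v q)"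
  by (simp add: herm_def inner_vec_def inner_complex_def algebra_simps)

lemma herm_self: "q \<in> S7 \<Longrightarrow> herm q q = 1"
proof -
  assume "q \<in> S7"
  then have "q \<bullet> q = 1" by (simp add: dot_square_norm)
  moreover have "Im (herm q q) = 0" by (simp add: herm_def mult.commute)
  ultimately show ?thesis by (simp add: complex_eq_iff inner_herm)
qed

lemma herm_smult: "herm (c *s v) q = c * herm v q" "herm v (c *s q) = cnj c * herm v q"
  by (simp_all add: herm_def sum_distrib_left algebra_simps)

lemma herm_add: "herm (v + w) q = herm v q + herm w q"
  by (simp add: herm_def sum.distrib algebra_simps)

lemma herm_scaleR: "herm (c *\<^sub>R v) q = c *\<^sub>R herm v q"
  by (simp add: herm_def sum_distrib_left scaleR_sum_right)

lemma herm_cnj: "(\<Sum>b\<in>UNIV. q $ b * cnj (v $ b)) = cnj (herm v q)"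
  by (simp add: herm_def mult.commute)

lemma horizontal_iff: "v \<in> horizontal q \<longleftrightarrow> herm v q = 0"
  by (simp add: horizontal_def tangent_S7_def inner_i_herm complex_eq_iff) (simp add: inner_herm)

lemma hopf_eq_iff:
  assumes "q \<in> S7" "r \<in> S7"
  shows "hopf q = hopf r \<longleftrightarrow> (\<exists>c. cmod c = 1 \<and> r = c *s q)"
proof
  assume h: "hopf q = hopf r"
  have ent: "r $ a * cnj (r $ b) = q $ a * cnj (q $ b)" for a b
    using h by (simp add: hopf_def vec_eq_iff)
  have "q $ a = herm q r * r $ a" for a
  proof -
    have "r $ a * herm q r = (\<Sum>b\<in>UNIV. (r $ a * cnj (r $ b)) * q $ b)"
      by (simp add: herm_def sum_distrib_left algebra_simps)
    also have "\<dots> = q $ a * herm q q"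
      by (simp only: ent) (simp add: herm_def sum_distrib_left algebra_simps)
    finally show ?thesis using herm_self [OF assms(1)] by (simp add: mult.commute)
  qed
  then have q: "q = herm q r *s r" by (simp add: vec_eq_iff)
  define d where "d = herm q r"
  have "herm q q = d * cnj d * herm r r"
    using q by (metis d_def herm_smult mult.assoc)
  then have d: "d * cnj d = 1" using herm_self assms by simp
  then have "complex_of_real ((cmod d)\<^sup>2) = 1" by (simp only: complex_norm_square)
  then have "(cmod d)\<^sup>2 = 1" by (simp only: of_real_eq_1_iff)
  then have "cmod d = 1" by (metis abs_norm_cancel power2_eq_1_iff abs_minus_cancel abs_one)
  moreover have "r = cnj d *s q"
    using q d by (metis d_def mult.commute vector_smult_assoc vector_smult_lid)
  ultimately show "\<exists>c. cmod c = 1 \<and> r = c *s q"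
    by (metis complex_mod_cnj)
next
  assume "\<exists>c. cmod c = 1 \<and> r = c *s q"
  then obtain c where c: "cmod c = 1" "r = c *s q" by blast
  have "c * cnj c = 1" using c(1) by (metis complex_norm_square of_real_1 power_one)
  then have "(c * q $ a) * cnj (c * q $ b) = q $ a * cnj (q $ b)" for a b
    by (metis (no_types, opaque_lifting) complex_cnj_mult mult.assoc mult.left_commute mult_1)
  then show "hopf q = hopf r" unfolding hopf_def c(2) by (simp only: vector_smult_component)
qed

lemma bounded_bilinear_hopf:
  "bounded_bilinear (\<lambda>v w. (\<chi> a b. v $ a * cnj (w $ b)) :: complex^4^4)"
proof (rule bilinear_conv_bounded_bilinear [THEN iffD1])
  show "bilinear (\<lambda>v w. (\<chi> a b. v $ a * cnj (w $ b)) :: complex^4^4)"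
    unfolding bilinear_def
    by (auto intro!: linearI simp: vec_eq_iff algebra_simps)
qed

lemma has_derivative_hopf:
  "(hopf has_derivative (\<lambda>v. \<chi> a b. v $ a * cnj (q $ b) + q $ a * cnj (v $ b))) (at q)"
proof -
  have "((\<lambda>q. (\<chi> a b. q $ a * cnj (q $ b)) :: complex^4^4) has_derivative
      (\<lambda>v. (\<chi> a b. q $ a * cnj (v $ b)) + (\<chi> a b. v $ a * cnj (q $ b)))) (at q)"
    by (rule bounded_bilinear.FDERIV [OF bounded_bilinear_hopf has_derivative_ident has_derivative_ident])
  moreover have "(\<lambda>v. (\<chi> a b. q $ a * cnj (v $ b)) + (\<chi> a b. v $ a * cnj (q $ b)))
      = (\<lambda>v. (\<chi> a b. v $ a * cnj (q $ b) + q $ a * cnj (v $ b)) :: complex^4^4)"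
    by (simp add: fun_eq_iff vec_eq_iff)
  ultimately show ?thesis by (simp add: hopf_def [abs_def])
qed

lemma dhopf_eq: "dhopf q v = (\<chi> a b. v $ a * cnj (q $ b) + q $ a * cnj (v $ b))"
  unfolding dhopf_def by (subst frechet_derivative_at [OF has_derivative_hopf, symmetric]) simp

lemma dhopf_add: "dhopf q (v + w) = dhopf q v + dhopf q w"
  by (simp add: dhopf_eq vec_eq_iff algebra_simps)

lemma dhopf_uminus: "dhopf q (- v) = - dhopf q v"
  by (simp add: dhopf_eq vec_eq_iff)

lemma dhopf_diff: "dhopf q (v - w) = dhopf q v - dhopf q w"
  by (simp add: dhopf_eq vec_eq_iff algebra_simps)

lemma dhopf_eq_0:
  assumes "q \<in> S7" "dhopf q v = 0"
  shows "v = - cnj (herm v q) *s q"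
proof -
  have ent: "v $ a * cnj (q $ b) + q $ a * cnj (v $ b) = 0" for a b
    using assms(2) by (simp add: dhopf_eq vec_eq_iff)
  have "v $ a + q $ a * cnj (herm v q) = 0" for a
  proof -
    have "v $ a * herm q q + q $ a * cnj (herm v q)
        = (\<Sum>b\<in>UNIV. (v $ a * cnj (q $ b) + q $ a * cnj (v $ b)) * q $ b)"
      by (simp add: herm_def sum_distrib_left sum.distrib algebra_simps)
    also have "\<dots> = 0" by (simp only: ent) simp
    finally show ?thesis using herm_self [OF assms(1)] by simp
  qed
  then show ?thesis by (simp add: vec_eq_iff eq_neg_iff_add_eq_0 mult.commute)
qed

lemma dhopf_eq_0_iff:
  assumes "q \<in> S7" "v \<in> tangent_S7 q"
  shows "dhopf q v = 0 \<longleftrightarrow> v \<in> span {\<i> *s q}"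
proof
  assume "dhopf q v = 0"
  from dhopf_eq_0 [OF assms(1) this] have v: "v = - cnj (herm v q) *s q" .
  have "Re (herm v q) = 0" using assms(2) by (simp add: tangent_S7_def inner_herm)
  then have "- cnj (herm v q) = complex_of_real (Im (herm v q)) * \<i>"
    by (simp add: complex_eq_iff)
  with v have "v = complex_of_real (Im (herm v q)) *s (\<i> *s q)"
    by (metis vector_smult_assoc)
  moreover have "complex_of_real t *s w = t *\<^sub>R w" for t and w :: "complex^4"
    by (simp only: vec_eq_iff vector_smult_component vector_scaleR_component)
      (simp add: scaleR_conv_of_real)
  ultimately have "v = Im (herm v q) *\<^sub>R (\<i> *s q)" by metis
  then show "v \<in> span {\<i> *s q}" by (metis span_base span_scale insertI1)
next
  assume "v \<in> span {\<i> *s q}"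
  then obtain c where "v = c *\<^sub>R (\<i> *s q)" by (auto simp: span_singleton)
  then have "v $ a = (c *\<^sub>R \<i>) * q $ a" for a by simp
  then show "dhopf q v = 0" by (simp add: dhopf_eq vec_eq_iff)
qed

lemma dhopf_horizontal_inj:
  assumes "q \<in> S7" "v \<in> horizontal q" "w \<in> horizontal q" "dhopf q v = dhopf q w"
  shows "v = w"
proof -
  have "v - w = - cnj (herm (v - w) q) *s q"
    using assms by (intro dhopf_eq_0) (simp_all add: dhopf_diff)
  moreover have "herm (v - w) q = 0"
    using assms herm_add [of "v - w" w q] by (simp add: horizontal_iff)
  ultimately show ?thesis by simp
qed

lemma dhopf_smult:
  assumes "cmod c = 1"
  shows "dhopf (c *s q) (c *s v) = dhopf q v"
proof -
  have "c * cnj c = 1" using assms by (metis complex_norm_square of_real_1 power_one)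
  then have "(c * x) * cnj (c * y) = x * cnj y" for x y
    by (metis (no_types, opaque_lifting) complex_cnj_mult mult.assoc mult.left_commute mult_1)
  then show ?thesis unfolding dhopf_eq by (simp only: vector_smult_component)
qed

text \<open>Change of the base point in the fibre.\<close>
lemma hopf_fibre:
  assumes "q \<in> S7" "r \<in> S7" "hopf r = hopf q"
  obtains c where "c * cnj c = 1" "cmod c = 1" "q = c *s r" "r = cnj c *s q"
    "\<And>v. dhopf r v = dhopf q (c *s v)"
    "\<And>v w :: complex^4. (c *s v) \<bullet> (c *s w) = v \<bullet> w"
proof -
  obtain c where c: "cmod c = 1" "q = c *s r"
    using assms hopf_eq_iff [of r q] by blast
  have cc: "c * cnj c = 1" using c(1) by (metis complex_norm_square of_real_1 power_one)
  show ?thesis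
  proof
    show "r = cnj c *s q" using c cc by (metis mult.commute vector_smult_assoc vector_smult_lid)
    show "dhopf r v = dhopf q (c *s v)" for v using c dhopf_smult by metis
    show "(c *s v) \<bullet> (c *s w) = v \<bullet> w" for v w :: "complex^4"
    proof -
      have "herm (c *s v) (c *s w) = (c * cnj c) * herm v w"
        unfolding herm_smult by (simp only: mult_ac)
      then show ?thesis unfolding inner_herm cc by simp
    qed
  qed (use c cc in auto)
qed

lemma jmul_smult: "jmul (c *s q) = cnj c *s jmul q"
  by (simp add: vec_eq_iff forall_4)

lemma span_jk: "span {jmul q, kmul q} = range (\<lambda>c. c *s jmul q)"
proof (intro equalityI subsetI)
  fix v assume "v \<in> span {jmul q, kmul q}"
  then obtain x y where "v = x *\<^sub>R jmul q + y *\<^sub>R kmul q"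
    by (auto simp: span_insert span_singleton algebra_simps)
  then have "v $ a = Complex x y * jmul q $ a" for a
    by (simp add: kmul_def complex_eq_iff)
  then have "v = Complex x y *s jmul q"
    by (simp only: vec_eq_iff vector_smult_component) simp
  then show "v \<in> range (\<lambda>c. c *s jmul q)" by blast
next
  fix v assume "v \<in> range (\<lambda>c. c *s jmul q)"
  then obtain c where "v = c *s jmul q" by blast
  then have "v $ a = (Re c *\<^sub>R jmul q + Im c *\<^sub>R kmul q) $ a" for a
    by (simp add: kmul_def complex_eq_iff)
  then have "v = Re c *\<^sub>R jmul q + Im c *\<^sub>R kmul q"
    by (simp only: vec_eq_iff) simp
  then show "v \<in> span {jmul q, kmul q}"
    by (simp add: span_add span_base span_scale)
qed

lemma herm_jmul: "herm (jmul q) q = 0"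
  by (simp add: herm_def sum_4)

lemma herm_commute: "herm v q = cnj (herm q v)"
  by (simp add: herm_def mult.commute)

text \<open>The horizontal lifts of \<open>D1\<close> and \<open>D2\<close>.\<close>
definition H1 :: "complex^4 \<Rightarrow> (complex^4) set" where
  "H1 q = span {jmul q, kmul q}"

definition H2 :: "complex^4 \<Rightarrow> (complex^4) set" where
  "H2 q = {v \<in> tangent_S7 q. \<forall>u \<in> span {\<i> *s q, jmul q, kmul q}. v \<bullet> u = 0}"

lemma H1_iff: "v \<in> H1 q \<longleftrightarrow> (\<exists>c. v = c *s jmul q)"
  by (auto simp: H1_def span_jk)

lemma H2_iff: "v \<in> H2 q \<longleftrightarrow> herm v q = 0 \<and> herm v (jmul q) = 0"
proof -
  have "(\<forall>u \<in> span S. v \<bullet> u = 0) \<longleftrightarrow> (\<forall>u \<in> S. v \<bullet> u = 0)" for S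
    using orthogonal_to_span [of _ S v] span_base [of _ S] unfolding orthogonal_def by blast
  then show ?thesis
    by (auto simp: H2_def tangent_S7_def kmul_def inner_i_herm complex_eq_iff)
      (auto simp: inner_herm)
qed

lemma H1_horizontal: "v \<in> H1 q \<Longrightarrow> v \<in> horizontal q"
  by (auto simp: H1_iff horizontal_iff herm_smult herm_jmul)

lemma H2_horizontal: "v \<in> H2 q \<Longrightarrow> v \<in> horizontal q"
  by (simp add: H2_iff horizontal_iff)

lemma horizontal_add: "v \<in> horizontal q \<Longrightarrow> w \<in> horizontal q \<Longrightarrow> v + w \<in> horizontal q"
  by (simp add: horizontal_iff herm_add)

lemma horizontal_smult: "v \<in> horizontal q \<Longrightarrow> c *s v \<in> horizontal q"
  by (simp add: horizontal_iff herm_smult)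

lemma H1_H2_unique:
  assumes "v1 \<in> H1 q" "w1 \<in> H1 q" "v2 \<in> H2 q" "w2 \<in> H2 q" "v1 + v2 = w1 + w2"
  shows "v1 = w1 \<and> v2 = w2"
proof -
  obtain c d where c: "v1 = c *s jmul q" and d: "w1 = d *s jmul q"
    using assms by (auto simp: H1_iff)
  have "herm (v1 + v2) (jmul q) = herm (w1 + w2) (jmul q)" using assms by simp
  then have "c * herm (jmul q) (jmul q) = d * herm (jmul q) (jmul q)"
    using assms by (simp add: herm_add c d herm_smult H2_iff)
  moreover have "jmul q = 0" if "herm (jmul q) (jmul q) = 0"
    using that inner_eq_zero_iff [of "jmul q"] by (simp add: inner_herm)
  ultimately have "v1 = w1" using c d by auto
  then show ?thesis using assms(5) by simp
qed

lemma D1_hopf: "q \<in> S7 \<Longrightarrow> D1 (hopf q) = dhopf q ` span {jmul q, kmul q}"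
proof (intro equalityI subsetI)
  assume q: "q \<in> S7"
  fix X assume "X \<in> D1 (hopf q)"
  then obtain r v where r: "r \<in> S7" "hopf r = hopf q" "v \<in> H1 r" "X = dhopf r v"
    by (auto simp: D1_def H1_def)
  obtain c where c: "r = cnj c *s q" "dhopf r v = dhopf q (c *s v)"
    using hopf_fibre [OF q r(1,2)] by metis
  have "c *s v \<in> H1 q"
    using r(3) by (auto simp: H1_iff c(1) jmul_smult vector_smult_assoc)
  then show "X \<in> dhopf q ` span {jmul q, kmul q}" using r c by (auto simp: H1_def)
qed (auto simp: D1_def)

lemma D2_hopf:
  "q \<in> S7 \<Longrightarrow> D2 (hopf q) =
     dhopf q ` {v \<in> tangent_S7 q. \<forall>u \<in> span {\<i> *s q, jmul q, kmul q}. v \<bullet> u = 0}"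
  unfolding H2_def [symmetric]
proof (intro equalityI subsetI)
  assume q: "q \<in> S7"
  fix X assume "X \<in> D2 (hopf q)"
  then obtain r v where r: "r \<in> S7" "hopf r = hopf q" "v \<in> H2 r" "X = dhopf r v"
    by (auto simp: D2_def H2_def)
  obtain c where c: "c * cnj c = 1" "r = cnj c *s q" "dhopf r v = dhopf q (c *s v)"
    using hopf_fibre [OF q r(1,2)] by metis
  have "c *s v \<in> H2 q"
    using r(3) c(1) by (auto simp: H2_iff c(2) jmul_smult herm_smult)
  then show "X \<in> dhopf q ` H2 q" using r c by auto
qed (auto simp: D2_def H2_def)

lemma g1_hopf:
  assumes q: "q \<in> S7" "v \<in> horizontal q" "w \<in> horizontal q"
  shows "g1 (hopf q) (dhopf q v) (dhopf q w) = v \<bullet> w"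
  unfolding g1_def
proof (rule the_equality)
  fix s assume "\<exists>r v' w'. r \<in> S7 \<and> hopf r = hopf q \<and> v' \<in> horizontal r \<and> w' \<in> horizontal r \<and>
     dhopf q v = dhopf r v' \<and> dhopf q w = dhopf r w' \<and> s = v' \<bullet> w'"
  then obtain r v' w' where r: "r \<in> S7" "hopf r = hopf q" "v' \<in> horizontal r" "w' \<in> horizontal r"
    "dhopf q v = dhopf r v'" "dhopf q w = dhopf r w'" "s = v' \<bullet> w'" by blast
  obtain c where c: "c * cnj c = 1" "r = cnj c *s q" "\<And>v. dhopf r v = dhopf q (c *s v)"
     "\<And>v w :: complex^4. (c *s v) \<bullet> (c *s w) = v \<bullet> w"
    using hopf_fibre [OF q(1) r(1,2)] by metis
  have "c \<noteq> 0" using c(1) by auto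
  then have "c *s v' \<in> horizontal q" "c *s w' \<in> horizontal q"
    using r c(2) by (auto simp: horizontal_iff herm_smult)
  then have "v = c *s v'" "w = c *s w'"
    using dhopf_horizontal_inj q r(5,6) c(3) by metis+
  then show "s = v \<bullet> w" using c(4) r(7) by metis
qed (use assms in blast)

lemma J1_hopf:
  assumes q: "q \<in> S7" "v \<in> horizontal q"
  shows "J1 (hopf q) (dhopf q v) = dhopf q (\<i> *s v)"
  unfolding J1_def
proof (rule the_equality)
  fix Y assume "\<exists>r v'. r \<in> S7 \<and> hopf r = hopf q \<and> v' \<in> horizontal r \<and>
     dhopf q v = dhopf r v' \<and> Y = dhopf r (\<i> *s v')"
  then obtain r v' where r: "r \<in> S7" "hopf r = hopf q" "v' \<in> horizontal r"
    "dhopf q v = dhopf r v'" "Y = dhopf r (\<i> *s v')" by blast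
  obtain c where c: "c * cnj c = 1" "r = cnj c *s q" "\<And>v. dhopf r v = dhopf q (c *s v)"
    using hopf_fibre [OF q(1) r(1,2)] by metis
  have "c \<noteq> 0" using c(1) by auto
  then have "c *s v' \<in> horizontal q"
    using r c(2) by (auto simp: horizontal_iff herm_smult)
  then have "v = c *s v'"
    using dhopf_horizontal_inj q r(4) c(3) by metis
  then show "Y = dhopf q (\<i> *s v)"
    using c(3) r(5) by (simp add: vector_smult_assoc mult.commute)
qed (use assms in blast)

lemma D1_D2_unique:
  assumes "q \<in> S7" "v1 \<in> H1 q" "v2 \<in> H2 q" "X1 \<in> D1 (hopf q)" "X2 \<in> D2 (hopf q)"
    "dhopf q (v1 + v2) = X1 + X2"
  shows "X1 = dhopf q v1 \<and> X2 = dhopf q v2"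
proof -
  obtain w1 w2 where w: "w1 \<in> H1 q" "w2 \<in> H2 q" "X1 = dhopf q w1" "X2 = dhopf q w2"
    using assms by (auto simp: D1_hopf D2_hopf H1_def H2_def)
  have "v1 + v2 = w1 + w2"
  proof (rule dhopf_horizontal_inj [OF assms(1)])
    show "v1 + v2 \<in> horizontal q" "w1 + w2 \<in> horizontal q"
      using assms w by (blast intro: horizontal_add H1_horizontal H2_horizontal)+
    show "dhopf q (v1 + v2) = dhopf q (w1 + w2)" using assms(6) w by (simp add: dhopf_add)
  qed
  then show ?thesis using H1_H2_unique assms w by blast
qed

lemma J_hopf:
  assumes q: "q \<in> S7" "v1 \<in> span {jmul q, kmul q}"
    "v2 \<in> tangent_S7 q" "\<And>u. u \<in> span {\<i> *s q, jmul q, kmul q} \<Longrightarrow> v2 \<bullet> u = 0"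
  shows "J (hopf q) (dhopf q (v1 + v2)) = dhopf q (- (\<i> *s v1) + \<i> *s v2)"
proof -
  have v: "v1 \<in> H1 q" "v2 \<in> H2 q" using q by (auto simp: H1_def H2_def)
  have D: "dhopf q v1 \<in> D1 (hopf q)" "dhopf q v2 \<in> D2 (hopf q)"
    using q(1) v by (auto simp: D1_hopf D2_hopf H1_def H2_def)
  have eq: "dhopf q (- (\<i> *s v1) + \<i> *s v2)
      = - J1 (hopf q) (dhopf q v1) + J1 (hopf q) (dhopf q v2)"
    using v q(1) by (simp add: J1_hopf H1_horizontal H2_horizontal dhopf_add dhopf_uminus dhopf_diff)
  show ?thesis
    unfolding J_def
  proof (rule the_equality)
    show "\<exists>X1\<in>D1 (hopf q). \<exists>X2\<in>D2 (hopf q). dhopf q (v1 + v2) = X1 + X2 \<and>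
        dhopf q (- (\<i> *s v1) + \<i> *s v2) = - J1 (hopf q) X1 + J1 (hopf q) X2"
      using D eq dhopf_add by metis
    fix Y assume "\<exists>X1\<in>D1 (hopf q). \<exists>X2\<in>D2 (hopf q). dhopf q (v1 + v2) = X1 + X2 \<and>
        Y = - J1 (hopf q) X1 + J1 (hopf q) X2"
    then show "Y = dhopf q (- (\<i> *s v1) + \<i> *s v2)"
      using D1_D2_unique [OF q(1) v] eq by metis
  qed
qed

lemma g_hopf:
  assumes q: "q \<in> S7"
    "v1 \<in> span {jmul q, kmul q}" "w1 \<in> span {jmul q, kmul q}"
    "v2 \<in> tangent_S7 q" "\<And>u. u \<in> span {\<i> *s q, jmul q, kmul q} \<Longrightarrow> v2 \<bullet> u = 0"
    "w2 \<in> tangent_S7 q" "\<And>u. u \<in> span {\<i> *s q, jmul q, kmul q} \<Longrightarrow> w2 \<bullet> u = 0"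
  shows "g (hopf q) (dhopf q (v1 + v2)) (dhopf q (w1 + w2)) = v1 \<bullet> w1 + 2 * (v2 \<bullet> w2)"
proof -
  have v: "v1 \<in> H1 q" "v2 \<in> H2 q" and w: "w1 \<in> H1 q" "w2 \<in> H2 q"
    using q by (auto simp: H1_def H2_def)
  have D: "dhopf q v1 \<in> D1 (hopf q)" "dhopf q v2 \<in> D2 (hopf q)"
    "dhopf q w1 \<in> D1 (hopf q)" "dhopf q w2 \<in> D2 (hopf q)"
    using q(1) v w by (auto simp: D1_hopf D2_hopf H1_def H2_def)
  have eq: "v1 \<bullet> w1 + 2 * (v2 \<bullet> w2) = g1 (hopf q) (dhopf q v1) (dhopf q w1)
      + 2 * g1 (hopf q) (dhopf q v2) (dhopf q w2)"
    using v w q(1) by (simp add: g1_hopf H1_horizontal H2_horizontal)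
  show ?thesis
    unfolding g_def
  proof (rule the_equality)
    show "\<exists>X1\<in>D1 (hopf q). \<exists>X2\<in>D2 (hopf q). \<exists>Y1\<in>D1 (hopf q). \<exists>Y2\<in>D2 (hopf q).
        dhopf q (v1 + v2) = X1 + X2 \<and> dhopf q (w1 + w2) = Y1 + Y2 \<and>
        v1 \<bullet> w1 + 2 * (v2 \<bullet> w2) = g1 (hopf q) X1 Y1 + 2 * g1 (hopf q) X2 Y2"
      using D eq dhopf_add by metis
    fix r assume "\<exists>X1\<in>D1 (hopf q). \<exists>X2\<in>D2 (hopf q). \<exists>Y1\<in>D1 (hopf q). \<exists>Y2\<in>D2 (hopf q).
        dhopf q (v1 + v2) = X1 + X2 \<and> dhopf q (w1 + w2) = Y1 + Y2 \<and>
        r = g1 (hopf q) X1 Y1 + 2 * g1 (hopf q) X2 Y2"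
    then show "r = v1 \<bullet> w1 + 2 * (v2 \<bullet> w2)"
      using D1_D2_unique [OF q(1) v] D1_D2_unique [OF q(1) w] eq by metis
  qed
qed

text \<open>Every tangent vector of \<open>\<complex>P\<^sup>3\<close> lies in \<open>D1 \<oplus> D2\<close>.\<close>
lemma horizontal_decomp:
  assumes "q \<in> S7" "v \<in> tangent_S7 q"
  obtains v1 v2 where "v1 \<in> H1 q" "v2 \<in> H2 q" "dhopf q v = dhopf q (v1 + v2)"
proof -
  have jq: "herm (jmul q) (jmul q) = 1"
    using herm_self [OF assms(1)] by (simp add: herm_def sum_4 algebra_simps)
  define w where "w = v - herm v q *s q"
  have w0: "herm w q = 0"
    using herm_add [of w "herm v q *s q" q] herm_self [OF assms(1)] by (simp add: w_def herm_smult)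
  define v1 where "v1 = herm w (jmul q) *s jmul q"
  have hw: "herm w u = herm v1 u + herm (w - v1) u" for u
    using herm_add [of v1 "w - v1" u] by simp
  have "herm (w - v1) q = 0"
    using hw [of q] w0 by (simp add: v1_def herm_smult herm_jmul)
  moreover have "herm (w - v1) (jmul q) = 0"
    using hw [of "jmul q"] jq by (simp add: v1_def herm_smult)
  ultimately have "w - v1 \<in> H2 q" by (simp add: H2_iff)
  moreover have "v1 \<in> H1 q" by (auto simp: H1_iff v1_def)
  moreover have "dhopf q v = dhopf q (v1 + (w - v1))"
  proof -
    have "Re (herm v q) = 0" using assms(2) by (simp add: tangent_S7_def inner_herm)
    then have "cnj (herm v q) = - herm v q" by (simp add: complex_eq_iff)
    then have "dhopf q (herm v q *s q) = 0"
      by (simp add: dhopf_eq vec_eq_iff)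
    then show ?thesis by (simp add: w_def dhopf_diff)
  qed
  ultimately show ?thesis using that by blast
qed

end

theory Submission
  imports Defs
begin

text \<open>
  A local lift \<open>q\<close> of the immersion to \<open>S\<^sup>7\<close>, completed by a unit vector \<open>p\<close> quaternionically orthogonal
  to \<open>q\<close>, is a lift to \<open>Sp(2)\<close>; its Maurer--Cartan form gives the structure equations. For a
  Lagrangian immersion the phase of \<open>q\<close> and the choice of \<open>p\<close> can be adapted so that the forms along
  \<open>j q\<close>, \<open>p\<close> and \<open>j p\<close> become \<open>cos \<theta> t\<^sub>1 + i sin \<theta> t\<^sub>2\<close>, \<open>(sin \<theta> t\<^sub>1 + i cos \<theta> t\<^sub>2) / \<surd>2\<close> and
  \<open>i t\<^sub>3 / \<surd>2\<close> for an orthonormal coframe \<open>t\<close> and an angle function \<open>0 \<le> \<theta> \<le> \<pi>/4\<close>. The remaining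
  forms are then components of the second fundamental form, a traceless cubic form.

  If the curvature is constant, Gauss' equation and the Jacobi identity for the three matrices of the
  cubic form make the latter linear in three functions with coefficients in \<open>s = sin\<^sup>2 \<theta>\<close>. The equation
  \<open>d (d s) = 0\<close> together with the differentiated Gauss equations forces \<open>s\<close> to be constant, and the
  structure equations for constant \<open>s\<close> are contradictory. The degenerate angles \<open>\<theta> = 0\<close> and
  \<open>\<theta> = \<pi>/4\<close> are treated separately.
\<close>

section \<open>Calculus of smooth functions\<close>

text \<open>The frame costs a fourth root of a phase: turning \<open>q\<close> by rho multiplies the
  complex square of \<open>be1 + i be2\<close> by rho^4, and the modulus of that square is cos (2
  theta). An adapted frame is therefore smooth only where theta avoids its extreme values, or where
  theta equals one of them on a whole open set. If no point has an intermediate angle, continuity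
  yields such an open set.

  The generic case hinges on the third frame vector \<open>E 3\<close>. The commutators of the three
  matrices of the cubic form are multiples of elementary skew matrices, with factors K minus an
  ambient curvature. The Jacobi identity kills the component with three distinct indices, and that
  component is, up to sign, the derivative of theta along \<open>E 3\<close>. So every coefficient
  depending on \<open>s\<close> is constant in that direction, and differentiating the Gauss
  equations along it gives linear equations for the derivatives of the three unknown functions. The
  curvature K is never determined: it cancels in differences, or it disappears when a polynomial in
  \<open>s\<close> is evaluated at a point where its factor vanishes.\<close>

abbreviation D :: "('a::real_normed_vector \<Rightarrow> 'b::real_normed_vector) \<Rightarrow> 'a \<Rightarrow> 'a \<Rightarrow> 'b"
  where "D f x \<equiv> frechet_derivative f (at x)"

lemma D_unique: "(f has_derivative f') (at x) \<Longrightarrow> D f x = f'"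
  by (metis frechet_derivative_at)

lemma D_cong:
  assumes "open S" "x \<in> S" "\<And>y. y \<in> S \<Longrightarrow> f y = h y" "f differentiable at x"
  shows "D f x = D h x" "h differentiable at x"
proof -
  have "(f has_derivative D f x) (at x)" using assms(4) by (simp add: frechet_derivative_works)
  then have "(h has_derivative D f x) (at x)"
    by (rule has_derivative_transform_within_open [OF _ assms(1,2)]) (use assms(3) in auto)
  then show "D f x = D h x" "h differentiable at x"
    by (auto simp: D_unique differentiable_def)
qed

lemma Ck_on_cong:
  assumes "open S" "\<And>x. x \<in> S \<Longrightarrow> f x = h x" "Ck_on k f S"
  shows "Ck_on k h S"
  using assms(2,3)
proof (induction k arbitrary: f h)
  case 0
  then show ?case by (simp cong: continuous_on_cong)
next
  case (Suc k)
  have *: "x \<in> S \<Longrightarrow> D f x = D h x \<and> h differentiable at x" for x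
    using D_cong [OF assms(1), of x f h] Suc.prems by auto
  have "Ck_on k (\<lambda>x. D h x v) S" for v
    using Suc.IH [of "\<lambda>x. D f x v" "\<lambda>x. D h x v"] * Suc.prems(2) by simp
  then show ?case using * by simp
qed

lemma Ck_on_SucD: "Ck_on (Suc k) f S \<Longrightarrow> Ck_on k f S"
proof (induction k arbitrary: f)
  case 0
  then show ?case
    by (auto intro!: continuous_at_imp_continuous_on differentiable_imp_continuous_within)
next
  case (Suc k)
  then show ?case by (metis Ck_on.simps(2))
qed

lemma Ck_on_add:
  fixes f h :: "'a::euclidean_space \<Rightarrow> 'b::real_normed_vector"
  assumes "open S" "Ck_on k f S" "Ck_on k h S"
  shows "Ck_on k (\<lambda>x. f x + h x) S"
  using assms(2,3)
proof (induction k arbitrary: f h)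
  case 0
  then show ?case by (simp add: continuous_on_add)
next
  case (Suc k)
  have "((\<lambda>x. f x + h x) has_derivative (\<lambda>v. D f x v + D h x v)) (at x)" if "x \<in> S" for x
    using that Suc.prems
    by (intro has_derivative_add) (auto simp: frechet_derivative_works [symmetric])
  note d = this D_unique [OF this]
  have "Ck_on k (\<lambda>x. D f x v + D h x v) S" for v
    using Suc by auto
  then have "Ck_on k (\<lambda>x. D (\<lambda>x. f x + h x) x v) S" for v
    by (rule Ck_on_cong [OF assms(1), rotated]) (simp add: d)
  moreover have "\<forall>x\<in>S. (\<lambda>x. f x + h x) differentiable at x"
    using d differentiable_def by blast
  ultimately show ?case by simp
qed

text \<open>One product rule serves scaling, products, inner products and linear maps. The induction
  varies both factors, since the derivative is a sum of two bilinear terms in other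
  functions.\<close>

lemma Ck_on_bilinear:
  fixes f :: "'a::euclidean_space \<Rightarrow> 'b::real_normed_vector" and h :: "'a \<Rightarrow> 'c::real_normed_vector"
    and B :: "'b \<Rightarrow> 'c \<Rightarrow> 'd::real_normed_vector"
  assumes "bounded_bilinear B" "open S" "Ck_on k f S" "Ck_on k h S"
  shows "Ck_on k (\<lambda>x. B (f x) (h x)) S"
  using assms(3,4)
proof (induction k arbitrary: f h)
  case 0
  then show ?case using bounded_bilinear.continuous_on [OF assms(1)] by simp
next
  case (Suc k)
  have d: "((\<lambda>x. B (f x) (h x)) has_derivative (\<lambda>v. B (f x) (D h x v) + B (D f x v) (h x))) (at x)"
    if "x \<in> S" for x
    using that Suc.prems
    by (intro bounded_bilinear.FDERIV [OF assms(1)]) (auto simp: frechet_derivative_works [symmetric])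
  have "Ck_on k f S" "Ck_on k h S" using Suc.prems Ck_on_SucD by blast+
  then have "Ck_on k (\<lambda>x. B (f x) (D h x v) + B (D f x v) (h x)) S" for v
    using Suc by (intro Ck_on_add assms(2)) auto
  then have "Ck_on k (\<lambda>x. D (\<lambda>x. B (f x) (h x)) x v) S" for v
    by (rule Ck_on_cong [OF assms(2), rotated]) (simp add: D_unique [OF d])
  moreover have "\<forall>x\<in>S. (\<lambda>x. B (f x) (h x)) differentiable at x"
    using d differentiable_def by blast
  ultimately show ?case by simp
qed

lemma Ck_on_const: "Ck_on k (\<lambda>x::'a::euclidean_space. c :: 'b::real_normed_vector) S"
proof (induction k arbitrary: c)
  case (Suc k)
  have "(\<lambda>x::'a. D (\<lambda>x. c) x v) = (\<lambda>x. 0)" for v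
    by (simp only: frechet_derivative_const)
  then show ?case using Suc [of 0] by (simp only: Ck_on.simps) simp
qed simp

named_theorems smooth_intros

lemma smooth_on_bilinear:
  assumes "bounded_bilinear B" "open S" "smooth_on S f" "smooth_on S h"
  shows "smooth_on S (\<lambda>x. B (f x) (h x))"
  using assms Ck_on_bilinear unfolding smooth_on_def by blast

lemma smooth_on_const [smooth_intros]: "smooth_on S (\<lambda>x. c)"
  by (simp add: smooth_on_def Ck_on_const)

lemmas smooth_on_scaleR [smooth_intros] = smooth_on_bilinear [OF bounded_bilinear_scaleR]
lemmas smooth_on_mult [smooth_intros] = smooth_on_bilinear [OF bounded_bilinear_mult]
lemmas smooth_on_inner [smooth_intros] = smooth_on_bilinear [OF bounded_bilinear_inner]

lemma smooth_on_linear: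
  fixes L :: "'b::real_normed_vector \<Rightarrow> 'c::real_normed_vector"
  assumes "bounded_linear L" "open S" "smooth_on S f"
  shows "smooth_on S (\<lambda>x. L (f x))"
proof -
  \<comment> \<open>A linear map is treated as a bilinear one whose scalar argument is the constant
    1.\<close>
  have "bounded_bilinear (\<lambda>(r::real) v. r *\<^sub>R L v)"
    using bounded_bilinear.comp [OF bounded_bilinear_scaleR bounded_linear_ident assms(1)] .
  from smooth_on_bilinear [OF this assms(2) smooth_on_const assms(3), of 1]
  show ?thesis by simp
qed

lemma smooth_on_cong:
  assumes "open S" "\<And>x. x \<in> S \<Longrightarrow> f x = h x" "smooth_on S f"
  shows "smooth_on S h"
  using assms Ck_on_cong unfolding smooth_on_def by blast

lemma smooth_on_add [smooth_intros]:
  "open S \<Longrightarrow> smooth_on S f \<Longrightarrow> smooth_on S h \<Longrightarrow> smooth_on S (\<lambda>x. f x + h x)"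
  using Ck_on_add unfolding smooth_on_def by blast

lemma smooth_on_uminus [smooth_intros]:
  assumes "open S" "smooth_on S f"
  shows "smooth_on S (\<lambda>x. - f x)"
  using smooth_on_linear [OF bounded_linear_minus [OF bounded_linear_ident] assms] by simp

lemma smooth_on_diff [smooth_intros]:
  assumes "open S" "smooth_on S f" "smooth_on S h"
  shows "smooth_on S (\<lambda>x. f x - h x)"
  using smooth_on_add [OF assms(1,2) smooth_on_uminus [OF assms(1,3)]] by simp

lemma smooth_on_sum [smooth_intros]:
  assumes "open S" "\<And>i. i \<in> I \<Longrightarrow> smooth_on S (f i)"
  shows "smooth_on S (\<lambda>x. \<Sum>i\<in>I. f i x)"
  using assms(2)
  by (induction I rule: infinite_finite_induct) (auto intro!: smooth_intros assms(1))

lemma smooth_on_power [smooth_intros]: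
  fixes f :: "'a::euclidean_space \<Rightarrow> 'b::real_normed_algebra_1"
  assumes "open S" "smooth_on S f"
  shows "smooth_on S (\<lambda>x. f x ^ n)"
  by (induction n) (auto intro!: smooth_intros assms)

lemma smooth_on_differentiable: "smooth_on S f \<Longrightarrow> x \<in> S \<Longrightarrow> f differentiable at x"
  unfolding smooth_on_def using Ck_on.simps(2) by blast

lemma smooth_on_D: "smooth_on S f \<Longrightarrow> smooth_on S (\<lambda>x. D f x v)"
  unfolding smooth_on_def using Ck_on.simps(2) by blast

lemma smooth_on_continuous: "smooth_on S f \<Longrightarrow> continuous_on S f"
  unfolding smooth_on_def using Ck_on.simps(1) by blast

lemma Ck_on_subset: "Ck_on k f S \<Longrightarrow> T \<subseteq> S \<Longrightarrow> Ck_on k f T"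
  by (induction k arbitrary: f) (auto intro: continuous_on_subset)

lemma smooth_on_subset: "smooth_on S f \<Longrightarrow> T \<subseteq> S \<Longrightarrow> smooth_on T f"
  unfolding smooth_on_def using Ck_on_subset by blast

text \<open>Bootstrapping: each derivative inherits the order of smoothness of \<open>f\<close>,
  which raises the order of \<open>f\<close> by one. It serves functions such as
  \<open>inverse\<close> and \<open>sqrt\<close>, whose derivatives are smooth expressions times the
  function itself.\<close>

lemma smooth_onI_derivative:
  assumes S: "open S"
    and diff: "\<And>x. x \<in> S \<Longrightarrow> f differentiable at x"
    and step: "\<And>k v. Ck_on k f S \<Longrightarrow> Ck_on k (\<lambda>x. D f x v) S"
  shows "smooth_on S f"
proof -
  have "Ck_on k f S" for k
  proof (induction k)
    case 0
    then show ?case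
      using diff by (auto intro!: continuous_at_imp_continuous_on differentiable_imp_continuous_within)
  qed (use diff step in auto)
  then show ?thesis by (simp add: smooth_on_def)
qed

lemma smooth_on_inverse [smooth_intros]:
  fixes f :: "'a::euclidean_space \<Rightarrow> real"
  assumes S: "open S" and f: "smooth_on S f" and nz: "\<And>x. x \<in> S \<Longrightarrow> f x \<noteq> 0"
  shows "smooth_on S (\<lambda>x. inverse (f x))"
proof (rule smooth_onI_derivative [OF S])
  have d: "((\<lambda>x. inverse (f x)) has_derivative (\<lambda>v. - (inverse (f x) * D f x v * inverse (f x)))) (at x)"
    if "x \<in> S" for x
    using that nz smooth_on_differentiable [OF f that]
    by (intro Deriv.has_derivative_inverse) (auto simp: frechet_derivative_works [symmetric])
  show "(\<lambda>x. inverse (f x)) differentiable at x" if "x \<in> S" for x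
    using d [OF that] by (auto simp: differentiable_def)
  show "Ck_on k (\<lambda>x. D (\<lambda>x. inverse (f x)) x v) S" if "Ck_on k (\<lambda>x. inverse (f x)) S" for k v
  proof (rule Ck_on_cong [OF S])
    show "x \<in> S \<Longrightarrow> (-1) * (inverse (f x) * D f x v * inverse (f x)) = D (\<lambda>x. inverse (f x)) x v" for x
      by (simp add: D_unique [OF d])
    show "Ck_on k (\<lambda>x. (-1) * (inverse (f x) * D f x v * inverse (f x))) S"
      using smooth_on_D [OF f, of v] that unfolding smooth_on_def
      by (intro Ck_on_bilinear [OF bounded_bilinear_mult S] Ck_on_const) auto
  qed
qed

lemma smooth_on_divide [smooth_intros]:
  fixes f h :: "'a::euclidean_space \<Rightarrow> real"
  assumes "open S" "smooth_on S f" "smooth_on S h" "\<And>x. x \<in> S \<Longrightarrow> h x \<noteq> 0"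
  shows "smooth_on S (\<lambda>x. f x / h x)"
  unfolding divide_inverse using assms by (intro smooth_intros)

lemma smooth_on_sqrt [smooth_intros]:
  fixes f :: "'a::euclidean_space \<Rightarrow> real"
  assumes S: "open S" and f: "smooth_on S f" and pos: "\<And>x. x \<in> S \<Longrightarrow> f x > 0"
  shows "smooth_on S (\<lambda>x. sqrt (f x))"
proof -
  have d: "((\<lambda>x. sqrt (f x)) has_derivative (\<lambda>v. D f x v * (inverse (sqrt (f x)) / 2))) (at x)"
    if "x \<in> S" for x
    using that pos smooth_on_differentiable [OF f that]
    by (intro has_derivative_real_sqrt) (auto simp: frechet_derivative_works [symmetric])
  \<comment> \<open>Brings the derivative of the root into the form smooth factor times root, as the
    bootstrapping rule requires.\<close>
  have r: "inverse (sqrt y) = inverse y * sqrt y" if "y > 0" for y :: real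
    using that by (simp add: field_simps)
  show ?thesis
  proof (rule smooth_onI_derivative [OF S])
    show "(\<lambda>x. sqrt (f x)) differentiable at x" if "x \<in> S" for x
      using d [OF that] by (auto simp: differentiable_def)
    show "Ck_on k (\<lambda>x. D (\<lambda>x. sqrt (f x)) x v) S" if "Ck_on k (\<lambda>x. sqrt (f x)) S" for k v
    proof (rule Ck_on_cong [OF S])
      show "x \<in> S \<Longrightarrow> (1/2) * (D f x v * inverse (f x)) * sqrt (f x) = D (\<lambda>x. sqrt (f x)) x v" for x
        using pos [of x] by (simp add: D_unique [OF d] r)
      have "smooth_on S (\<lambda>x. (1/2) * (D f x v * inverse (f x)))"
        using pos by (intro smooth_intros S f smooth_on_D) (metis less_irrefl)
      then have "Ck_on k (\<lambda>x. (1/2) * (D f x v * inverse (f x))) S"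
        unfolding smooth_on_def by blast
      then show "Ck_on k (\<lambda>x. (1/2) * (D f x v * inverse (f x)) * sqrt (f x)) S"
        by (rule Ck_on_bilinear [OF bounded_bilinear_mult S _ that])
    qed
  qed
qed

lemma smooth_on_vec_nth [smooth_intros]:
  fixes f :: "'a::euclidean_space \<Rightarrow> 'b::real_normed_vector^'n::finite"
  assumes "open S" "smooth_on S f"
  shows "smooth_on S (\<lambda>x. f x $ i)"
  using smooth_on_linear [OF bounded_linear_vec_nth assms] .

lemma smooth_on_vec_lambda [smooth_intros]:
  fixes f :: "'n::finite \<Rightarrow> 'a::euclidean_space \<Rightarrow> 'b::real_normed_vector"
  assumes S: "open S" and f: "\<And>i. smooth_on S (f i)"
  shows "smooth_on S (\<lambda>x. \<chi> i. f i x)"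
proof -
  have bl: "bounded_linear (\<lambda>y. axis i y :: 'b^'n)" for i
  proof (rule bounded_linear_intro [where K=1])
    have "norm (axis i y :: 'b^'n) \<le> (\<Sum>j\<in>UNIV. norm ((axis i y :: 'b^'n) $ j))" for y
      unfolding norm_vec_def by (rule L2_set_le_sum) auto
    also have "(\<Sum>j\<in>UNIV. norm ((axis i y :: 'b^'n) $ j)) = norm y" for y
      by (simp add: axis_def if_distrib cong: if_cong)
    finally show "norm (axis i y :: 'b^'n) \<le> norm y * 1" for y by simp
  qed (auto simp: vec_eq_iff axis_def)
  have "smooth_on S (\<lambda>x. \<Sum>i\<in>UNIV. axis i (f i x))"
    by (intro smooth_on_sum S smooth_on_linear [OF bl] f)
  moreover have "(\<Sum>i\<in>UNIV. axis i (f i x)) = (\<chi> i. f i x)" for x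
    by (simp add: vec_eq_iff axis_def)
  ultimately show ?thesis by simp
qed


lemma smooth_D: "smooth_on S f \<Longrightarrow> x \<in> S \<Longrightarrow> (f has_derivative D f x) (at x)"
  using smooth_on_differentiable frechet_derivative_works by blast

lemma D_axis:
  fixes f :: "real^'n::finite \<Rightarrow> 'b::real_normed_vector"
  assumes "f differentiable at x"
  shows "D f x X = (\<Sum>i\<in>UNIV. X $ i *\<^sub>R D f x (axis i 1))"
proof -
  have "D f x X = D f x (\<Sum>i\<in>UNIV. X $ i *\<^sub>R axis i 1)"
    by (simp add: basis_expansion scalar_mult_eq_scaleR [symmetric])
  then show ?thesis
    using linear_frechet_derivative [OF assms] by (simp add: linear_sum linear_cmul)
qed

section \<open>Differentiation rules on an open set\<close>

context
  fixes S :: "'a::euclidean_space set" and x :: 'a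
  assumes x: "x \<in> S"
begin

lemma D_add: "smooth_on S f \<Longrightarrow> smooth_on S h \<Longrightarrow> D (\<lambda>x. f x + h x) x v = D f x v + D h x v"
  using D_unique [OF has_derivative_add [OF smooth_D smooth_D]] x by fastforce

lemma D_diff: "smooth_on S f \<Longrightarrow> smooth_on S h \<Longrightarrow> D (\<lambda>x. f x - h x) x v = D f x v - D h x v"
  using D_unique [OF has_derivative_diff [OF smooth_D smooth_D]] x by fastforce

lemma D_uminus: "smooth_on S f \<Longrightarrow> D (\<lambda>x. - f x) x v = - D f x v"
  using D_unique [OF has_derivative_minus [OF smooth_D]] x by fastforce

lemma D_sum:
  "(\<And>i. i \<in> I \<Longrightarrow> smooth_on S (f i)) \<Longrightarrow> D (\<lambda>x. \<Sum>i\<in>I. f i x) x v = (\<Sum>i\<in>I. D (f i) x v)"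
  using D_unique [OF has_derivative_sum [of I f "\<lambda>i. D (f i) x"]] x smooth_D by metis

lemma D_bilinear:
  "bounded_bilinear B \<Longrightarrow> smooth_on S f \<Longrightarrow> smooth_on S h \<Longrightarrow>
    D (\<lambda>x. B (f x) (h x)) x v = B (f x) (D h x v) + B (D f x v) (h x)"
  using D_unique [OF bounded_bilinear.FDERIV [OF _ smooth_D smooth_D]] x by fastforce

lemma D_linear:
  "bounded_linear L \<Longrightarrow> smooth_on S f \<Longrightarrow> D (\<lambda>x. L (f x)) x v = L (D f x v)"
  using D_unique [OF bounded_linear.has_derivative [OF _ smooth_D]] x by fastforce

lemmas D_mult = D_bilinear [OF bounded_bilinear_mult]
lemmas D_scaleR = D_bilinear [OF bounded_bilinear_scaleR]
lemmas D_inner = D_bilinear [OF bounded_bilinear_inner]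
lemmas D_vec_nth = D_linear [OF bounded_linear_vec_nth]

lemma D_power2:
  fixes f :: "'a \<Rightarrow> real"
  shows "smooth_on S f \<Longrightarrow> D (\<lambda>x. (f x)\<^sup>2) x v = 2 * f x * D f x v"
  unfolding power2_eq_square by (simp add: D_mult)

end

lemma D_eq_on_open:
  assumes "open S" "x \<in> S" "smooth_on S f" "\<And>y. y \<in> S \<Longrightarrow> f y = h y"
  shows "D f x v = D h x v"
  using D_cong [OF assms(1,2,4) smooth_on_differentiable [OF assms(3,2)]] by simp

lemma D_eq_0:
  fixes c :: "'b::real_normed_vector"
  assumes "open (S :: 'a::euclidean_space set)" "x \<in> S" "\<And>y. y \<in> S \<Longrightarrow> f y = c"
  shows "D f x v = 0"
proof -
  have "D (\<lambda>_. c) x v = D f x v"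
    by (rule D_eq_on_open [OF assms(1,2) smooth_on_const]) (simp add: assms(3))
  then show ?thesis by simp
qed

text \<open>The mean value theorem is applied in direction \<open>X\<close> to the increment of
  \<open>f\<close> along \<open>Y\<close>, and then in direction \<open>Y\<close> to the derivative
  so obtained.\<close>

lemma second_difference_MVT:
  fixes f :: "'a::euclidean_space \<Rightarrow> real"
  assumes f: "smooth_on S f" and t: "t > 0"
    and S: "\<And>a b. 0 \<le> a \<Longrightarrow> a \<le> t \<Longrightarrow> 0 \<le> b \<Longrightarrow> b \<le> t \<Longrightarrow> x + a *\<^sub>R X + b *\<^sub>R Y \<in> S"
  obtains a b where "0 \<le> a" "a \<le> t" "0 \<le> b" "b \<le> t"
    "f (x + t *\<^sub>R X + t *\<^sub>R Y) - f (x + t *\<^sub>R X) - f (x + t *\<^sub>R Y) + f x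
      = t\<^sup>2 * D (\<lambda>y. D f y X) (x + a *\<^sub>R X + b *\<^sub>R Y) Y"
proof -
  have *: "((\<lambda>r. u (z + r *\<^sub>R V)) has_real_derivative D u (z + r *\<^sub>R V) V) (at r)"
    if "smooth_on S u" "z + r *\<^sub>R V \<in> S" for u :: "'a \<Rightarrow> real" and z V r
  proof -
    have "((\<lambda>r. z + r *\<^sub>R V) has_derivative (\<lambda>h. h *\<^sub>R V)) (at r)"
      by (auto intro!: derivative_eq_intros)
    from has_derivative_compose [OF this smooth_D [OF that]]
    have "((\<lambda>r. u (z + r *\<^sub>R V)) has_derivative (\<lambda>h. D u (z + r *\<^sub>R V) (h *\<^sub>R V))) (at r)" .
    moreover have "D u (z + r *\<^sub>R V) (h *\<^sub>R V) = D u (z + r *\<^sub>R V) V * h" for h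
      using linear_frechet_derivative [OF smooth_on_differentiable [OF that]] by (simp add: linear_cmul)
    ultimately show ?thesis by (simp add: has_field_derivative_def)
  qed
  define p where "p a = f (x + t *\<^sub>R Y + a *\<^sub>R X) - f (x + a *\<^sub>R X)" for a
  have inS: "x + t *\<^sub>R Y + a *\<^sub>R X \<in> S" "x + a *\<^sub>R X \<in> S" if "0 \<le> a" "a \<le> t" for a
    using S [of a t] S [of a 0] that t by (simp_all add: algebra_simps)
  have "(p has_real_derivative (D f (x + t *\<^sub>R Y + a *\<^sub>R X) X - D f (x + a *\<^sub>R X) X)) (at a)"
    if "0 \<le> a" "a \<le> t" for a
    unfolding p_def by (intro DERIV_diff * f inS that)
  then obtain a where a: "0 < a" "a < t"
    "p t - p 0 = t * (D f (x + t *\<^sub>R Y + a *\<^sub>R X) X - D f (x + a *\<^sub>R X) X)"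
    using MVT2 [of 0 t p "\<lambda>a. D f (x + t *\<^sub>R Y + a *\<^sub>R X) X - D f (x + a *\<^sub>R X) X"] t by auto
  have "((\<lambda>b. D f (x + a *\<^sub>R X + b *\<^sub>R Y) X) has_real_derivative
      D (\<lambda>y. D f y X) (x + a *\<^sub>R X + b *\<^sub>R Y) Y) (at b)" if "0 \<le> b" "b \<le> t" for b
    by (intro * smooth_on_D f S) (use a that in auto)
  then obtain b where b: "0 < b" "b < t"
    "D f (x + a *\<^sub>R X + t *\<^sub>R Y) X - D f (x + a *\<^sub>R X + 0 *\<^sub>R Y) X
      = t * D (\<lambda>y. D f y X) (x + a *\<^sub>R X + b *\<^sub>R Y) Y"
    using MVT2 [of 0 t "\<lambda>b. D f (x + a *\<^sub>R X + b *\<^sub>R Y) X"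
        "\<lambda>b. D (\<lambda>y. D f y X) (x + a *\<^sub>R X + b *\<^sub>R Y) Y"] t by auto
  show ?thesis
  proof
    show "f (x + t *\<^sub>R X + t *\<^sub>R Y) - f (x + t *\<^sub>R X) - f (x + t *\<^sub>R Y) + f x
      = t\<^sup>2 * D (\<lambda>y. D f y X) (x + a *\<^sub>R X + b *\<^sub>R Y) Y"
      using a(3) b(3) by (simp add: p_def power2_eq_square algebra_simps)
  qed (use a b in auto)
qed

text \<open>Up to the factor \<open>t^2\<close>, both mixed derivatives take, at points near
  \<open>x\<close>, the value of one second difference, which is symmetric in \<open>X\<close> and
  \<open>Y\<close>. Continuity then forbids different values at \<open>x\<close>.\<close>

lemma D_D_commute_real:
  fixes f :: "'a::euclidean_space \<Rightarrow> real"
  assumes S: "open S" "x \<in> S" and f: "smooth_on S f"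
  shows "D (\<lambda>y. D f y X) x Y = D (\<lambda>y. D f y Y) x X"
proof (rule ccontr)
  define P where "P y = D (\<lambda>y. D f y X) y Y" for y
  define Q where "Q y = D (\<lambda>y. D f y Y) y X" for y
  assume "D (\<lambda>y. D f y X) x Y \<noteq> D (\<lambda>y. D f y Y) x X"
  then have e: "\<bar>P x - Q x\<bar> / 2 > 0" (is "?e > 0") by (simp add: P_def Q_def)
  have "continuous_on S P" "continuous_on S Q"
    unfolding P_def Q_def by (intro smooth_on_continuous smooth_on_D f)+
  then have "isCont P x" "isCont Q x" using S by (auto simp: continuous_on_eq_continuous_at)
  then obtain d1 d2 where d: "d1 > 0" "d2 > 0"
    "\<And>y. dist y x < d1 \<Longrightarrow> dist (P y) (P x) < ?e" "\<And>y. dist y x < d2 \<Longrightarrow> dist (Q y) (Q x) < ?e"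
    using e unfolding continuous_at_eps_delta by metis
  obtain d3 where d3: "d3 > 0" "\<And>y. dist y x < d3 \<Longrightarrow> y \<in> S"
    using S open_dist by metis
  define d where "d = min d1 (min d2 d3)"
  define t where "t = d / (norm X + norm Y + 1)"
  have dpos: "d > 0" using d d3 by (simp add: d_def)
  then have t: "t > 0"
    by (simp add: t_def add_nonneg_pos)
  have near: "dist (x + a *\<^sub>R X + b *\<^sub>R Y) x < d" "dist (x + a *\<^sub>R Y + b *\<^sub>R X) x < d"
    if "0 \<le> a" "a \<le> t" "0 \<le> b" "b \<le> t" for a b
  proof -
    have **: "norm (a *\<^sub>R V + b *\<^sub>R W) < d" if "norm V + norm W = norm X + norm Y" for V W :: 'a
    proof -
      have "norm (a *\<^sub>R V + b *\<^sub>R W) \<le> a * norm V + b * norm W"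
        using norm_triangle_ineq [of "a *\<^sub>R V" "b *\<^sub>R W"] \<open>0 \<le> a\<close> \<open>0 \<le> b\<close> by simp
      also have "\<dots> \<le> t * norm V + t * norm W"
        using \<open>a \<le> t\<close> \<open>b \<le> t\<close> by (intro add_mono mult_right_mono) auto
      also have "\<dots> < t * (norm X + norm Y + 1)"
        using t that by (simp add: distrib_left [symmetric])
      also have "\<dots> = d"
        using add_nonneg_pos [of "norm X + norm Y" 1] by (simp add: t_def)
      finally show ?thesis .
    qed
    show "dist (x + a *\<^sub>R X + b *\<^sub>R Y) x < d" "dist (x + a *\<^sub>R Y + b *\<^sub>R X) x < d"
      using ** [of X Y] ** [of Y X] by (simp_all add: dist_norm add.assoc add.commute)
  qed
  have inS: "x + a *\<^sub>R X + b *\<^sub>R Y \<in> S" "x + a *\<^sub>R Y + b *\<^sub>R X \<in> S"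
    if "0 \<le> a" "a \<le> t" "0 \<le> b" "b \<le> t" for a b
    using near [OF that] d3 by (auto simp: d_def)
  obtain a b where ab: "0 \<le> a" "a \<le> t" "0 \<le> b" "b \<le> t"
    "f (x + t *\<^sub>R X + t *\<^sub>R Y) - f (x + t *\<^sub>R X) - f (x + t *\<^sub>R Y) + f x
      = t\<^sup>2 * P (x + a *\<^sub>R X + b *\<^sub>R Y)"
    using second_difference_MVT [OF f t, of x X Y] inS unfolding P_def by metis
  obtain a' b' where ab': "0 \<le> a'" "a' \<le> t" "0 \<le> b'" "b' \<le> t"
    "f (x + t *\<^sub>R Y + t *\<^sub>R X) - f (x + t *\<^sub>R Y) - f (x + t *\<^sub>R X) + f x
      = t\<^sup>2 * Q (x + a' *\<^sub>R Y + b' *\<^sub>R X)"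
    using second_difference_MVT [OF f t, of x Y X] inS unfolding Q_def by metis
  have "t\<^sup>2 * P (x + a *\<^sub>R X + b *\<^sub>R Y) = t\<^sup>2 * Q (x + a' *\<^sub>R Y + b' *\<^sub>R X)"
  proof -
    have "x + t *\<^sub>R Y + t *\<^sub>R X = x + t *\<^sub>R X + t *\<^sub>R Y" by simp
    then show ?thesis using ab(5) ab'(5) by (simp only:)
  qed
  then have PQ: "P (x + a *\<^sub>R X + b *\<^sub>R Y) = Q (x + a' *\<^sub>R Y + b' *\<^sub>R X)" using t by simp
  have "dist (P (x + a *\<^sub>R X + b *\<^sub>R Y)) (P x) < ?e" "dist (Q (x + a' *\<^sub>R Y + b' *\<^sub>R X)) (Q x) < ?e"
    using near(1) [OF ab(1-4)] near(2) [OF ab'(1-4)] unfolding d_def by (meson d min_less_iff_conj)+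
  then show False using e unfolding dist_real_def PQ by (auto simp: abs_if split: if_splits)
qed

lemma D_D_commute:
  fixes f :: "'a::euclidean_space \<Rightarrow> 'b::euclidean_space"
  assumes S: "open S" "x \<in> S" and f: "smooth_on S f"
  shows "D (\<lambda>y. D f y X) x Y = D (\<lambda>y. D f y Y) x X"
proof (rule euclidean_eqI)
  fix b :: 'b
  have *: "D (\<lambda>y. D f y V) x W \<bullet> b = D (\<lambda>y. D (\<lambda>y. f y \<bullet> b) y V) x W" for V W
  proof -
    have "D (\<lambda>y. D f y V) x W \<bullet> b = D (\<lambda>y. D f y V \<bullet> b) x W"
      using D_linear [OF S(2) bounded_linear_inner_left smooth_on_D [OF f]] by metis
    also have "\<dots> = D (\<lambda>y. D (\<lambda>y. f y \<bullet> b) y V) x W"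
    proof (rule D_eq_on_open [OF S])
      show "smooth_on S (\<lambda>y. D f y V \<bullet> b)" by (intro smooth_intros S smooth_on_D f)
      show "D f y V \<bullet> b = D (\<lambda>y. f y \<bullet> b) y V" if "y \<in> S" for y
        using D_linear [OF that bounded_linear_inner_left f] by metis
    qed
    finally show ?thesis .
  qed
  have "smooth_on S (\<lambda>y. f y \<bullet> b)" by (intro smooth_intros S f)
  from D_D_commute_real [OF S this, of X Y]
  show "D (\<lambda>y. D f y X) x Y \<bullet> b = D (\<lambda>y. D f y Y) x X \<bullet> b" by (simp add: *)
qed

section \<open>Moving frames\<close>

text \<open>One-forms are stored as the vectors that pair with tangent vectors. On constant vector
  fields the exterior derivative has no bracket term.\<close>

definition dform :: "('a::euclidean_space \<Rightarrow> 'a) \<Rightarrow> 'a \<Rightarrow> 'a \<Rightarrow> 'a \<Rightarrow> real" where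
  "dform w x X Y = D w x X \<bullet> Y - D w x Y \<bullet> X"

definition wedge :: "'a::real_inner \<Rightarrow> 'a \<Rightarrow> 'a \<Rightarrow> 'a \<Rightarrow> real" where
  "wedge u v X Y = (u \<bullet> X) * (v \<bullet> Y) - (u \<bullet> Y) * (v \<bullet> X)"

lemma smooth_on_prod [smooth_intros]:
  fixes f :: "'i \<Rightarrow> 'a::euclidean_space \<Rightarrow> real"
  assumes "open S" "\<And>i. i \<in> I \<Longrightarrow> smooth_on S (f i)"
  shows "smooth_on S (\<lambda>x. \<Prod>i\<in>I. f i x)"
  using assms(2)
  by (induction I rule: infinite_finite_induct) (auto intro!: smooth_intros assms(1))

lemma smooth_on_det [smooth_intros]:
  fixes M :: "'a::euclidean_space \<Rightarrow> real^'n::finite^'n"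
  assumes "open S" "\<And>i j. smooth_on S (\<lambda>x. M x $ i $ j)"
  shows "smooth_on S (\<lambda>x. det (M x))"
  unfolding det_def by (intro smooth_intros assms)

lemma invertible_rows:
  fixes M :: "real^'n::finite^'n"
  assumes "\<And>X. (\<And>a. M $ a \<bullet> X = 0) \<Longrightarrow> X = 0"
  shows "invertible M"
proof -
  have "X = 0" if "M *v X = 0" for X
    using that assms [of X] by (simp add: matrix_vector_mult_def inner_vec_def vec_eq_iff)
  then show ?thesis
    using matrix_left_invertible_ker [of M] invertible_left_inverse by blast
qed

lemma rows_solve:
  fixes t :: "'n::finite \<Rightarrow> real^'n" and y :: "'n \<Rightarrow> real"
  assumes "\<And>X. (\<And>a. t a \<bullet> X = 0) \<Longrightarrow> X = 0"
  obtains X where "\<And>a. t a \<bullet> X = y a"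
proof -
  define M where "M = (\<chi> a. t a)"
  have "invertible M" using assms by (intro invertible_rows) (simp add: M_def)
  then obtain N where "M ** N = mat 1" by (auto simp: invertible_def)
  then have "M *v (N *v (\<chi> a. y a)) = (\<chi> a. y a)"
    by (simp add: matrix_vector_mul_assoc)
  then have "t a \<bullet> (N *v (\<chi> a. y a)) = y a" for a
    by (simp add: M_def matrix_vector_mult_def inner_vec_def vec_eq_iff)
  then show ?thesis using that by blast
qed

text \<open>Cramer's rule writes the solution as quotients of determinants. This gives smoothness of
  objects known only through a linear system: Christoffel symbols, dual frames and raised
  indices.\<close>

lemma smooth_on_solve:
  fixes t :: "'n::finite \<Rightarrow> 'a::euclidean_space \<Rightarrow> real^'n" and X :: "'a \<Rightarrow> real^'n"
  assumes S: "open S" and t: "\<And>a. smooth_on S (t a)" and y: "\<And>a. smooth_on S (y a)"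
    and nondeg: "\<And>x Y. x \<in> S \<Longrightarrow> (\<And>a. t a x \<bullet> Y = 0) \<Longrightarrow> Y = 0"
    and X: "\<And>x a. x \<in> S \<Longrightarrow> t a x \<bullet> X x = y a x"
  shows "smooth_on S X"
proof -
  define M where "M x = (\<chi> a. t a x)" for x
  define N where "N k x = (\<chi> i j. if j = k then y i x else t i x $ j)" for k x
  have det: "det (M x) \<noteq> 0" if "x \<in> S" for x
    using invertible_rows [of "M x"] nondeg [OF that]
    by (simp add: M_def invertible_det_nz)
  have eq: "(\<chi> k. det (N k x) / det (M x)) = X x" if "x \<in> S" for x
  proof -
    have "M x *v X x = (\<chi> a. y a x)"
      using X [OF that] by (simp add: M_def matrix_vector_mult_def inner_vec_def vec_eq_iff)
    then show ?thesis
      unfolding cramer [OF det [OF that]] by (simp add: N_def M_def cong: if_cong)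
  qed
  have N: "smooth_on S (\<lambda>x. N k x $ i $ j)" for k i j
    using t y S by (cases "j = k") (auto simp: N_def intro!: smooth_intros)
  have M: "smooth_on S (\<lambda>x. M x $ i $ j)" for i j
    using t S by (auto simp: M_def intro!: smooth_intros)
  have "smooth_on S (\<lambda>x. \<chi> k. det (N k x) / det (M x))"
    by (intro smooth_intros S N M det)
  then show ?thesis by (rule smooth_on_cong [OF S eq, rotated])
qed

lemma sum_skew_symmetric:
  fixes w :: "'n::finite \<Rightarrow> 'n \<Rightarrow> real"
  assumes "\<And>a b. w a b = - w b a" "\<And>a b. s a b = s b a"
  shows "(\<Sum>a\<in>UNIV. \<Sum>b\<in>UNIV. w a b * s a b) = 0"
proof -
  have "(\<Sum>a\<in>UNIV. \<Sum>b\<in>UNIV. w a b * s a b) = (\<Sum>b\<in>UNIV. \<Sum>a\<in>UNIV. w a b * s a b)"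
    by (rule sum.swap)
  also have "\<dots> = (\<Sum>b\<in>UNIV. \<Sum>a\<in>UNIV. - (w b a * s b a))"
  proof (intro sum.cong refl)
    show "w a b * s a b = - (w b a * s b a)" for a b
      using assms(1) [of a b] assms(2) [of a b] by simp
  qed
  finally show ?thesis by (simp add: sum_negf)
qed

lemma double_sum_inner:
  fixes u v :: "real^'n::finite"
  shows "(\<Sum>i\<in>UNIV. \<Sum>j\<in>UNIV. X $ i * Y $ j * (u $ i * v $ j)) = (u \<bullet> X) * (v \<bullet> Y)"
  by (simp add: inner_vec_def sum_product mult_ac)

text \<open>Cartan's structure equations: \<open>t\<close> is an orthonormal coframe of
  \<open>h\<close>, and a skew, torsion-free \<open>w\<close> is its Levi-Civita connection. The
  locale links this calculus to \<open>curvature\<close>, which is defined through Christoffel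
  symbols.\<close>

locale moving_frame =
  fixes U :: "(real^'n::finite) set" and t :: "'n \<Rightarrow> real^'n \<Rightarrow> real^'n"
    and w :: "'n \<Rightarrow> 'n \<Rightarrow> real^'n \<Rightarrow> real^'n" and h :: "real^'n \<Rightarrow> real^'n^'n"
  assumes U: "open U" and t: "\<And>a. smooth_on U (t a)" and w: "\<And>a b. smooth_on U (w a b)"
    and skew: "\<And>a b x. x \<in> U \<Longrightarrow> w a b x = - w b a x"
    and torsion: "\<And>a x X Y. x \<in> U \<Longrightarrow>
      dform (t a) x X Y = - (\<Sum>b\<in>UNIV. wedge (w a b x) (t b x) X Y)"
    and nondeg: "\<And>x X. x \<in> U \<Longrightarrow> (\<And>a. t a x \<bullet> X = 0) \<Longrightarrow> X = 0"
    and h: "\<And>x i j. x \<in> U \<Longrightarrow> h x $ i $ j = (\<Sum>a\<in>UNIV. t a x $ i * t a x $ j)"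
begin

definition Om :: "'n \<Rightarrow> 'n \<Rightarrow> real^'n \<Rightarrow> real^'n \<Rightarrow> real^'n \<Rightarrow> real" where
  "Om a b x X Y = dform (w a b) x X Y + (\<Sum>c\<in>UNIV. wedge (w a c x) (w c b x) X Y)"

text \<open>The \<open>a\<close>-th frame component of the covariant derivative of the
  \<open>j\<close>-th coordinate field in direction \<open>i\<close>, hence a Christoffel symbol
  with its upper index moved to the frame.\<close>

definition T :: "'n \<Rightarrow> 'n \<Rightarrow> 'n \<Rightarrow> real^'n \<Rightarrow> real" where
  "T a i j x = D (\<lambda>y. t a y $ j) x (axis i 1) + (\<Sum>b\<in>UNIV. w a b x $ i * t b x $ j)"

lemma tj: "smooth_on U (\<lambda>y. t a y $ j)" and wj: "smooth_on U (\<lambda>y. w a b y $ j)"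
  by (intro smooth_intros U t w)+

lemma smooth_T: "smooth_on U (T a i j)"
  unfolding T_def [abs_def] by (intro smooth_intros smooth_on_D tj wj U)

lemma T_sym: "x \<in> U \<Longrightarrow> T a i j x = T a j i x"
  using torsion [of x a "axis i 1" "axis j 1"]
  by (simp add: dform_def T_def wedge_def inner_axis D_vec_nth [OF _ t] sum_subtractf algebra_simps)

lemma D_h:
  assumes x: "x \<in> U"
  shows "partial i (\<lambda>y. h y $ j $ m) x = (\<Sum>a\<in>UNIV. t a x $ j * T a i m x + T a i j x * t a x $ m)"
proof -
  have "partial i (\<lambda>y. h y $ j $ m) x = D (\<lambda>y. \<Sum>a\<in>UNIV. t a y $ j * t a y $ m) x (axis i 1)"
    unfolding partial_def
    by (rule D_eq_on_open [OF U x, symmetric]) (auto intro!: smooth_intros U t simp: h)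
  also have "\<dots> = (\<Sum>a\<in>UNIV. t a x $ j * D (\<lambda>y. t a y $ m) x (axis i 1)
      + D (\<lambda>y. t a y $ j) x (axis i 1) * t a x $ m)"
    by (simp add: D_sum [OF x] D_mult [OF x] tj smooth_on_mult U)
  also have "\<dots> = (\<Sum>a\<in>UNIV. t a x $ j * T a i m x + T a i j x * t a x $ m)
     - (\<Sum>a\<in>UNIV. \<Sum>b\<in>UNIV. w a b x $ i * (t a x $ j * t b x $ m + t b x $ j * t a x $ m))"
    unfolding T_def
    by (simp add: sum_subtractf [symmetric] sum.distrib [symmetric] sum_distrib_left sum_distrib_right
        algebra_simps)
  \<comment> \<open>Metric compatibility: a skew factor against a symmetric one.\<close>
  also have "(\<Sum>a\<in>UNIV. \<Sum>b\<in>UNIV. w a b x $ i * (t a x $ j * t b x $ m + t b x $ j * t a x $ m)) = 0"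
  proof (rule sum_skew_symmetric)
    show "w a b x $ i = - w b a x $ i" for a b using skew [OF x, of a b] by simp
  qed simp
  finally show ?thesis by simp
qed

lemma inner_h: "x \<in> U \<Longrightarrow> X \<bullet> (h x *v Y) = (\<Sum>a\<in>UNIV. (t a x \<bullet> X) * (t a x \<bullet> Y))"
proof -
  assume x: "x \<in> U"
  have "X \<bullet> (h x *v Y) = (\<Sum>i\<in>UNIV. \<Sum>j\<in>UNIV. \<Sum>a\<in>UNIV. X $ i * Y $ j * (t a x $ i * t a x $ j))"
    by (simp add: inner_vec_def matrix_vector_mult_def h [OF x] sum_distrib_left sum_distrib_right
        mult_ac)
  also have "\<dots> = (\<Sum>i\<in>UNIV. \<Sum>a\<in>UNIV. \<Sum>j\<in>UNIV. X $ i * Y $ j * (t a x $ i * t a x $ j))"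
    by (intro sum.cong refl sum.swap)
  also have "\<dots> = (\<Sum>a\<in>UNIV. \<Sum>i\<in>UNIV. \<Sum>j\<in>UNIV. X $ i * Y $ j * (t a x $ i * t a x $ j))"
    by (rule sum.swap)
  finally show ?thesis by (simp add: double_sum_inner)
qed

lemma h_inverse: "x \<in> U \<Longrightarrow> h x ** matrix_inv (h x) = mat 1"
proof -
  assume x: "x \<in> U"
  have "X = 0" if "h x *v X = 0" for X
  proof -
    have "(\<Sum>a\<in>UNIV. (t a x \<bullet> X) * (t a x \<bullet> X)) = 0" using inner_h [OF x, of X X] that by simp
    then have "t a x \<bullet> X = 0" for a
      by (simp add: sum_nonneg_eq_0_iff)
    then show ?thesis using nondeg [OF x] by blast
  qed
  then have "invertible (h x)"
    using matrix_left_invertible_ker [of "h x"] invertible_left_inverse by blast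
  then show ?thesis
    unfolding matrix_inv_def invertible_def by (rule someI2_ex) blast
qed

lemma christoffel_T:
  assumes x: "x \<in> U"
  shows "(\<Sum>l\<in>UNIV. t a x $ l * christoffel h l i j x) = T a i j x"
proof -
  \<comment> \<open>\<open>L\<close> is the Christoffel symbol with lowered index; the Koszul
    combination of derivatives of \<open>h\<close> equals twice it.\<close>
  define L where "L m = (\<Sum>a\<in>UNIV. T a i j x * t a x $ m)" for m
  define G where "G l = christoffel h l i j x" for l
  have "partial i (\<lambda>y. h y $ j $ m) x + partial j (\<lambda>y. h y $ i $ m) x - partial m (\<lambda>y. h y $ i $ j) x
      = 2 * L m" for m
    unfolding D_h [OF x] L_def sum_distrib_left sum.distrib [symmetric] sum_subtractf [symmetric]
    by (intro sum.cong refl)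
      (simp add: T_sym [OF x, of _ m] T_sym [OF x, of _ j i] algebra_simps)
  then have G: "G l = (\<Sum>m\<in>UNIV. matrix_inv (h x) $ l $ m * L m)" for l
    unfolding G_def christoffel_def by (simp add: sum_divide_distrib)
  have hG: "(\<Sum>l\<in>UNIV. h x $ k $ l * G l) = L k" for k
  proof -
    have "(\<chi> l. G l) = matrix_inv (h x) *v (\<chi> m. L m)"
      by (simp add: matrix_vector_mult_def G vec_eq_iff)
    then have "h x *v (\<chi> l. G l) = (\<chi> m. L m)"
      by (simp add: matrix_vector_mul_assoc h_inverse [OF x])
    then show ?thesis by (simp add: matrix_vector_mult_def vec_eq_iff)
  qed
  \<comment> \<open>The deviation \<open>y\<close> satisfies \<open>sum y a * t a = 0\<close>.
    Pairing with the vector whose frame components are \<open>y\<close> turns this into a vanishing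
    sum of squares.\<close>
  define y where "y a = (\<Sum>l\<in>UNIV. t a x $ l * G l) - T a i j x" for a
  obtain X where X: "\<And>a. t a x \<bullet> X = y a" using rows_solve [of "\<lambda>a. t a x" y] nondeg [OF x] by metis
  have "(\<Sum>a\<in>UNIV. y a * t a x $ k) = 0" for k
  proof -
    have "(\<Sum>a\<in>UNIV. y a * t a x $ k) = (\<Sum>a\<in>UNIV. \<Sum>l\<in>UNIV. t a x $ k * t a x $ l * G l) - L k"
      unfolding y_def L_def
      by (simp add: algebra_simps sum_distrib_left sum_subtractf sum_distrib_right)
    also have "(\<Sum>a\<in>UNIV. \<Sum>l\<in>UNIV. t a x $ k * t a x $ l * G l) = (\<Sum>l\<in>UNIV. h x $ k $ l * G l)"
      by (subst sum.swap) (simp add: h [OF x] sum_distrib_right)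
    finally show ?thesis using hG by simp
  qed
  then have "0 = (\<Sum>k\<in>UNIV. (\<Sum>a\<in>UNIV. y a * t a x $ k) * X $ k)" by simp
  also have "\<dots> = (\<Sum>a\<in>UNIV. y a * (t a x \<bullet> X))"
    unfolding inner_vec_def sum_distrib_left sum_distrib_right
    by (subst sum.swap) (simp add: mult_ac)
  finally have "(\<Sum>a\<in>UNIV. y a * y a) = 0" by (simp add: X)
  then have "y a = 0" by (simp add: sum_nonneg_eq_0_iff)
  then show ?thesis by (simp add: y_def G_def)
qed

text \<open>The symbols solve the linear system \<open>christoffel_T\<close>, so
  \<open>matrix_inv\<close> never has to be differentiated.\<close>

lemma smooth_christoffel: "smooth_on U (christoffel h l i j)"
proof -
  have "smooth_on U (\<lambda>x. \<chi> l. christoffel h l i j x)"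
    by (rule smooth_on_solve [OF U t smooth_T nondeg])
      (auto simp: inner_vec_def christoffel_T)
  from smooth_on_vec_nth [OF U this, of l] show ?thesis by simp
qed

text \<open>Differentiating \<open>christoffel_T\<close> gives \<open>P\<close>, and the quadratic
  Christoffel terms give \<open>Q\<close>. First derivatives of \<open>t\<close> times Christoffel
  symbols cancel between the two, second derivatives of \<open>t\<close> cancel by symmetry in
  \<open>i\<close> and \<open>j\<close>, and what remains is the curvature form.\<close>

lemma riemann_Om:
  assumes x: "x \<in> U"
  shows "(\<Sum>l\<in>UNIV. t a x $ l * riemann h l i j k x)
    = (\<Sum>b\<in>UNIV. Om a b x (axis i 1) (axis j 1) * t b x $ k)"
proof -
  define p where "p i f = D f x (axis i 1)" for i and f :: "real^'n \<Rightarrow> real"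
  define G where "G l i j = christoffel h l i j x" for l i j
  have TG: "(\<Sum>l\<in>UNIV. t a x $ l * G l i j) = T a i j x" for a i j
    using christoffel_T [OF x] by (simp add: G_def)
  have Teq: "T a i j x = p i (\<lambda>y. t a y $ j) + (\<Sum>b\<in>UNIV. w a b x $ i * t b x $ j)" for a i j
    by (simp add: T_def p_def)
  have P: "(\<Sum>l\<in>UNIV. t a x $ l * p i (christoffel h l j k)) =
      p i (\<lambda>y. D (\<lambda>y. t a y $ k) y (axis j 1))
      + (\<Sum>b\<in>UNIV. w a b x $ j * p i (\<lambda>y. t b y $ k) + p i (\<lambda>y. w a b y $ j) * t b x $ k)
      - (\<Sum>l\<in>UNIV. p i (\<lambda>y. t a y $ l) * G l j k)" for i j
  proof -
    have "p i (T a j k) = p i (\<lambda>y. \<Sum>l\<in>UNIV. t a y $ l * christoffel h l j k y)"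
      unfolding p_def by (rule D_eq_on_open [OF U x smooth_T]) (simp add: christoffel_T)
    also have "\<dots> = (\<Sum>l\<in>UNIV. t a x $ l * p i (christoffel h l j k) + p i (\<lambda>y. t a y $ l) * G l j k)"
      unfolding p_def
      by (simp add: D_sum [OF x] D_mult [OF x] tj smooth_christoffel smooth_on_mult U G_def)
    also have "p i (T a j k) = p i (\<lambda>y. D (\<lambda>y. t a y $ k) y (axis j 1))
      + (\<Sum>b\<in>UNIV. w a b x $ j * p i (\<lambda>y. t b y $ k) + p i (\<lambda>y. w a b y $ j) * t b x $ k)"
      unfolding p_def T_def [abs_def]
      by (simp add: D_add [OF x] D_sum [OF x] D_mult [OF x] tj wj smooth_on_mult smooth_on_sum smooth_on_D U)
    finally show ?thesis by (simp add: sum.distrib)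
  qed
  have Q: "(\<Sum>l\<in>UNIV. t a x $ l * (\<Sum>m\<in>UNIV. G l i m * G m j k)) =
      (\<Sum>m\<in>UNIV. p i (\<lambda>y. t a y $ m) * G m j k) + (\<Sum>b\<in>UNIV. w a b x $ i * T b j k x)" for i j
  proof -
    have "(\<Sum>l\<in>UNIV. t a x $ l * (\<Sum>m\<in>UNIV. G l i m * G m j k))
        = (\<Sum>m\<in>UNIV. (\<Sum>l\<in>UNIV. t a x $ l * G l i m) * G m j k)"
      unfolding sum_distrib_left sum_distrib_right
      by (subst sum.swap) (simp add: mult_ac)
    also have "\<dots> = (\<Sum>m\<in>UNIV. p i (\<lambda>y. t a y $ m) * G m j k)
        + (\<Sum>m\<in>UNIV. \<Sum>b\<in>UNIV. w a b x $ i * (t b x $ m * G m j k))"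
      unfolding TG Teq by (simp add: distrib_right sum.distrib sum_distrib_right mult.assoc)
    also have "(\<Sum>m\<in>UNIV. \<Sum>b\<in>UNIV. w a b x $ i * (t b x $ m * G m j k))
        = (\<Sum>b\<in>UNIV. w a b x $ i * T b j k x)"
      by (subst sum.swap) (simp add: sum_distrib_left [symmetric] TG)
    finally show ?thesis .
  qed
  have comm: "p i (\<lambda>y. D (\<lambda>y. t a y $ k) y (axis j 1)) = p j (\<lambda>y. D (\<lambda>y. t a y $ k) y (axis i 1))"
    unfolding p_def by (rule D_D_commute [OF U x tj])
  have "(\<Sum>l\<in>UNIV. t a x $ l * riemann h l i j k x)
      = (\<Sum>l\<in>UNIV. t a x $ l * p i (christoffel h l j k)) + (\<Sum>l\<in>UNIV. t a x $ l * (\<Sum>m\<in>UNIV. G l i m * G m j k))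
      - ((\<Sum>l\<in>UNIV. t a x $ l * p j (christoffel h l i k)) + (\<Sum>l\<in>UNIV. t a x $ l * (\<Sum>m\<in>UNIV. G l j m * G m i k)))"
    by (simp add: riemann_def partial_def p_def G_def sum_subtractf sum.distrib algebra_simps)
  also have "\<dots> = (\<Sum>b\<in>UNIV. (p i (\<lambda>y. w a b y $ j) - p j (\<lambda>y. w a b y $ i)) * t b x $ k)
      + ((\<Sum>b\<in>UNIV. w a b x $ i * (\<Sum>c\<in>UNIV. w b c x $ j * t c x $ k))
        - (\<Sum>b\<in>UNIV. w a b x $ j * (\<Sum>c\<in>UNIV. w b c x $ i * t c x $ k)))"
    unfolding P Q Teq comm
    by (simp add: sum.distrib sum_subtractf algebra_simps)
  also have "(\<Sum>b\<in>UNIV. w a b x $ i * (\<Sum>c\<in>UNIV. w b c x $ j * t c x $ k))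
        - (\<Sum>b\<in>UNIV. w a b x $ j * (\<Sum>c\<in>UNIV. w b c x $ i * t c x $ k))
      = (\<Sum>c\<in>UNIV. (\<Sum>b\<in>UNIV. w a b x $ i * w b c x $ j - w a b x $ j * w b c x $ i) * t c x $ k)"
    unfolding sum_distrib_left sum_distrib_right sum_subtractf [symmetric]
    by (subst sum.swap) (simp add: algebra_simps)
  finally show ?thesis
    by (simp add: Om_def dform_def wedge_def p_def inner_axis D_vec_nth [OF x w] sum.distrib [symmetric]
        distrib_right)
qed

lemma Om_axis:
  assumes x: "x \<in> U"
  shows "(\<Sum>i\<in>UNIV. \<Sum>j\<in>UNIV. X $ i * Y $ j * Om a b x (axis i 1) (axis j 1)) = Om a b x X Y"
proof -
  note exp = D_axis [OF smooth_on_differentiable [OF w x]]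
  have 1: "D (w a b) x X \<bullet> Y = (\<Sum>i\<in>UNIV. \<Sum>j\<in>UNIV. X $ i * Y $ j * (D (w a b) x (axis i 1) $ j))" for X Y
    by (subst exp, simp add: inner_vec_def sum_distrib_left sum_distrib_right mult_ac, rule sum.swap)
  have 2: "D (w a b) x Y \<bullet> X = (\<Sum>i\<in>UNIV. \<Sum>j\<in>UNIV. X $ i * Y $ j * (D (w a b) x (axis j 1) $ i))"
    unfolding 1 by (subst sum.swap) (simp add: mult_ac)
  have 3: "(\<Sum>i\<in>UNIV. \<Sum>j\<in>UNIV. X $ i * Y $ j * wedge u v (axis i 1) (axis j 1)) = wedge u v X Y" for u v
  proof -
    have "(\<Sum>i\<in>UNIV. \<Sum>j\<in>UNIV. X $ i * Y $ j * wedge u v (axis i 1) (axis j 1))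
      = (\<Sum>i\<in>UNIV. \<Sum>j\<in>UNIV. X $ i * Y $ j * (u $ i * v $ j))
      - (\<Sum>i\<in>UNIV. \<Sum>j\<in>UNIV. X $ i * Y $ j * (v $ i * u $ j))"
      by (simp add: wedge_def inner_axis algebra_simps sum_subtractf)
    then show ?thesis by (simp only: double_sum_inner wedge_def) (simp add: mult.commute)
  qed
  have "(\<Sum>i\<in>UNIV. \<Sum>j\<in>UNIV. X $ i * Y $ j * (\<Sum>c\<in>UNIV. wedge (w a c x) (w c b x) (axis i 1) (axis j 1)))
     = (\<Sum>c\<in>UNIV. wedge (w a c x) (w c b x) X Y)"
  proof -
    let ?f = "\<lambda>i j c. X $ i * Y $ j * wedge (w a c x) (w c b x) (axis i 1) (axis j 1)"
    have "(\<Sum>i\<in>UNIV. \<Sum>j\<in>UNIV. \<Sum>c\<in>UNIV. ?f i j c) = (\<Sum>i\<in>UNIV. \<Sum>c\<in>UNIV. \<Sum>j\<in>UNIV. ?f i j c)"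
      by (intro sum.cong refl sum.swap)
    also have "\<dots> = (\<Sum>c\<in>UNIV. \<Sum>i\<in>UNIV. \<Sum>j\<in>UNIV. ?f i j c)" by (rule sum.swap)
    finally show ?thesis by (simp only: sum_distrib_left 3)
  qed
  then show ?thesis
    unfolding Om_def dform_def 1 [of X Y] 2
    by (simp add: inner_axis distrib_left sum.distrib right_diff_distrib sum_subtractf)
qed

theorem metric_curvature:
  assumes x: "x \<in> U"
  shows "metric_at h x (curvature h x X Y Z) W
    = (\<Sum>a\<in>UNIV. \<Sum>b\<in>UNIV. Om a b x X Y * (t b x \<bullet> Z) * (t a x \<bullet> W))"
proof -
  have "t a x \<bullet> curvature h x X Y Z = (\<Sum>b\<in>UNIV. Om a b x X Y * (t b x \<bullet> Z))" for a
  proof -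
    have "t a x \<bullet> curvature h x X Y Z
        = (\<Sum>l\<in>UNIV. \<Sum>i\<in>UNIV. \<Sum>j\<in>UNIV. \<Sum>k\<in>UNIV. X $ i * Y $ j * Z $ k * (t a x $ l * riemann h l i j k x))"
      by (simp add: curvature_def inner_vec_def sum_distrib_left mult_ac)
    also have "\<dots> = (\<Sum>i\<in>UNIV. \<Sum>j\<in>UNIV. \<Sum>k\<in>UNIV. \<Sum>l\<in>UNIV. X $ i * Y $ j * Z $ k * (t a x $ l * riemann h l i j k x))"
      by (subst sum.swap, rule sum.cong [OF refl], subst sum.swap, rule sum.cong [OF refl], rule sum.swap)
    also have "\<dots> = (\<Sum>i\<in>UNIV. \<Sum>j\<in>UNIV. \<Sum>k\<in>UNIV. \<Sum>b\<in>UNIV. X $ i * Y $ j * Z $ k * (Om a b x (axis i 1) (axis j 1) * t b x $ k))"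
      by (simp only: sum_distrib_left [symmetric] riemann_Om [OF x])
    also have "\<dots> = (\<Sum>i\<in>UNIV. \<Sum>j\<in>UNIV. \<Sum>b\<in>UNIV. (X $ i * Y $ j * Om a b x (axis i 1) (axis j 1)) * (t b x \<bullet> Z))"
      unfolding inner_vec_def inner_real_def sum_distrib_left
      by (rule sum.cong [OF refl], rule sum.cong [OF refl], subst sum.swap) (simp add: mult_ac)
    also have "\<dots> = (\<Sum>b\<in>UNIV. \<Sum>i\<in>UNIV. \<Sum>j\<in>UNIV. (X $ i * Y $ j * Om a b x (axis i 1) (axis j 1)) * (t b x \<bullet> Z))"
      by (subst sum.swap, rule sum.cong [OF refl], subst sum.swap, rule refl)
    finally show ?thesis by (simp only: sum_distrib_right [symmetric] Om_axis [OF x])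
  qed
  then show ?thesis unfolding metric_at_def inner_h [OF x]
    by (simp add: sum_distrib_right)
qed

end

section \<open>Adapted coframes\<close>

text \<open>Let C1, C2, C3 be the symmetric traceless matrices of a cubic form with C1 = (a b c; b d
  e; c e -(a+d)). The hypotheses say that [Ci, Cj] is kij times the elementary skew matrix in the
  plane ij. The conclusions are components of the Jacobi identity for C1, C2, C3, which is linear in
  the cubic form.\<close>

lemma Gauss_linear_relations:
  fixes a b c d e f g0 :: real
  assumes M1: "a*e + b*g0 - c*(b+f) - (c*b + e*d - (a+d)*e) = 0"
    and M2: "d*c + f*e - g0*(a+d) - (b*e + d*g0 - e*(b+f)) = 0"
    and M3: "- (a+d)*b - (b+f)*d - (c+g0)*e - (c*e + e*g0 + (a+d)*(b+f)) = 0"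
    and K12: "a*d + b*f + c*g0 - b\<^sup>2 - d\<^sup>2 - e\<^sup>2 = k12"
    and K13: "- a*(a+d) - b*(b+f) - c*(c+g0) - c\<^sup>2 - e\<^sup>2 - (a+d)\<^sup>2 = k13"
    and K23: "- d*(a+d) - f*(b+f) - g0*(c+g0) - e\<^sup>2 - g0\<^sup>2 - (b+f)\<^sup>2 = k23"
    and ne: "k13 \<noteq> k23"
  shows "e = 0" "g0*(k13-k12) = c*(k23-k12)"
    "b*(2*(k13-k12) - (k23-k12)) + f*(k13-k12) = 0" "d*((k13-k12) - 2*(k23-k12)) = a*(k23-k12)"
proof -
  have "e*(k13-k23) = 0" using M1 M2 M3 K12 K13 K23 by algebra
  then show e: "e = 0" using ne by simp
  show "g0*(k13-k12) = c*(k23-k12)"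
    using M1 M2 M3 K12 K13 K23 e by algebra
  show "b*(2*(k13-k12) - (k23-k12)) + f*(k13-k12) = 0"
    using M1 M2 M3 K12 K13 K23 e by algebra
  show "d*((k13-k12) - 2*(k23-k12)) = a*(k23-k12)"
    using M1 M2 M3 K12 K13 K23 e by algebra
qed

section \<open>Exterior derivatives of one-forms\<close>

definition grad :: "(real^'n \<Rightarrow> real) \<Rightarrow> real^'n \<Rightarrow> real^'n::finite" where
  "grad u x = (\<chi> i. D u x (axis i 1))"

lemma grad_inner: "u differentiable at x \<Longrightarrow> grad u x \<bullet> X = D u x X"
  using D_axis [of u x X] by (simp add: grad_def inner_vec_def mult.commute)

lemma smooth_on_grad [smooth_intros]: "open S \<Longrightarrow> smooth_on S u \<Longrightarrow> smooth_on S (grad u)"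
  unfolding grad_def [abs_def] by (intro smooth_intros smooth_on_D)

lemma dform_scaleR:
  assumes "x \<in> S" "smooth_on S f" "smooth_on S w"
  shows "dform (\<lambda>y. f y *\<^sub>R w y) x X Y
    = D f x X * (w x \<bullet> Y) - D f x Y * (w x \<bullet> X) + f x * dform w x X Y"
  using assms by (simp add: dform_def D_scaleR [where S=S] inner_add_left algebra_simps)

lemma dform_add:
  assumes "x \<in> S" "smooth_on S v" "smooth_on S w"
  shows "dform (\<lambda>y. v y + w y) x X Y = dform v x X Y + dform w x X Y"
  using assms by (simp add: dform_def D_add [where S=S] inner_add_left algebra_simps)

lemma dform_diff:
  assumes "x \<in> S" "smooth_on S v" "smooth_on S w"
  shows "dform (\<lambda>y. v y - w y) x X Y = dform v x X Y - dform w x X Y"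
  using assms by (simp add: dform_def D_diff [where S=S] inner_diff_left algebra_simps)

lemma dform_uminus:
  assumes "x \<in> S" "smooth_on S w"
  shows "dform (\<lambda>y. - w y) x X Y = - dform w x X Y"
  using assms by (simp add: dform_def D_uminus [where S=S] algebra_simps)

lemma dform_const_scaleR:
  assumes "x \<in> S" "smooth_on S w"
  shows "dform (\<lambda>y. r *\<^sub>R w y) x X Y = r * dform w x X Y"
  using dform_scaleR [OF assms(1) smooth_on_const assms(2)] by simp

lemma dform_cong:
  assumes "open S" "x \<in> S" "smooth_on S v" "\<And>y. y \<in> S \<Longrightarrow> v y = w y"
  shows "dform v x X Y = dform w x X Y"
  unfolding dform_def using D_eq_on_open [OF assms] by metis

lemma dform_grad:
  assumes "open S" "x \<in> S" "smooth_on S u"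
  shows "dform (grad u) x X Y = 0"
proof -
  have "D (grad u) x X \<bullet> Y = D (\<lambda>y. D u y Y) x X" for X Y
  proof -
    have "D (grad u) x X \<bullet> Y = D (\<lambda>y. grad u y \<bullet> Y) x X"
      using D_linear [OF assms(2) bounded_linear_inner_left smooth_on_grad [OF assms(1,3)]] by metis
    also have "\<dots> = D (\<lambda>y. D u y Y) x X"
      by (rule D_eq_on_open [OF assms(1,2)])
        (auto intro!: smooth_intros assms grad_inner smooth_on_differentiable [OF assms(3)])
    finally show ?thesis .
  qed
  then show ?thesis using D_D_commute [OF assms] by (simp add: dform_def)
qed

text \<open>The coframe \<open>t1, t2, t3\<close> is adapted in the sense above, with \<open>sn, cs\<close> the sine and
  cosine of \<open>\<theta>\<close>; \<open>al\<close>, \<open>ga\<close> and \<open>d1 + i d2\<close> are the forms of \<open>dq\<close> along \<open>i q\<close> and of \<open>dp\<close> along \<open>i p\<close> and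
  \<open>j p\<close>.\<close>
locale adapted_coframe =
  fixes U :: "(real^3) set" and sn cs :: "real^3 \<Rightarrow> real"
    and t1 t2 t3 al ga d1 d2 :: "real^3 \<Rightarrow> real^3" and h :: "real^3 \<Rightarrow> real^3^3" and K :: real
  assumes U [simp]: "open U" and U_ne: "U \<noteq> {}"
    and sm [smooth_intros]: "smooth_on U sn" "smooth_on U cs" "smooth_on U t1" "smooth_on U t2"
      "smooth_on U t3" "smooth_on U al" "smooth_on U ga" "smooth_on U d1" "smooth_on U d2"
    and indep: "\<And>x X. x \<in> U \<Longrightarrow> t1 x \<bullet> X = 0 \<Longrightarrow> t2 x \<bullet> X = 0 \<Longrightarrow> t3 x \<bullet> X = 0 \<Longrightarrow> X = 0"
    and unit: "\<And>x. x \<in> U \<Longrightarrow> (sn x)\<^sup>2 + (cs x)\<^sup>2 = 1"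
    and str1: "\<And>x X Y. x \<in> U \<Longrightarrow> dform (\<lambda>y. cs y *\<^sub>R t1 y) x X Y =
      - 2 * sn x * wedge (al x) (t2 x) X Y - cs x * wedge (t2 x) (t3 x) X Y"
    and str2: "\<And>x X Y. x \<in> U \<Longrightarrow> dform (\<lambda>y. sn y *\<^sub>R t2 y) x X Y =
      2 * cs x * wedge (al x) (t1 x) X Y + sn x * wedge (t1 x) (t3 x) X Y"
    and str3: "\<And>x X Y. x \<in> U \<Longrightarrow> dform (\<lambda>y. sn y *\<^sub>R t1 y) x X Y =
      - cs x * (wedge (al x) (t2 x) X Y - wedge (ga x) (t2 x) X Y)
      - sn x * wedge (t2 x) (t3 x) X Y + wedge (d2 x) (t3 x) X Y"
    and str4: "\<And>x X Y. x \<in> U \<Longrightarrow> dform (\<lambda>y. cs y *\<^sub>R t2 y) x X Y =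
      sn x * (wedge (al x) (t1 x) X Y - wedge (ga x) (t1 x) X Y)
      + cs x * wedge (t1 x) (t3 x) X Y + wedge (d1 x) (t3 x) X Y"
    and str5: "\<And>x X Y. x \<in> U \<Longrightarrow> wedge (al x) (t3 x) X Y + wedge (ga x) (t3 x) X Y =
      - sn x * wedge (d1 x) (t1 x) X Y + cs x * wedge (d2 x) (t2 x) X Y"
    and str6: "\<And>x X Y. x \<in> U \<Longrightarrow> dform t3 x X Y = - wedge (t1 x) (t2 x) X Y
      - cs x * wedge (d1 x) (t2 x) X Y - sn x * wedge (d2 x) (t1 x) X Y"
    and dal: "\<And>x X Y. x \<in> U \<Longrightarrow> dform al x X Y = 3 * sn x * cs x * wedge (t1 x) (t2 x) X Y"
    and dga: "\<And>x X Y. x \<in> U \<Longrightarrow> dform ga x X Y =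
      - sn x * cs x * wedge (t1 x) (t2 x) X Y + 2 * wedge (d1 x) (d2 x) X Y"
    and dd1: "\<And>x X Y. x \<in> U \<Longrightarrow> dform d1 x X Y =
      - 2 * wedge (ga x) (d2 x) X Y - cs x * wedge (t2 x) (t3 x) X Y"
    and dd2: "\<And>x X Y. x \<in> U \<Longrightarrow> dform d2 x X Y =
      2 * wedge (ga x) (d1 x) X Y - sn x * wedge (t1 x) (t3 x) X Y"
    and metric: "\<And>x i j. x \<in> U \<Longrightarrow>
      h x $ i $ j = t1 x $ i * t1 x $ j + t2 x $ i * t2 x $ j + t3 x $ i * t3 x $ j"
    and curv: "\<And>x X Y. x \<in> U \<Longrightarrow>
      metric_at h x X X * metric_at h x Y Y - (metric_at h x X Y)\<^sup>2 \<noteq> 0 \<Longrightarrow>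
      metric_at h x (curvature h x X Y Y) X =
      K * (metric_at h x X X * metric_at h x Y Y - (metric_at h x X Y)\<^sup>2)"
begin

text \<open>This is \<open>d theta\<close>, written without choosing an angle function.\<close>

definition ta :: "real^3 \<Rightarrow> real^3" where
  "ta x = cs x *\<^sub>R grad sn x - sn x *\<^sub>R grad cs x"

lemma D_sn: "x \<in> U \<Longrightarrow> D sn x X = cs x * (ta x \<bullet> X)"
  and D_cs: "x \<in> U \<Longrightarrow> D cs x X = - sn x * (ta x \<bullet> X)"
proof -
  assume x: "x \<in> U"
  have "D (\<lambda>x. (sn x)\<^sup>2 + (cs x)\<^sup>2) x X = 0"
    by (rule D_eq_0 [OF U x unit])
  then have *: "sn x * D sn x X + cs x * D cs x X = 0"
    by (simp add: D_add [OF x] D_power2 [OF x] smooth_on_power sm)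
  have ta: "ta x \<bullet> X = cs x * D sn x X - sn x * D cs x X"
    by (simp add: ta_def inner_diff_left grad_inner smooth_on_differentiable [OF _ x] sm)
  show "D sn x X = cs x * (ta x \<bullet> X)" "D cs x X = - sn x * (ta x \<bullet> X)"
    using * unit [OF x] unfolding ta by algebra+
qed

text \<open>The exterior derivatives of \<open>cs t1\<close> and \<open>sn t1\<close> form a linear
  system with a rotation matrix in the unknowns \<open>dform t1\<close> and
  \<open>wedge ta t1\<close>. Solving it yields a torsion equation and an algebraic relation that
  later expresses the symmetry of the second fundamental form. The same is done for
  \<open>t2\<close> below.\<close>

lemma
  assumes x: "x \<in> U"
  shows dt1: "dform t1 x X Y = - sn x * cs x * (3 * wedge (al x) (t2 x) X Y - wedge (ga x) (t2 x) X Y)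
      - wedge (t2 x) (t3 x) X Y + sn x * wedge (d2 x) (t3 x) X Y" (is ?A)
    and sym1: "wedge (ta x) (t1 x) X Y =
      (2 * (sn x)\<^sup>2 - (cs x)\<^sup>2) * wedge (al x) (t2 x) X Y + (cs x)\<^sup>2 * wedge (ga x) (t2 x) X Y
      + cs x * wedge (d2 x) (t3 x) X Y" (is ?B)
proof -
  have 1: "- sn x * wedge (ta x) (t1 x) X Y + cs x * dform t1 x X Y =
      - 2 * sn x * wedge (al x) (t2 x) X Y - cs x * wedge (t2 x) (t3 x) X Y"
    unfolding str1 [OF x, symmetric] dform_scaleR [OF x sm(2,3)] D_cs [OF x]
    by (simp add: wedge_def algebra_simps)
  have 2: "cs x * wedge (ta x) (t1 x) X Y + sn x * dform t1 x X Y =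
      - cs x * (wedge (al x) (t2 x) X Y - wedge (ga x) (t2 x) X Y)
      - sn x * wedge (t2 x) (t3 x) X Y + wedge (d2 x) (t3 x) X Y"
    unfolding str3 [OF x, symmetric] dform_scaleR [OF x sm(1,3)] D_sn [OF x]
    by (simp add: wedge_def algebra_simps)
  show ?A ?B
    using 1 2 unit [OF x] by algebra+
qed

lemma
  assumes x: "x \<in> U"
  shows dt2: "dform t2 x X Y = sn x * cs x * (3 * wedge (al x) (t1 x) X Y - wedge (ga x) (t1 x) X Y)
      + wedge (t1 x) (t3 x) X Y + cs x * wedge (d1 x) (t3 x) X Y" (is ?A)
    and sym2: "wedge (ta x) (t2 x) X Y =
      2 * (cs x)\<^sup>2 * wedge (al x) (t1 x) X Y
      - (sn x)\<^sup>2 * (wedge (al x) (t1 x) X Y - wedge (ga x) (t1 x) X Y)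
      - sn x * wedge (d1 x) (t3 x) X Y" (is ?B)
proof -
  have 1: "cs x * wedge (ta x) (t2 x) X Y + sn x * dform t2 x X Y =
      2 * cs x * wedge (al x) (t1 x) X Y + sn x * wedge (t1 x) (t3 x) X Y"
    unfolding str2 [OF x, symmetric] dform_scaleR [OF x sm(1,4)] D_sn [OF x]
    by (simp add: wedge_def algebra_simps)
  have 2: "- sn x * wedge (ta x) (t2 x) X Y + cs x * dform t2 x X Y =
      sn x * (wedge (al x) (t1 x) X Y - wedge (ga x) (t1 x) X Y)
      + cs x * wedge (t1 x) (t3 x) X Y + wedge (d1 x) (t3 x) X Y"
    unfolding str4 [OF x, symmetric] dform_scaleR [OF x sm(2,4)] D_cs [OF x]
    by (simp add: wedge_def algebra_simps)
  show ?A ?B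
    using 1 2 unit [OF x] by algebra+
qed

text \<open>The \<open>s\<^sub>i\<^sub>j\<close> are the components of the second fundamental form (with normal bundle identified with the
  tangent bundle by \<open>J\<close>), the \<open>w\<^sub>i\<^sub>j\<close> below those of the Levi-Civita connection.\<close>
definition s11 :: "real^3 \<Rightarrow> real^3" where
  "s11 x = (2 * (cs x)\<^sup>2) *\<^sub>R al x - (sn x)\<^sup>2 *\<^sub>R (al x - ga x)"
definition s12 :: "real^3 \<Rightarrow> real^3" where "s12 x = - ta x"
definition s13 :: "real^3 \<Rightarrow> real^3" where "s13 x = - (sn x *\<^sub>R d1 x)"
definition s22 :: "real^3 \<Rightarrow> real^3" where
  "s22 x = (2 * (sn x)\<^sup>2 - (cs x)\<^sup>2) *\<^sub>R al x + (cs x)\<^sup>2 *\<^sub>R ga x"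
definition s23 :: "real^3 \<Rightarrow> real^3" where "s23 x = cs x *\<^sub>R d2 x"
definition s33 :: "real^3 \<Rightarrow> real^3" where "s33 x = - (al x + ga x)"

lemmas s_defs = s11_def s12_def s13_def s22_def s23_def s33_def

lemma s_trace: "x \<in> U \<Longrightarrow> s11 x + s22 x + s33 x = 0"
proof -
  assume x: "x \<in> U"
  have *: "(cs x)\<^sup>2 = 1 - (sn x)\<^sup>2" using unit [OF x] by simp
  show ?thesis unfolding s_defs * by (simp add: vec_eq_iff algebra_simps)
qed

lemma s33_inner: "x \<in> U \<Longrightarrow> s33 x \<bullet> X = - (s11 x \<bullet> X + s22 x \<bullet> X)"
  using s_trace [of x] by (metis add.inverse_unique inner_add_left inner_minus_left)

text \<open>These are the three relations left over after solving for \<open>dform t1\<close> and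
  \<open>dform t2\<close>, in the form that Cartan's lemma needs.\<close>

lemma s_wedge:
  assumes x: "x \<in> U"
  shows "wedge (s11 x) (t1 x) X Y + wedge (s12 x) (t2 x) X Y + wedge (s13 x) (t3 x) X Y = 0"
    "wedge (s12 x) (t1 x) X Y + wedge (s22 x) (t2 x) X Y + wedge (s23 x) (t3 x) X Y = 0"
    "wedge (s13 x) (t1 x) X Y + wedge (s23 x) (t2 x) X Y + wedge (s33 x) (t3 x) X Y = 0"
  using sym1 [OF x, of X Y] sym2 [OF x, of X Y] str5 [OF x, of X Y]
  by (simp_all add: s_defs wedge_def algebra_simps)

text \<open>Read off from the torsion equations. The summands with factor 1/2 distribute the terms
  \<open>t2 ^ t3\<close>, \<open>t1 ^ t3\<close> and \<open>t1 ^ t2\<close> in the only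
  skew-symmetric way.\<close>

definition w12 :: "real^3 \<Rightarrow> real^3" where
  "w12 x = (sn x * cs x) *\<^sub>R (3 *\<^sub>R al x - ga x) - (1/2) *\<^sub>R t3 x"
definition w13 :: "real^3 \<Rightarrow> real^3" where "w13 x = (1/2) *\<^sub>R t2 x - sn x *\<^sub>R d2 x"
definition w23 :: "real^3 \<Rightarrow> real^3" where "w23 x = - (cs x *\<^sub>R d1 x) - (1/2) *\<^sub>R t1 x"

lemmas w_defs = w12_def w13_def w23_def

text \<open>Gauss' equation. The terms in the \<open>s\<close> forms are an entry of the commutators
  of the cubic form matrices, and the coefficient of \<open>wedge t1 t2\<close> is the ambient
  sectional curvature of the plane. In the other two planes it is \<open>sn^2 + 1/4\<close> and
  \<open>cs^2 + 1/4\<close>; the differences of the three drive the generic case.\<close>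

lemma curvature_form12:
  assumes x: "x \<in> U"
  shows "dform w12 x X Y - wedge (w13 x) (w23 x) X Y =
    wedge (s11 x) (s12 x) X Y + wedge (s12 x) (s22 x) X Y + wedge (s13 x) (s23 x) X Y
    + (10 * (sn x)\<^sup>2 * (cs x)\<^sup>2 + 1/4) * wedge (t1 x) (t2 x) X Y"
proof -
  have *: "D (\<lambda>y. sn y * cs y) x X = ((cs x)\<^sup>2 - (sn x)\<^sup>2) * (ta x \<bullet> X)" for X
    by (simp add: D_mult [OF x] sm D_sn [OF x] D_cs [OF x] power2_eq_square algebra_simps)
  have "dform w12 x X Y = ((cs x)\<^sup>2 - (sn x)\<^sup>2) * (wedge (ta x) (3 *\<^sub>R al x - ga x) X Y)
    + sn x * cs x * (3 * dform al x X Y - dform ga x X Y) - dform t3 x X Y / 2"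
    unfolding w12_def [abs_def]
    by (subst dform_diff [OF x] dform_scaleR [OF x] dform_const_scaleR [OF x],
        (intro smooth_intros U; fail)+)+
      (simp only: *, simp add: wedge_def algebra_simps)
  then show ?thesis
    unfolding dal [OF x] dga [OF x] str6 [OF x] 
    by (simp add: s_defs w_defs wedge_def inner_diff_left inner_add_left field_simps power2_eq_square)
qed

lemma cs_square:
  assumes x: "x \<in> U"
  shows "cs x * cs x = 1 - sn x * sn x" "cs x * (cs x * z) = z - sn x * (sn x * z)"
  using unit [OF x] by algebra+

lemma curvature_form13:
  assumes x: "x \<in> U"
  shows "dform w13 x X Y + wedge (w12 x) (w23 x) X Y =
    wedge (s11 x) (s13 x) X Y + wedge (s12 x) (s23 x) X Y + wedge (s13 x) (s33 x) X Y
    + ((sn x)\<^sup>2 + 1/4) * wedge (t1 x) (t3 x) X Y"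
proof -
  have "dform w13 x X Y = dform t2 x X Y / 2 - cs x * wedge (ta x) (d2 x) X Y - sn x * dform d2 x X Y"
    unfolding w13_def [abs_def]
    by (subst dform_diff [OF x] dform_scaleR [OF x] dform_const_scaleR [OF x],
        (intro smooth_intros U; fail)+)+
      (simp add: D_sn [OF x] wedge_def algebra_simps)
  then show ?thesis
    unfolding dd2 [OF x] dt2 [OF x]
    by (simp add: s_defs w_defs wedge_def inner_diff_left inner_add_left field_simps power2_eq_square
        cs_square [OF x])
qed

lemma curvature_form23:
  assumes x: "x \<in> U"
  shows "dform w23 x X Y - wedge (w12 x) (w13 x) X Y =
    wedge (s12 x) (s13 x) X Y + wedge (s22 x) (s23 x) X Y + wedge (s23 x) (s33 x) X Y
    + ((cs x)\<^sup>2 + 1/4) * wedge (t2 x) (t3 x) X Y"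
proof -
  have "dform w23 x X Y = - (dform t1 x X Y / 2) + sn x * wedge (ta x) (d1 x) X Y - cs x * dform d1 x X Y"
    unfolding w23_def [abs_def]
    by (subst dform_diff [OF x] dform_uminus [OF x] dform_scaleR [OF x] dform_const_scaleR [OF x],
        (intro smooth_intros U; fail)+)+
      (simp add: D_cs [OF x] wedge_def algebra_simps)
  then show ?thesis
    unfolding dd1 [OF x] dt1 [OF x]
    by (simp add: s_defs w_defs wedge_def inner_diff_left inner_add_left field_simps power2_eq_square
        cs_square [OF x])
qed

section \<open>Levi-Civita connection and Gauss equations in the adapted frame\<close>

definition tt :: "3 \<Rightarrow> real^3 \<Rightarrow> real^3" where
  "tt a = (if a = 1 then t1 else if a = 2 then t2 else t3)"

definition ww :: "3 \<Rightarrow> 3 \<Rightarrow> real^3 \<Rightarrow> real^3" where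
  "ww a b = (if a = b then (\<lambda>x. 0)
     else if (a, b) = (1, 2) then w12 else if (a, b) = (2, 1) then (\<lambda>x. - w12 x)
     else if (a, b) = (1, 3) then w13 else if (a, b) = (3, 1) then (\<lambda>x. - w13 x)
     else if (a, b) = (2, 3) then w23 else (\<lambda>x. - w23 x))"

lemma tt_simps [simp]: "tt 1 = t1" "tt 2 = t2" "tt 3 = t3"
  by (simp_all add: tt_def)

lemma ww_simps [simp]: "ww a a = (\<lambda>x. 0)" "ww 1 2 = w12" "ww 2 1 = (\<lambda>x. - w12 x)"
  "ww 1 3 = w13" "ww 3 1 = (\<lambda>x. - w13 x)" "ww 2 3 = w23" "ww 3 2 = (\<lambda>x. - w23 x)"
  by (simp_all add: ww_def)

lemma smooth_w: "smooth_on U w12" "smooth_on U w13" "smooth_on U w23"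
  unfolding w_defs [abs_def] by (intro smooth_intros U)+

lemma smooth_tt: "smooth_on U (tt a)"
  using exhaust_3 [of a] sm by auto

lemma nondeg_tt: "x \<in> U \<Longrightarrow> (\<And>a. tt a x \<bullet> X = 0) \<Longrightarrow> X = 0"
  using indep tt_simps by metis

sublocale moving_frame U tt ww h
proof
  fix a b :: 3 and x X Y :: "real^3"
  show "smooth_on U (tt a)" by (rule smooth_tt)
  show "smooth_on U (ww a b)"
    using exhaust_3 [of a] exhaust_3 [of b] smooth_w by (auto intro!: smooth_intros)
  show "ww a b x = - ww b a x" if "x \<in> U"
    using exhaust_3 [of a] exhaust_3 [of b] by auto
  show "X = 0" if "x \<in> U" "\<And>a. tt a x \<bullet> X = 0" using nondeg_tt that by blast
  show "h x $ i $ j = (\<Sum>a\<in>UNIV. tt a x $ i * tt a x $ j)" if "x \<in> U" for i j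
    by (simp add: sum_3 metric [OF that])
  assume x: "x \<in> U"
  show "dform (tt a) x X Y = - (\<Sum>b\<in>UNIV. wedge (ww a b x) (tt b x) X Y)"
    using exhaust_3 [of a]
  proof (elim disjE)
    assume "a = 1"
    then show ?thesis
      by (simp add: sum_3 dt1 [OF x] w_defs wedge_def inner_diff_left inner_add_left field_simps)
  next
    assume "a = 2"
    then show ?thesis
      by (simp add: sum_3 dt2 [OF x] w_defs wedge_def inner_diff_left inner_add_left field_simps)
  next
    assume "a = 3"
    then show ?thesis
      by (simp add: sum_3 str6 [OF x] w_defs wedge_def inner_diff_left inner_add_left field_simps)
  qed
qed (rule U)

definition E :: "3 \<Rightarrow> real^3 \<Rightarrow> real^3" where
  "E b x = (SOME X. \<forall>a. tt a x \<bullet> X = (if a = b then 1 else 0))"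

lemma tt_E: "x \<in> U \<Longrightarrow> tt a x \<bullet> E b x = (if a = b then 1 else 0)"
proof -
  assume x: "x \<in> U"
  have "\<exists>X. \<forall>a. tt a x \<bullet> X = (if a = b then 1 else 0)"
    using rows_solve [of "\<lambda>a. tt a x" "\<lambda>a. if a = b then 1 else 0"] nondeg_tt [OF x] by metis
  from someI_ex [OF this] show ?thesis by (simp add: E_def)
qed

lemma t_E [simp]:
  assumes "x \<in> U"
  shows "t1 x \<bullet> E 1 x = 1" "t1 x \<bullet> E 2 x = 0" "t1 x \<bullet> E 3 x = 0"
    "t2 x \<bullet> E 1 x = 0" "t2 x \<bullet> E 2 x = 1" "t2 x \<bullet> E 3 x = 0"
    "t3 x \<bullet> E 1 x = 0" "t3 x \<bullet> E 2 x = 0" "t3 x \<bullet> E 3 x = 1"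
  using tt_E [OF assms, of 1] tt_E [OF assms, of 2] tt_E [OF assms, of 3] by simp_all

lemma smooth_E [smooth_intros]: "smooth_on U (E b)"
  by (rule smooth_on_solve [OF U smooth_tt smooth_on_const nondeg_tt tt_E])

lemma E_expansion:
  assumes x: "x \<in> U"
  shows "X = (t1 x \<bullet> X) *\<^sub>R E 1 x + (t2 x \<bullet> X) *\<^sub>R E 2 x + (t3 x \<bullet> X) *\<^sub>R E 3 x"
proof -
  have "X - ((t1 x \<bullet> X) *\<^sub>R E 1 x + (t2 x \<bullet> X) *\<^sub>R E 2 x + (t3 x \<bullet> X) *\<^sub>R E 3 x) = 0"
    by (rule indep [OF x]) (simp_all add: inner_diff_right inner_add_right x)
  then show ?thesis by simp
qed

lemma covector_expansion:
  assumes x: "x \<in> U"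
  shows "u \<bullet> X = (u \<bullet> E 1 x) * (t1 x \<bullet> X) + (u \<bullet> E 2 x) * (t2 x \<bullet> X) + (u \<bullet> E 3 x) * (t3 x \<bullet> X)"
  by (subst E_expansion [OF x, of X]) (simp add: inner_add_right)

lemma smooth_s [smooth_intros]: "smooth_on U s11" "smooth_on U s12" "smooth_on U s13"
  "smooth_on U s22" "smooth_on U s23" "smooth_on U s33" "smooth_on U ta"
  unfolding s_defs [abs_def] ta_def [abs_def] by (intro smooth_intros U)+

text \<open>The components 111, 112, 113, 122, 123, 222 and 223 of the cubic form; vanishing trace
  supplies the other three.\<close>

definition "ca x = s11 x \<bullet> E 1 x" for x
definition "cb x = s11 x \<bullet> E 2 x" for x
definition "cc x = s11 x \<bullet> E 3 x" for x
definition "cd x = s22 x \<bullet> E 1 x" for x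
definition "ce x = s12 x \<bullet> E 3 x" for x
definition "cf x = s22 x \<bullet> E 2 x" for x
definition "cg x = s22 x \<bullet> E 3 x" for x

lemmas c_defs = ca_def cb_def cc_def cd_def ce_def cf_def cg_def

lemma smooth_c [smooth_intros]: "smooth_on U ca" "smooth_on U cb" "smooth_on U cc"
  "smooth_on U cd" "smooth_on U ce" "smooth_on U cf" "smooth_on U cg"
  unfolding c_defs [abs_def] by (intro smooth_intros U)+

text \<open>Cartan's lemma: evaluating \<open>s_wedge\<close> on pairs of frame vectors makes the
  components totally symmetric, and \<open>s_trace\<close> eliminates the index pair 33.\<close>

lemma s_E:
  assumes x: "x \<in> U"
  shows "s11 x \<bullet> E 1 x = ca x" "s11 x \<bullet> E 2 x = cb x" "s11 x \<bullet> E 3 x = cc x"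
    "s12 x \<bullet> E 1 x = cb x" "s12 x \<bullet> E 2 x = cd x" "s12 x \<bullet> E 3 x = ce x"
    "s13 x \<bullet> E 1 x = cc x" "s13 x \<bullet> E 2 x = ce x" "s13 x \<bullet> E 3 x = - (ca x + cd x)"
    "s22 x \<bullet> E 1 x = cd x" "s22 x \<bullet> E 2 x = cf x" "s22 x \<bullet> E 3 x = cg x"
    "s23 x \<bullet> E 1 x = ce x" "s23 x \<bullet> E 2 x = cg x" "s23 x \<bullet> E 3 x = - (cb x + cf x)"
    "s33 x \<bullet> E 1 x = - (ca x + cd x)" "s33 x \<bullet> E 2 x = - (cb x + cf x)"
    "s33 x \<bullet> E 3 x = - (cc x + cg x)"
  using s_wedge [OF x, of "E 1 x" "E 2 x"] s_wedge [OF x, of "E 1 x" "E 3 x"]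
    s_wedge [OF x, of "E 2 x" "E 3 x"]
  by (simp_all add: wedge_def x c_defs s33_inner [OF x])

lemma Om_eq:
  assumes x: "x \<in> U"
  shows "Om 1 2 x X Y = wedge (s11 x) (s12 x) X Y + wedge (s12 x) (s22 x) X Y + wedge (s13 x) (s23 x) X Y
    + (10 * (sn x)\<^sup>2 * (cs x)\<^sup>2 + 1/4) * wedge (t1 x) (t2 x) X Y"
   "Om 1 3 x X Y = wedge (s11 x) (s13 x) X Y + wedge (s12 x) (s23 x) X Y + wedge (s13 x) (s33 x) X Y
    + ((sn x)\<^sup>2 + 1/4) * wedge (t1 x) (t3 x) X Y"
   "Om 2 3 x X Y = wedge (s12 x) (s13 x) X Y + wedge (s22 x) (s23 x) X Y + wedge (s23 x) (s33 x) X Y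
    + ((cs x)\<^sup>2 + 1/4) * wedge (t2 x) (t3 x) X Y"
  by (simp_all add: Om_def sum_3 curvature_form12 [OF x, symmetric] curvature_form13 [OF x, symmetric]
      curvature_form23 [OF x, symmetric]) (simp_all add: wedge_def)

lemma Om_skew:
  assumes x: "x \<in> U"
  shows "Om 2 1 x X Y = - Om 1 2 x X Y" "Om 3 1 x X Y = - Om 1 3 x X Y" "Om 3 2 x X Y = - Om 2 3 x X Y"
    "Om 1 1 x X Y = 0" "Om 2 2 x X Y = 0" "Om 3 3 x X Y = 0"
  by (simp_all add: Om_def sum_3 dform_uminus [OF x] smooth_w)
    (simp_all add: wedge_def dform_def algebra_simps)

lemma metric_t:
  "x \<in> U \<Longrightarrow> metric_at h x X Y = (t1 x \<bullet> X) * (t1 x \<bullet> Y) + (t2 x \<bullet> X) * (t2 x \<bullet> Y) + (t3 x \<bullet> X) * (t3 x \<bullet> Y)"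
  by (simp add: metric_at_def inner_h sum_3)

lemma Gauss:
  assumes x: "x \<in> U"
  shows "ca x * cd x + cb x * cf x + cc x * cg x - (cb x)\<^sup>2 - (cd x)\<^sup>2 - (ce x)\<^sup>2
      = K - 1/4 - 10 * (sn x)\<^sup>2 * (cs x)\<^sup>2" (is ?K12)
    "- ca x * (ca x + cd x) - cb x * (cb x + cf x) - cc x * (cc x + cg x) - (cc x)\<^sup>2 - (ce x)\<^sup>2 - (ca x + cd x)\<^sup>2
      = K - 1/4 - (sn x)\<^sup>2" (is ?K13)
    "- cd x * (ca x + cd x) - cf x * (cb x + cf x) - cg x * (cc x + cg x) - (ce x)\<^sup>2 - (cg x)\<^sup>2 - (cb x + cf x)\<^sup>2
      = K - 1/4 - (cs x)\<^sup>2" (is ?K23)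
    "ca x * ce x + cb x * cg x - cc x * (cb x + cf x) - (cc x * cb x + ce x * cd x - (ca x + cd x) * ce x) = 0" (is ?M1)
    "cd x * cc x + cf x * ce x - cg x * (ca x + cd x) - (cb x * ce x + cd x * cg x - ce x * (cb x + cf x)) = 0" (is ?M2)
    "- (ca x + cd x) * cb x - (cb x + cf x) * cd x - (cc x + cg x) * ce x
      - (cc x * ce x + ce x * cg x + (ca x + cd x) * (cb x + cf x)) = 0" (is ?M3)
proof -
  have *: "Om 1 2 x X Y * ((t1 x \<bullet> X) * (t2 x \<bullet> Y) - (t2 x \<bullet> X) * (t1 x \<bullet> Y))
    + Om 1 3 x X Y * ((t1 x \<bullet> X) * (t3 x \<bullet> Y) - (t3 x \<bullet> X) * (t1 x \<bullet> Y))
    + Om 2 3 x X Y * ((t2 x \<bullet> X) * (t3 x \<bullet> Y) - (t3 x \<bullet> X) * (t2 x \<bullet> Y))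
    = K * (metric_at h x X X * metric_at h x Y Y - (metric_at h x X Y)\<^sup>2)"
    if "metric_at h x X X * metric_at h x Y Y - (metric_at h x X Y)\<^sup>2 \<noteq> 0" for X Y
    using curv [OF x that]
    by (simp add: metric_curvature [OF x] sum_3 Om_skew [OF x] algebra_simps)
  note s = Om_eq [OF x] wedge_def inner_add_right metric_t [OF x] s_E [OF x] t_E [OF x]
  show ?K12 using * [of "E 1 x" "E 2 x"] by (simp add: s power2_eq_square algebra_simps)
  show ?K13 using * [of "E 1 x" "E 3 x"] by (simp add: s power2_eq_square algebra_simps)
  show ?K23 using * [of "E 2 x" "E 3 x"] by (simp add: s power2_eq_square algebra_simps)
  \<comment> \<open>Constant curvature only fixes values of the form <R(X,Y)Y,X>. The mixed
    components come from polarization with a sum of two frame vectors.\<close>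
  show ?M1 using * [of "E 1 x" "E 2 x + E 3 x"] * [of "E 1 x" "E 2 x"] * [of "E 1 x" "E 3 x"]
    by (simp add: s power2_eq_square algebra_simps)
  show ?M2 using * [of "E 2 x" "E 1 x + E 3 x"] * [of "E 2 x" "E 1 x"] * [of "E 2 x" "E 3 x"]
    by (simp add: s power2_eq_square algebra_simps)
  show ?M3 using * [of "E 3 x" "E 1 x + E 2 x"] * [of "E 3 x" "E 1 x"] * [of "E 3 x" "E 2 x"]
    by (simp add: s power2_eq_square algebra_simps)
qed

end

lemma inner_eqI: "(\<And>X. u \<bullet> X = v \<bullet> X) \<Longrightarrow> u = v"
  using vector_eq_rdot by blast

section \<open>The degenerate angles pi/4 and 0 on an open set\<close>

context adapted_coframe
begin

text \<open>A constant angle kills \<open>ta\<close>, and equal sine and cosine give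
  \<open>s11 = s22\<close>. Only \<open>cc = cg\<close> can survive, and the first two Gauss
  equations would make its square negative.\<close>

lemma no_diagonal:
  assumes eq: "\<And>x. x \<in> U \<Longrightarrow> sn x = cs x"
  shows False
proof -
  obtain x where x: "x \<in> U" using U_ne by blast
  have u: "2 * (cs x)\<^sup>2 = 1" using unit [OF x] eq [OF x] by simp
  then have nz: "cs x \<noteq> 0" by auto
  have "ta x \<bullet> X = 0" for X
  proof -
    have "D sn x X = D cs x X" by (rule D_eq_on_open [OF U x sm(1) eq])
    then show ?thesis using D_sn [OF x, of X] D_cs [OF x, of X] eq [OF x] nz by simp
  qed
  then have 0: "cb x = 0" "cd x = 0" "ce x = 0"
    using s_E(4-6) [OF x] by (simp_all add: s12_def)
  have "s11 x = s22 x"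
    using u by (simp add: s_defs eq [OF x] scaleR_diff_right scaleR_add_left [symmetric])
      (simp add: algebra_simps)
  then have "ca x = 0" "cg x = cc x" using s_E [OF x] 0 by simp_all
  then have "(cc x)\<^sup>2 = K - 1/4 - 10 * (cs x)\<^sup>2 * (cs x)\<^sup>2" "- 3 * (cc x)\<^sup>2 = K - 1/4 - (cs x)\<^sup>2"
    using Gauss(1,2) [OF x] 0 by (simp_all add: eq [OF x] power2_eq_square)
  moreover have "(cs x)\<^sup>2 = 1/2" using u by simp
  ultimately have "4 * (cc x)\<^sup>2 = -2" by simp
  then show False using zero_le_power2 [of "cc x"] by linarith
qed

text \<open>Only \<open>cf\<close> and \<open>cg\<close> survive, and Gauss' equations put them on a
  circle of radius squared 1/2. The structure equations for \<open>ga\<close> and \<open>d2\<close>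
  make the pair rotate with angular form \<open>v\<close>. Such a form has to be closed, but
  \<open>dv = - t2 ^ t3\<close>.\<close>

lemma no_zero:
  assumes sn: "\<And>x. x \<in> U \<Longrightarrow> sn x = 0" and cs: "\<And>x. x \<in> U \<Longrightarrow> cs x = 1"
  shows False
proof -
  have ta: "ta x \<bullet> X = 0" if x: "x \<in> U" for x X
    using D_sn [OF x, of X] cs [OF x] D_eq_0 [OF U x sn] by simp
  have 0: "cb x = 0" "cd x = 0" "ce x = 0" "cc x = 0" "ca x = 0" if x: "x \<in> U" for x
  proof -
    show *: "cb x = 0" "cd x = 0" "ce x = 0"
      using s_E(4-6) [OF x] ta [OF x] by (simp_all add: s12_def)
    show "cc x = 0" "ca x = 0"
      using s_E(7,9) [OF x] * by (simp_all add: s13_def sn [OF x])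
  qed
  have s22: "s22 x \<bullet> X = cf x * (t2 x \<bullet> X) + cg x * (t3 x \<bullet> X)" if x: "x \<in> U" for x X
    using covector_expansion [OF x, of "s22 x" X] s_E [OF x] 0 [OF x] by simp
  have d2: "d2 x \<bullet> X = cg x * (t2 x \<bullet> X) - cf x * (t3 x \<bullet> X)" if x: "x \<in> U" for x X
    using covector_expansion [OF x, of "s23 x" X] s_E [OF x] 0 [OF x] by (simp add: s23_def cs [OF x])
  have al: "al x \<bullet> X = 0" if x: "x \<in> U" for x X
    using covector_expansion [OF x, of "s11 x" X] s_E [OF x] 0 [OF x]
    by (simp add: s11_def cs [OF x] sn [OF x])
  have ga: "ga x \<bullet> X = cf x * (t2 x \<bullet> X) + cg x * (t3 x \<bullet> X)" if x: "x \<in> U" for x X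
    using s22 [OF x, of X] al [OF x, of X] by (simp add: s22_def cs [OF x] sn [OF x] inner_diff_left)
  have q: "(cf x)\<^sup>2 + (cg x)\<^sup>2 = 1/2" if x: "x \<in> U" for x
    using Gauss(1,3) [OF x] 0 [OF x] by (simp add: cs [OF x] sn [OF x] power2_eq_square)
  \<comment> \<open>With \<open>ga = cf t2 + cg t3\<close> and \<open>d2 = cg t2 - cf t3\<close>,
    the term \<open>t1 + d1\<close> comes from \<open>dform t2\<close> and \<open>dform t3\<close>,
    and \<open>2 d1\<close> from \<open>d1 ^ d2\<close>.\<close>
  define v where "v x = t1 x + 3 *\<^sub>R d1 x" for x
  have smv: "smooth_on U v" unfolding v_def [abs_def] by (intro smooth_intros U)
  have dv: "dform v x X Y = - wedge (t2 x) (t3 x) X Y" if x: "x \<in> U" for x X Y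
  proof -
    have "dform v x X Y = dform t1 x X Y + 3 * dform d1 x X Y"
      unfolding v_def [abs_def]
      by (subst dform_add [OF x] dform_const_scaleR [OF x], (intro smooth_intros U; fail)+)+ simp
    also have "\<dots> = - wedge (t2 x) (t3 x) X Y - 6 * (wedge (ga x) (d2 x) X Y + (1/2) * wedge (t2 x) (t3 x) X Y)"
      by (simp add: dt1 [OF x] dd1 [OF x] cs [OF x] sn [OF x])
    also have "wedge (ga x) (d2 x) X Y = - ((cf x)\<^sup>2 + (cg x)\<^sup>2) * wedge (t2 x) (t3 x) X Y"
      by (simp add: wedge_def ga [OF x] d2 [OF x] power2_eq_square algebra_simps)
    finally show ?thesis by (simp add: q [OF x])
  qed
  have D_cf: "D cf x X = cg x * (v x \<bullet> X)" and D_cg: "D cg x X = - cf x * (v x \<bullet> X)"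
    if x: "x \<in> U" for x X
  proof -
    \<comment> \<open>\<open>A\<close> and \<open>B\<close> measure the failure of the rotation
      equations. The two structure equations give Cauchy-Riemann relations between their components,
      and the constant radius gives \<open>cf A + cg B = 0\<close>. Together these force
      \<open>(cf^2 + cg^2) A = 0\<close>.\<close>
    define A where "A X = D cf x X - cg x * (v x \<bullet> X)" for X
    define B where "B X = D cg x X + cf x * (v x \<bullet> X)" for X
    have fA: "cf x * A X + cg x * B X = 0" for X
    proof -
      have "D (\<lambda>x. (cf x)\<^sup>2 + (cg x)\<^sup>2) x X = 0" by (rule D_eq_0 [OF U x q])
      then show ?thesis
        by (simp add: D_add [OF x] D_power2 [OF x] smooth_on_power smooth_c A_def B_def algebra_simps)
    qed
    have 1: "dform ga x X Y = dform (\<lambda>y. cf y *\<^sub>R t2 y + cg y *\<^sub>R t3 y) x X Y" for X Y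
    proof (rule dform_cong [OF U x sm(7)])
      show "ga y = cf y *\<^sub>R t2 y + cg y *\<^sub>R t3 y" if "y \<in> U" for y
        by (rule inner_eqI) (simp add: ga [OF that] inner_add_left)
    qed
    have 2: "dform d2 x X Y = dform (\<lambda>y. cg y *\<^sub>R t2 y - cf y *\<^sub>R t3 y) x X Y" for X Y
    proof (rule dform_cong [OF U x sm(9)])
      show "d2 y = cg y *\<^sub>R t2 y - cf y *\<^sub>R t3 y" if "y \<in> U" for y
        by (rule inner_eqI) (simp add: d2 [OF that] inner_diff_left)
    qed
    note w = wedge_def v_def ga [OF x] d2 [OF x] inner_add_left al [OF x]
    have AB: "A X * (t2 x \<bullet> Y) - A Y * (t2 x \<bullet> X) + B X * (t3 x \<bullet> Y) - B Y * (t3 x \<bullet> X) = 0" for X Y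
    proof -
      have "dform ga x X Y = D cf x X * (t2 x \<bullet> Y) - D cf x Y * (t2 x \<bullet> X) + cf x * dform t2 x X Y
        + (D cg x X * (t3 x \<bullet> Y) - D cg x Y * (t3 x \<bullet> X) + cg x * dform t3 x X Y)"
        unfolding 1
        by (subst dform_add [OF x] dform_scaleR [OF x], (intro smooth_intros U; fail)+)+ simp
      then show ?thesis
        unfolding dga [OF x] dt2 [OF x] str6 [OF x] A_def B_def
        by (simp add: w cs [OF x] sn [OF x] algebra_simps)
    qed
    have BA: "B X * (t2 x \<bullet> Y) - B Y * (t2 x \<bullet> X) - A X * (t3 x \<bullet> Y) + A Y * (t3 x \<bullet> X) = 0" for X Y
    proof -
      have "dform d2 x X Y = D cg x X * (t2 x \<bullet> Y) - D cg x Y * (t2 x \<bullet> X) + cg x * dform t2 x X Y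
        - (D cf x X * (t3 x \<bullet> Y) - D cf x Y * (t3 x \<bullet> X) + cf x * dform t3 x X Y)"
        unfolding 2
        by (subst dform_diff [OF x] dform_scaleR [OF x], (intro smooth_intros U; fail)+)+ simp
      then show ?thesis
        unfolding dd2 [OF x] dt2 [OF x] str6 [OF x] A_def B_def
        by (simp add: w cs [OF x] sn [OF x] algebra_simps)
    qed
    have AB0: "A (E 1 x) = 0" "B (E 1 x) = 0" "B (E 2 x) = A (E 3 x)" "B (E 3 x) = - A (E 2 x)"
      using AB [of "E 1 x" "E 2 x"] AB [of "E 1 x" "E 3 x"] AB [of "E 2 x" "E 3 x"]
        BA [of "E 2 x" "E 3 x"] x by auto
    have "(cf x)\<^sup>2 * A (E 2 x) + (cg x)\<^sup>2 * A (E 2 x) = 0" "(cf x)\<^sup>2 * A (E 3 x) + (cg x)\<^sup>2 * A (E 3 x) = 0"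
      using fA [of "E 2 x"] fA [of "E 3 x"] unfolding AB0 by algebra+
    then have AB1: "A (E 2 x) = 0" "A (E 3 x) = 0"
      unfolding distrib_right [symmetric] q [OF x] by auto
    define Av where "Av = grad cf x - cg x *\<^sub>R v x"
    define Bv where "Bv = grad cg x + cf x *\<^sub>R v x"
    have Av: "Av \<bullet> X = A X" and Bv: "Bv \<bullet> X = B X" for X
      by (simp_all add: Av_def Bv_def A_def B_def inner_diff_left inner_add_left grad_inner
          smooth_on_differentiable [OF _ x] smooth_c)
    have "A X = 0" "B X = 0" for X
      using covector_expansion [OF x, of Av X] covector_expansion [OF x, of Bv X] AB0 AB1
      by (simp_all add: Av Bv)
    then show "D cf x X = cg x * (v x \<bullet> X)" "D cg x X = - cf x * (v x \<bullet> X)"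
      by (simp_all add: A_def B_def eq_neg_iff_add_eq_0)
  qed
  obtain x where x: "x \<in> U" using U_ne by blast
  have "dform (\<lambda>y. cg y *\<^sub>R v y) x X Y = 0" for X Y
  proof -
    have "dform (grad cf) x X Y = dform (\<lambda>y. cg y *\<^sub>R v y) x X Y"
    proof (rule dform_cong [OF U x])
      show "grad cf y = cg y *\<^sub>R v y" if y: "y \<in> U" for y
        using D_cf [OF y] by (simp add: grad_def vec_eq_iff inner_axis)
    qed (intro smooth_intros U)
    then show ?thesis using dform_grad [OF U x smooth_c(6)] by simp
  qed
  moreover have "dform (\<lambda>y. - cf y *\<^sub>R v y) x X Y = 0" for X Y
  proof -
    have "dform (grad cg) x X Y = dform (\<lambda>y. - cf y *\<^sub>R v y) x X Y"
    proof (rule dform_cong [OF U x])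
      show "grad cg y = - cf y *\<^sub>R v y" if y: "y \<in> U" for y
        using D_cg [OF y] by (simp add: grad_def vec_eq_iff inner_axis)
    qed (intro smooth_intros U)
    then show ?thesis using dform_grad [OF U x smooth_c(7)] by simp
  qed
  ultimately have "cg x * dform v x X Y = 0" "cf x * dform v x X Y = 0" for X Y
    by (simp_all add: dform_scaleR [OF x] dform_uminus [OF x] smooth_on_scaleR smooth_c smv
        D_cf [OF x] D_cg [OF x] dv [OF x])
  from this [of "E 2 x" "E 3 x"] have "cg x = 0" "cf x = 0" by (simp_all add: dv [OF x] wedge_def x)
  then show False using q [OF x] by simp
qed

end

text \<open>A polynomial has finitely many roots, and a continuous function with finite range on a
  ball is constant.\<close>

lemma D_eq_0_if_algebraic:
  fixes s :: "'a::euclidean_space \<Rightarrow> real"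
  assumes W: "open W" "x \<in> W" and s: "smooth_on W s"
    and p: "p \<noteq> 0" "\<And>y. y \<in> W \<Longrightarrow> poly p (s y) = 0"
  shows "D s x X = 0"
proof -
  obtain e where e: "e > 0" "ball x e \<subseteq> W" using W open_contains_ball by blast
  have "finite (s ` ball x e)"
    using finite_subset [OF _ poly_roots_finite [OF p(1)]] p(2) e(2) by blast
  moreover have "continuous_on (ball x e) s"
    using smooth_on_continuous [OF s] e(2) continuous_on_subset by blast
  ultimately have "s constant_on ball x e"
    by (intro continuous_finite_range_constant) auto
  then obtain c where "\<And>y. y \<in> ball x e \<Longrightarrow> s y = c" by (auto simp: constant_on_def)
  then show ?thesis using D_eq_0 [of "ball x e" x s c] e(1) by auto
qed

text \<open>The first equation reduces \<open>z^2\<close> to \<open>z/8 + 3/40\<close>, which makes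
  the second read \<open>(5z+4) N = 2 z^2\<close>. The third, multiplied by \<open>5z+4\<close>,
  collapses to \<open>z (59z+2) = 0\<close>, and neither root satisfies the first.\<close>

lemma no_common_root:
  fixes z N :: real
  assumes "5*z*(8*z-1) = 3" "2*z\<^sup>2*(1-20*N) = N" "z*(15*N-1)*(8*z-1) = - N - 2*z\<^sup>2*(100*N-9)"
  shows False
proof -
  have 1: "z\<^sup>2 = z/8 + 3/40" using assms(1) by (simp add: power2_eq_square algebra_simps)
  have 2: "(5*z+4)*N = 2*z\<^sup>2"
    using assms(2) unfolding 1 by (simp add: field_simps)
  have "z * ((15*((5*z+4)*N) - (5*z+4)) * (8*z-1)) = (5*z+4) * (z*(15*N-1)*(8*z-1))"
    by (simp add: algebra_simps)
  also have "\<dots> = - ((5*z+4)*N) - 2*z\<^sup>2*(100*((5*z+4)*N)-9*(5*z+4))"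
    unfolding assms(3) by (simp add: algebra_simps)
  finally have "z * ((15*(2*z\<^sup>2) - (5*z+4)) * (8*z-1)) = - (2*z\<^sup>2) - 2*z\<^sup>2*(100*(2*z\<^sup>2)-9*(5*z+4))"
    unfolding 2 .
  then have "z * ((15*(2*z\<^sup>2) - (5*z+4)) * (8*z-1) + 2*z + 2*z*(100*(2*z\<^sup>2)-9*(5*z+4))) = 0"
    by (simp add: algebra_simps power2_eq_square)
  moreover have "(15*(2*z\<^sup>2) - (5*z+4)) * (8*z-1) + 2*z + 2*z*(100*(2*z\<^sup>2)-9*(5*z+4)) = - 59*z - 2"
  proof -
    have zz: "z * z = z/8 + 3/40" "z * (z * w) = (z/8 + 3/40) * w" for w
      using 1 by (simp_all add: power2_eq_square mult.assoc [symmetric])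
    show ?thesis unfolding power2_eq_square by (simp add: algebra_simps zz diff_divide_distrib add_divide_distrib)
  qed
  ultimately have "z = 0 \<or> z = - 2/59" by auto
  then show False using 1 by (auto simp: power2_eq_square)
qed

section \<open>Generic angles: 0 < theta < pi/4\<close>

locale generic_coframe = adapted_coframe +
  assumes sn_pos: "\<And>x. x \<in> U \<Longrightarrow> 0 < sn x" and sn_less: "\<And>x. x \<in> U \<Longrightarrow> sn x < cs x"
begin

definition s where "s x = (sn x)\<^sup>2" for x
definition n where "n x = sn x * cs x" for x
definition N where "N x = s x * (1 - s x)" for x
text \<open>\<open>u\<close> and \<open>v\<close> are the differences \<open>k13 - k12\<close> and
  \<open>k23 - k12\<close> of \<open>Gauss_linear_relations\<close>, in which \<open>K\<close>
  cancels.\<close>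

definition u where "u x = s x * (9 - 10 * s x)" for x
definition v where "v x = (1 - s x) * (10 * s x - 1)" for x
text \<open>The proportionality factors in the solution of the linear relations. Dividing by
  \<open>u - v = 1 - 2s\<close>, which is positive, keeps them smooth, whereas \<open>v\<close> may
  vanish (at \<open>s = 1/10\<close>).\<close>

definition lam where "lam x = (cc x - cg x) / (1 - 2 * s x)" for x
definition et where "et x = (ca x + cd x) / (1 - 2 * s x)" for x
definition mu where "mu x = - (cb x + cf x) / (1 - 2 * s x)" for x

definition nu1 where "nu1 x = 10 * n x * lam x * (1 - s x) - 1" for x
definition nu2 where "nu2 x = 10 * n x * lam x * s x - 1" for x

lemma s_range: "x \<in> U \<Longrightarrow> 0 < s x" "x \<in> U \<Longrightarrow> s x < 1/2"
proof -
  assume x: "x \<in> U"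
  show "0 < s x" using sn_pos [OF x] by (simp add: s_def)
  have "(sn x)\<^sup>2 < (cs x)\<^sup>2" using sn_pos [OF x] sn_less [OF x] by (intro power_strict_mono) auto
  then show "s x < 1/2" using unit [OF x] by (simp add: s_def)
qed

lemma cs_s: "x \<in> U \<Longrightarrow> (cs x)\<^sup>2 = 1 - s x"
  using unit [of x] by (simp add: s_def)

lemma n2: "x \<in> U \<Longrightarrow> (n x)\<^sup>2 = N x"
  by (simp add: n_def N_def power_mult_distrib cs_s) (simp add: s_def)

lemma n_pos: "x \<in> U \<Longrightarrow> n x > 0" and cs_pos: "x \<in> U \<Longrightarrow> cs x > 0"
  using sn_pos [of x] sn_less [of x] by (auto simp: n_def)

lemma uv: "u x - v x = 1 - 2 * s x" "u x + v x = 20 * N x - 1" "u x * v x = N x * (100 * N x - 9)"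
  "u x * (1 - s x) - v x * s x = 10 * N x * (1 - 2 * s x)"
  by (simp_all add: u_def v_def N_def algebra_simps)

lemma u_pos: "x \<in> U \<Longrightarrow> u x > 0" and N_pos: "x \<in> U \<Longrightarrow> N x > 0"
  using s_range [of x] by (auto simp: u_def N_def)

lemma smooth_s' [smooth_intros]: "smooth_on U s" "smooth_on U n" "smooth_on U N" "smooth_on U u" "smooth_on U v"
  unfolding s_def [abs_def] n_def [abs_def] N_def [abs_def] u_def [abs_def] v_def [abs_def]
  by (intro smooth_intros U)+

lemma smooth_lam [smooth_intros]: "smooth_on U lam" "smooth_on U et" "smooth_on U mu"
  unfolding lam_def [abs_def] et_def [abs_def] mu_def [abs_def]
  by (intro smooth_intros U; use s_range(2) in fastforce)+

lemma c_eq: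
  assumes x: "x \<in> U"
  shows "ce x = 0" and "cc x = lam x * u x" (is ?c) and "cg x = lam x * v x" (is ?g)
    and "ca x = et x * (u x - 2 * v x)" (is ?a) and "cd x = et x * v x" (is ?d)
    and "cb x = mu x * u x" (is ?b) and "cf x = mu x * (v x - 2 * u x)" (is ?f)
proof -
  let ?k12 = "K - 1/4 - 10 * (sn x)\<^sup>2 * (cs x)\<^sup>2"
  let ?k13 = "K - 1/4 - (sn x)\<^sup>2"
  let ?k23 = "K - 1/4 - (cs x)\<^sup>2"
  have k: "?k13 - ?k12 = u x" "?k23 - ?k12 = v x"
    by (simp_all add: cs_s [OF x] u_def v_def s_def [symmetric] algebra_simps)
  have ne: "?k13 \<noteq> ?k23" using s_range [OF x] by (simp add: cs_s [OF x] s_def [symmetric])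
  note G = Gauss [OF x]
  note rel = Gauss_linear_relations [OF G(4-6) G(1-3) ne, unfolded k]
  show "ce x = 0" by (rule rel(1))
  have p: "1 - 2 * s x \<noteq> 0" using s_range [OF x] by simp
  have d: "lam x * (u x - v x) = cc x - cg x" "et x * (u x - v x) = ca x + cd x"
    "mu x * (u x - v x) = - (cb x + cf x)"
    using p by (simp_all add: lam_def et_def mu_def uv)
  have uvne: "u x - v x \<noteq> 0" using p by (simp add: uv)
  have "(cc x - lam x * u x) * (u x - v x) = 0" "(cg x - lam x * v x) * (u x - v x) = 0"
    "(ca x - et x * (u x - 2 * v x)) * (u x - v x) = 0" "(cd x - et x * v x) * (u x - v x) = 0"
    "(cb x - mu x * u x) * (u x - v x) = 0" "(cf x - mu x * (v x - 2 * u x)) * (u x - v x) = 0"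
    using rel d by algebra+
  then show ?c ?g ?a ?d ?b ?f
    using uvne by simp_all
qed

text \<open>The difference of the last two diagonal Gauss equations, in which \<open>K\<close>
  cancels, divided by \<open>u - v\<close>.\<close>

lemma star:
  assumes x: "x \<in> U"
  shows "(et x)\<^sup>2 * (2 * v x - u x) + (mu x)\<^sup>2 * (2 * u x - v x) - (lam x)\<^sup>2 * (u x + v x) = 1/2"
proof -
  have "(2 * ((et x)\<^sup>2 * (2 * v x - u x) + (mu x)\<^sup>2 * (2 * u x - v x) - (lam x)\<^sup>2 * (u x + v x)))
    * (u x - v x) = u x - v x"
    using Gauss(2,3) [OF x] unfolding c_eq [OF x] cs_s [OF x] uv(1) s_def [symmetric]
    using uv(1) [of x] by algebra
  moreover have "u x - v x \<noteq> 0" using s_range [OF x] by (simp add: uv)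
  ultimately show ?thesis by simp
qed

lemma K_eq:
  assumes x: "x \<in> U"
  shows "10 * N x + (et x)\<^sup>2 * v x * (u x - 3 * v x) + (mu x)\<^sup>2 * u x * (v x - 3 * u x)
    + (lam x)\<^sup>2 * (u x * v x) = K - 1/4"
  using Gauss(1) [OF x] unfolding c_eq [OF x] cs_s [OF x] s_def [symmetric]
  by (simp add: N_def power2_eq_square algebra_simps)

text \<open>Here \<open>ds = -2n s12\<close>, and the vanishing of \<open>ce\<close> makes
  \<open>s\<close> constant along \<open>E 3\<close>. This singles out \<open>E 3\<close> as the
  direction for the following differentiations.\<close>

lemma D_s:
  assumes x: "x \<in> U"
  shows "D s x (E 1 x) = - 2 * n x * cb x" "D s x (E 2 x) = - 2 * n x * cd x" "D s x (E 3 x) = 0"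
proof -
  have "D s x X = - 2 * n x * (s12 x \<bullet> X)" for X
    unfolding s_def [abs_def] D_power2 [OF x sm(1)] D_sn [OF x] by (simp add: n_def s12_def)
  then show "D s x (E 1 x) = - 2 * n x * cb x" "D s x (E 2 x) = - 2 * n x * cd x" "D s x (E 3 x) = 0"
    by (simp_all add: s_E [OF x] c_eq(1) [OF x])
qed

lemma D_functions_of_s:
  assumes x: "x \<in> U" and D: "D s x X = 0"
  shows "D u x X = 0" "D v x X = 0" "D N x X = 0" "D n x X = 0"
proof -
  note D' = D_mult [OF x] D_diff [OF x] smooth_on_mult smooth_on_diff smooth_on_const smooth_s' D
  show "D u x X = 0" "D v x X = 0" "D N x X = 0"
    unfolding u_def [abs_def] v_def [abs_def] N_def [abs_def] by (simp_all add: D')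
  have "D (\<lambda>x. (n x)\<^sup>2) x X = D N x X"
    by (rule D_eq_on_open [OF U x]) (auto intro!: smooth_intros U n2)
  then show "D n x X = 0"
    using n_pos [OF x] by (simp add: D_power2 [OF x] smooth_s' \<open>D N x X = 0\<close>)
qed

lemma connection_E:
  assumes x: "x \<in> U"
  shows "3 * (al x \<bullet> E 3 x) - ga x \<bullet> E 3 x = lam x"
    "d1 x \<bullet> E 2 x = 0" "d2 x \<bullet> E 1 x = 0"
    "cs x * (d1 x \<bullet> E 1 x) = - n x * lam x * (9 - 10 * s x)"
    "sn x * (d2 x \<bullet> E 2 x) = n x * lam x * (10 * s x - 1)"
proof -
  have c: "cs x * cs x = 1 - s x" "sn x * sn x = s x"
    using cs_s [OF x] by (simp_all add: s_def power2_eq_square)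
  have "s11 x \<bullet> E 3 x - s22 x \<bullet> E 3 x = (1 - 2 * s x) * (3 * (al x \<bullet> E 3 x) - ga x \<bullet> E 3 x)"
    by (simp add: s11_def s22_def inner_diff_left inner_add_left power2_eq_square c algebra_simps)
  then show "3 * (al x \<bullet> E 3 x) - ga x \<bullet> E 3 x = lam x"
    using s_range [OF x] by (simp add: s_E [OF x] lam_def)
  show "d1 x \<bullet> E 2 x = 0"
    using s_E(8) [OF x] sn_pos [OF x] by (simp add: s13_def c_eq [OF x])
  show "d2 x \<bullet> E 1 x = 0"
    using s_E(13) [OF x] cs_pos [OF x] by (simp add: s23_def c_eq [OF x])
  have "sn x * (cs x * (d1 x \<bullet> E 1 x)) = sn x * (- n x * lam x * (9 - 10 * s x))"
    using s_E(7) [OF x] c unfolding s13_def n_def c_eq [OF x] u_def inner_minus_left inner_scaleR_left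
    by algebra
  then show "cs x * (d1 x \<bullet> E 1 x) = - n x * lam x * (9 - 10 * s x)"
    using sn_pos [OF x] unfolding mult_cancel_left by simp
  have "cs x * (sn x * (d2 x \<bullet> E 2 x)) = cs x * (n x * lam x * (10 * s x - 1))"
    using s_E(14) [OF x] c unfolding s23_def n_def c_eq [OF x] v_def inner_scaleR_left
    by algebra
  then show "sn x * (d2 x \<bullet> E 2 x) = n x * lam x * (10 * s x - 1)"
    using cs_pos [OF x] unfolding mult_cancel_left by simp
qed

text \<open>The form \<open>s12 = - d theta\<close> is closed. Expanding it as
  \<open>cb t1 + cd t2\<close> and evaluating its exterior derivative on \<open>E 3\<close> with
  \<open>E 1\<close> or \<open>E 2\<close> gives the two derivatives.\<close>

lemma D_cb: "x \<in> U \<Longrightarrow> D cb x (E 3 x) = - cd x * nu1 x"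
  and D_cd: "x \<in> U \<Longrightarrow> D cd x (E 3 x) = cb x * nu2 x"
proof -
  assume x: "x \<in> U"
  have eq: "s12 y = cb y *\<^sub>R t1 y + cd y *\<^sub>R t2 y" if y: "y \<in> U" for y
    by (rule inner_eqI)
      (subst covector_expansion [OF y, of "s12 y"], simp add: s_E [OF y] c_eq(1) [OF y] inner_add_left)
  have 0: "dform s12 x X Y = 0" for X Y
  proof -
    have "dform s12 x X Y = - dform ta x X Y"
      unfolding s12_def [abs_def] by (rule dform_uminus [OF x smooth_s(7)])
    also have "dform ta x X Y = 0"
      unfolding ta_def [abs_def]
      by (subst dform_diff [OF x] dform_scaleR [OF x], (intro smooth_intros U; fail)+)+
        (simp add: dform_grad [OF U x] sm grad_inner smooth_on_differentiable [OF _ x]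
          D_sn [OF x] D_cs [OF x])
    finally show ?thesis by simp
  qed
  have 1: "D cb x X * (t1 x \<bullet> Y) - D cb x Y * (t1 x \<bullet> X) + cb x * dform t1 x X Y
    + (D cd x X * (t2 x \<bullet> Y) - D cd x Y * (t2 x \<bullet> X) + cd x * dform t2 x X Y) = 0" for X Y
  proof -
    have "dform s12 x X Y = dform (\<lambda>y. cb y *\<^sub>R t1 y + cd y *\<^sub>R t2 y) x X Y"
      by (rule dform_cong [OF U x smooth_s(2) eq])
    also have "\<dots> = D cb x X * (t1 x \<bullet> Y) - D cb x Y * (t1 x \<bullet> X) + cb x * dform t1 x X Y
      + (D cd x X * (t2 x \<bullet> Y) - D cd x Y * (t2 x \<bullet> X) + cd x * dform t2 x X Y)"
      by (subst dform_add [OF x] dform_scaleR [OF x], (intro smooth_intros U; fail)+)+ simp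
    finally show ?thesis using 0 by simp
  qed
  note w = dt1 [OF x] dt2 [OF x] wedge_def t_E [OF x] connection_E(2,3) [OF x]
  have "D cb x (E 3 x) = - cd x * (n x * (3 * (al x \<bullet> E 3 x) - ga x \<bullet> E 3 x) - 1 - cs x * (d1 x \<bullet> E 1 x))"
    using 1 [of "E 3 x" "E 1 x"] by (simp add: w n_def algebra_simps)
  then show "D cb x (E 3 x) = - cd x * nu1 x"
    unfolding connection_E [OF x] nu1_def by (simp add: algebra_simps)
  have "D cd x (E 3 x) = cb x * (n x * (3 * (al x \<bullet> E 3 x) - ga x \<bullet> E 3 x) - 1 + sn x * (d2 x \<bullet> E 2 x))"
    using 1 [of "E 3 x" "E 2 x"] by (simp add: w n_def algebra_simps)
  then show "D cd x (E 3 x) = cb x * nu2 x"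
    unfolding connection_E [OF x] nu2_def by (simp add: algebra_simps)
qed

text \<open>Along \<open>E 3\<close> the functions \<open>u\<close>, \<open>v\<close> and
  \<open>N\<close> behave as constants, so differentiating \<open>cb = mu u\<close>,
  \<open>cd = et v\<close>, \<open>star\<close> and \<open>K_eq\<close> gives four linear equations
  for three derivatives.\<close>

lemma E3_derivatives:
  assumes x: "x \<in> U"
  defines "De \<equiv> D et x (E 3 x)" and "Dm \<equiv> D mu x (E 3 x)" and "Dl \<equiv> D lam x (E 3 x)"
  shows "u x * Dm = - et x * v x * nu1 x" (is ?e0)
    "v x * De = mu x * u x * nu2 x" (is ?e1)
    "et x * De * (2 * v x - u x) + mu x * Dm * (2 * u x - v x) = lam x * Dl * (u x + v x)" (is ?e2)
    "et x * De * v x * (u x - 3 * v x) + mu x * Dm * u x * (v x - 3 * u x) + lam x * Dl * (u x * v x) = 0" (is ?e3)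
proof -
  note D0 = D_functions_of_s [OF x D_s(3) [OF x]]
  note D' = D_mult [OF x] D_diff [OF x] D_add [OF x] D_power2 [OF x] smooth_on_mult smooth_on_diff
    smooth_on_add smooth_on_power smooth_on_const smooth_s' smooth_lam D0
  have "D cb x (E 3 x) = D (\<lambda>x. mu x * u x) x (E 3 x)"
    by (rule D_eq_on_open [OF U x smooth_c(2) c_eq(6)])
  then show ?e0
    by (simp add: D' D_cb [OF x] c_eq(5) [OF x] Dm_def)
  have "D cd x (E 3 x) = D (\<lambda>x. et x * v x) x (E 3 x)"
    by (rule D_eq_on_open [OF U x smooth_c(4) c_eq(5)])
  then show ?e1
    by (simp add: D' D_cd [OF x] c_eq(6) [OF x] De_def)
  have "D (\<lambda>x. (et x)\<^sup>2 * (2 * v x - u x) + (mu x)\<^sup>2 * (2 * u x - v x) - (lam x)\<^sup>2 * (u x + v x)) x (E 3 x) = 0"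
    by (rule D_eq_0 [OF U x star])
  then show ?e2
    by (simp add: D' De_def Dm_def Dl_def algebra_simps)
  have "D (\<lambda>x. 10 * N x + (et x)\<^sup>2 * v x * (u x - 3 * v x) + (mu x)\<^sup>2 * u x * (v x - 3 * u x)
    + (lam x)\<^sup>2 * (u x * v x)) x (E 3 x) = 0"
    by (rule D_eq_0 [OF U x K_eq])
  then show ?e3
    by (simp add: D' De_def Dm_def Dl_def algebra_simps)
qed

text \<open>Where both components are nonzero, eliminating the three derivatives leaves
  \<open>u nu1 = v nu2\<close>, which prescribes \<open>lam n N\<close>. Then \<open>lam\<close> is
  constant along \<open>E 3\<close> too, and the overdetermined system gives
  \<open>nu1 = nu2 = 0\<close>. That means \<open>lam = 0\<close>, whereas \<open>lam = 0\<close>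
  makes \<open>nu1 = -1\<close>.\<close>

lemma cb_cd_0:
  assumes x: "x \<in> U"
  shows "cb x * cd x = 0"
proof (rule ccontr)
  assume "cb x * cd x \<noteq> 0"
  define W where "W = {y \<in> U. cb y * cd y \<in> - {0}}"
  have "continuous_on U (\<lambda>y. cb y * cd y)"
    by (intro smooth_on_continuous smooth_intros U)
  then have W: "open W"
    unfolding W_def by (rule continuous_open_preimage [OF _ U, unfolded vimage_def Int_def, simplified]) auto
  have xW: "x \<in> W" using x \<open>cb x * cd x \<noteq> 0\<close> by (simp add: W_def)
  have nz: "et y \<noteq> 0" "mu y \<noteq> 0" "v y \<noteq> 0" "u y \<noteq> 0" "y \<in> U" if "y \<in> W" for y
    using that by (auto simp: W_def c_eq)
  have uv_eq: "u y * nu1 y = v y * nu2 y"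
    if y: "y \<in> W" for y
  proof -
    \<comment> \<open>Adding \<open>u v\<close> times the third relation and \<open>u + v\<close>
      times the fourth removes the derivative of \<open>lam\<close> and leaves
      \<open>v^3 et De + u^3 mu Dm = 0\<close>; the first two relations then substitute
      \<open>De\<close> and \<open>Dm\<close>.\<close>
    have "et y * mu y * u y * v y * (u y * nu1 y - v y * nu2 y) = 0"
      using E3_derivatives [OF nz(5) [OF y]] by algebra
    then show ?thesis using nz [OF y] by simp
  qed
  have lam: "100 * (lam y * n y * N y) = 1" if y: "y \<in> W" for y
  proof -
    have "(100 * (lam y * n y * N y) - 1) * (1 - 2 * s y) = 0"
      using uv_eq [OF y] uv(1,4) [of y] unfolding nu1_def nu2_def by algebra
    then show ?thesis using s_range [OF nz(5) [OF y]] by simp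
  qed
  have "D (\<lambda>y. 100 * (lam y * n y * N y)) x (E 3 x) = 0"
    by (rule D_eq_0 [OF W xW lam])
  then have Dl: "D lam x (E 3 x) = 0"
    using n_pos [OF x] N_pos [OF x]
    by (simp add: D_mult [OF x] smooth_on_mult smooth_on_const smooth_s' smooth_lam
        D_functions_of_s [OF x D_s(3) [OF x]])
  \<comment> \<open>The cube is \<open>u^2 (u - 3v) - v^2 (v - 3u)\<close>, from the fourth relation
    without its \<open>Dl\<close> term.\<close>
  have "et x * mu x * (u x) * nu1 x * (u x - v x) ^ 3 = 0"
    using E3_derivatives [OF x] uv_eq [OF xW] unfolding Dl by algebra
  moreover have "u x - v x \<noteq> 0" using s_range [OF x] by (simp add: uv)
  ultimately have 1: "nu1 x = 0" using nz [OF xW] by simp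
  then have "nu2 x = 0" using uv_eq [OF xW] nz [OF xW] by simp
  with 1 have "10 * n x * lam x * (1 - 2 * s x) = 0" unfolding nu1_def nu2_def by algebra
  with 1 show False using s_range [OF x] by (auto simp: nu1_def)
qed

end

section \<open>Constancy of s and the final contradiction\<close>

context generic_coframe
begin

lemma open_nonzero: "smooth_on U r \<Longrightarrow> open {y \<in> U. r y \<noteq> (0::real)}"
  using continuous_open_preimage [OF smooth_on_continuous U, of r "- {0}"]
  by (simp add: vimage_def Int_def open_Compl)

text \<open>Near a point with \<open>cb\<close> nonzero, \<open>cd = 0\<close> forces
  \<open>nu2 = 0\<close>, which expresses \<open>lam^2\<close> through \<open>s\<close>. Eliminating
  \<open>mu^2\<close> from \<open>star\<close> and \<open>K_eq\<close> then gives a polynomial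
  equation for \<open>s\<close>. So \<open>s\<close> is locally constant, against
  \<open>D_s\<close>.\<close>

lemma cb_0:
  assumes x: "x \<in> U"
  shows "cb x = 0"
proof (rule ccontr)
  assume "cb x \<noteq> 0"
  define W where "W = {y \<in> U. cb y \<noteq> 0}"
  have W: "open W" unfolding W_def by (intro open_nonzero smooth_intros)
  have xW: "x \<in> W" using x \<open>cb x \<noteq> 0\<close> by (simp add: W_def)
  have cd: "cd y = 0" if "y \<in> W" for y using that cb_cd_0 by (auto simp: W_def)
  define pu where "pu = [:0, 9, -10 :: real:]"
  define pv where "pv = [:1, -1:] * [:-1, 10 :: real:]"
  define P where "P = [:0, 0, 0, 100:] * [:1, -1 :: real:]"
  define k where "k = [:K - 1/4:] - 10 * ([:0, 1:] * [:1, -1:])"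
  define Q where "Q = (P * k - pu * pv) * (2 * pu - pv) - pu * (pv - 3 * pu) * ([:1/2:] * P + pu + pv)"
  have "D s x (E 1 x) = 0"
  proof (rule D_eq_0_if_algebraic [OF W xW])
    show "smooth_on W s" using smooth_on_subset [OF smooth_s'(1)] by (auto simp: W_def)
    \<comment> \<open>At 1 both \<open>pv\<close> and \<open>P\<close> vanish, so the unknown
      \<open>K\<close> drops out and \<open>Q\<close> has the value -3.\<close>
    have "poly Q 1 \<noteq> 0" by (simp add: Q_def pu_def pv_def P_def)
    moreover have "poly pv 0 \<noteq> 0" by (simp add: pv_def)
    ultimately show "pv * Q \<noteq> 0" by auto
    show "poly (pv * Q) (s y) = 0" if y: "y \<in> W" for y
    proof -
      have yU: "y \<in> U" using y by (simp add: W_def)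
      have "D cd y (E 3 y) = 0" by (rule D_eq_0 [OF W y cd])
      then have 1: "10 * n y * lam y * s y = 1" using y D_cd [OF yU] by (simp add: W_def nu1_def nu2_def)
      have "(10 * n y * lam y * s y)\<^sup>2 = 100 * N y * (s y)\<^sup>2 * (lam y)\<^sup>2"
        by (simp add: power_mult_distrib n2 [OF yU])
      then have L: "100 * N y * (s y)\<^sup>2 * (lam y)\<^sup>2 = 1" unfolding 1 by simp
      have "et y * v y = 0" using cd [OF y] c_eq(5) [OF yU] by simp
      \<comment> \<open>The extra factor \<open>v\<close> is needed because \<open>et v = 0\<close>
        does not give \<open>et = 0\<close> at zeros of \<open>v\<close>.\<close>
      then have "v y * ((100 * N y * (s y)\<^sup>2 * (K - 1/4 - 10 * N y) - u y * v y) * (2 * u y - v y)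
          - u y * (v y - 3 * u y) * (1/2 * (100 * N y * (s y)\<^sup>2) + u y + v y)) = 0"
        using star [OF yU] K_eq [OF yU] L by algebra
      moreover have "poly pu (s y) = u y" "poly pv (s y) = v y" "poly P (s y) = 100 * N y * (s y)\<^sup>2"
        "poly k (s y) = K - 1/4 - 10 * N y"
        by (simp_all add: pu_def pv_def P_def k_def u_def v_def N_def power2_eq_square algebra_simps)
      ultimately show ?thesis by (simp add: Q_def)
    qed
  qed
  then show False using D_s(1) [OF x] n_pos [OF x] \<open>cb x \<noteq> 0\<close> by simp
qed

text \<open>With \<open>cb\<close> gone everywhere, \<open>mu = 0\<close>, and the vanishing
  derivative of \<open>cb\<close> now forces \<open>nu1 = 0\<close> where \<open>cd\<close> is
  nonzero. The elimination concerns \<open>et^2\<close> instead of \<open>mu^2\<close>.\<close>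

lemma cd_0:
  assumes x: "x \<in> U"
  shows "cd x = 0"
proof (rule ccontr)
  assume "cd x \<noteq> 0"
  define W where "W = {y \<in> U. cd y \<noteq> 0}"
  have W: "open W" unfolding W_def by (intro open_nonzero smooth_intros)
  have xW: "x \<in> W" using x \<open>cd x \<noteq> 0\<close> by (simp add: W_def)
  define pu where "pu = [:0, 9, -10 :: real:]"
  define pv where "pv = [:1, -1:] * [:-1, 10 :: real:]"
  define P where "P = [:0, 100:] * ([:1, -1 :: real:] * [:1, -1 :: real:] * [:1, -1 :: real:])"
  define k where "k = [:K - 1/4:] - 10 * ([:0, 1:] * [:1, -1:])"
  define Q where "Q = (P * k - pu * pv) * (2 * pv - pu) - pv * (pu - 3 * pv) * ([:1/2:] * P + pu + pv)"
  have "D s x (E 2 x) = 0"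
  proof (rule D_eq_0_if_algebraic [OF W xW])
    show "smooth_on W s" using smooth_on_subset [OF smooth_s'(1)] by (auto simp: W_def)
    \<comment> \<open>Here \<open>pu\<close> and \<open>P\<close> vanish at 0, again removing
      \<open>K\<close> and leaving -3.\<close>
    have "poly Q 0 \<noteq> 0" by (simp add: Q_def pu_def pv_def P_def)
    then show "Q \<noteq> 0" by auto
    show "poly Q (s y) = 0" if y: "y \<in> W" for y
    proof -
      have yU: "y \<in> U" using y by (simp add: W_def)
      have "D cb y (E 3 y) = 0" by (rule D_eq_0 [OF U yU cb_0])
      then have 1: "10 * n y * lam y * (1 - s y) = 1" using y D_cb [OF yU] by (simp add: W_def nu1_def nu2_def)
      have "(10 * n y * lam y * (1 - s y))\<^sup>2 = 100 * N y * (1 - s y)\<^sup>2 * (lam y)\<^sup>2"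
        by (simp add: power_mult_distrib n2 [OF yU])
      then have L: "100 * N y * (1 - s y)\<^sup>2 * (lam y)\<^sup>2 = 1" unfolding 1 by simp
      have mu: "mu y = 0" using cb_0 [OF yU] c_eq(6) [OF yU] u_pos [OF yU] by simp
      have elim: "(q * (k - 10 * m) - a * b) * (2 * b - a) - b * (a - 3 * b) * (1/2 * q + a + b) = 0"
        if "q * l = 1" "e * (2 * b - a) - l * (a + b) = 1/2"
          "10 * m + e * b * (a - 3 * b) + l * (a * b) = k" for q l e a b m k :: real
        using that by algebra
      have "(100 * N y * (1 - s y)\<^sup>2 * (K - 1/4 - 10 * N y) - u y * v y) * (2 * v y - u y)
          - v y * (u y - 3 * v y) * (1/2 * (100 * N y * (1 - s y)\<^sup>2) + u y + v y) = 0"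
        using elim [OF L] star [OF yU] K_eq [OF yU] by (simp add: mu)
      moreover have "poly pu (s y) = u y" "poly pv (s y) = v y" "poly P (s y) = 100 * N y * (1 - s y)\<^sup>2"
        "poly k (s y) = K - 1/4 - 10 * N y"
        by (simp_all add: pu_def pv_def P_def k_def u_def v_def N_def power2_eq_square algebra_simps)
      ultimately show ?thesis by (simp add: Q_def)
    qed
  qed
  then show False using D_s(2) [OF x] n_pos [OF x] \<open>cd x \<noteq> 0\<close> by simp
qed

text \<open>Only \<open>lam\<close> is left of the cubic form, and it is constant together with
  \<open>s\<close>. Then \<open>al\<close> and \<open>ga\<close> are constant multiples of
  \<open>t3\<close>; their exterior derivatives and \<open>star\<close> give three equations for the
  two numbers \<open>n lam\<close> and \<open>N\<close>.\<close>

theorem no_generic: False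
proof -
  have mu: "mu y = 0" if "y \<in> U" for y
    using cb_0 [OF that] c_eq(6) [OF that] u_pos [OF that] by simp
  have v: "v y \<noteq> 0" if y: "y \<in> U" for y
  proof
    assume v: "v y = 0"
    have "(et y)\<^sup>2 * u y + (lam y)\<^sup>2 * u y = - 1/2" using star [OF y] by (simp add: mu [OF y] v)
    moreover have "(et y)\<^sup>2 * u y + (lam y)\<^sup>2 * u y \<ge> 0"
      using u_pos [OF y] by (intro add_nonneg_nonneg mult_nonneg_nonneg) auto
    ultimately show False by simp
  qed
  have et: "et y = 0" if "y \<in> U" for y
    using cd_0 [OF that] c_eq(5) [OF that] v [OF that] by simp
  have L: "(lam y)\<^sup>2 * (1 - 20 * N y) = 1/2" if y: "y \<in> U" for y
    using star [OF y] by (simp add: mu [OF y] et [OF y] uv algebra_simps)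
  have Ds: "D s y X = 0" if y: "y \<in> U" for y X
    using D_s [OF y] cb_0 [OF y] cd_0 [OF y] covector_expansion [OF y, of "grad s y" X]
    by (simp add: grad_inner smooth_on_differentiable [OF smooth_s'(1) y])
  have Dlam: "D lam y X = 0" if y: "y \<in> U" for y X
  proof -
    have "D (\<lambda>y. (lam y)\<^sup>2 * (1 - 20 * N y)) y X = 0" by (rule D_eq_0 [OF U y L])
    then have "lam y * (1 - 20 * N y) * D lam y X = 0"
      by (auto simp: D_mult [OF y] D_diff [OF y] D_power2 [OF y] smooth_on_mult smooth_on_diff
          smooth_on_const smooth_on_power smooth_s' smooth_lam D_functions_of_s [OF y Ds [OF y]])
    then show ?thesis using L [OF y] by auto
  qed
  obtain x where x: "x \<in> U" using U_ne by blast
  have n: "n x \<noteq> 0" "N x \<noteq> 0" "sn x \<noteq> 0" "cs x \<noteq> 0"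
    using n_pos [OF x] N_pos [OF x] sn_pos [OF x] cs_pos [OF x] by auto
  \<comment> \<open>The factors solve \<open>3 al - ga = lam t3\<close> and
    \<open>al + ga = lam (20 N - 1) t3\<close>.\<close>
  have al: "al y = (5 * (N y * lam y)) *\<^sub>R t3 y" and ga: "ga y = ((15 * N y - 1) * lam y) *\<^sub>R t3 y"
    if y: "y \<in> U" for y
  proof -
    have *: "(1 - 2 * s y) * (3 * (al y \<bullet> X) - ga y \<bullet> X) = s11 y \<bullet> X - s22 y \<bullet> X"
      "al y \<bullet> X + ga y \<bullet> X = - (s33 y \<bullet> X)" for X
    proof -
      have c: "cs y * cs y = 1 - s y" "sn y * sn y = s y"
        using cs_s [OF y] by (simp_all add: s_def power2_eq_square)
      show "(1 - 2 * s y) * (3 * (al y \<bullet> X) - ga y \<bullet> X) = s11 y \<bullet> X - s22 y \<bullet> X"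
        "al y \<bullet> X + ga y \<bullet> X = - (s33 y \<bullet> X)"
        by (simp_all add: s_defs inner_diff_left inner_add_left power2_eq_square c algebra_simps)
    qed
    have p: "1 - 2 * s y \<noteq> 0" using s_range [OF y] by simp
    have E: "3 * (al y \<bullet> E 1 y) - ga y \<bullet> E 1 y = 0" "al y \<bullet> E 1 y + ga y \<bullet> E 1 y = 0"
      "3 * (al y \<bullet> E 2 y) - ga y \<bullet> E 2 y = 0" "al y \<bullet> E 2 y + ga y \<bullet> E 2 y = 0"
      using *[of "E 1 y"] *[of "E 2 y"] p by (simp_all add: s_E [OF y] c_eq [OF y] mu [OF y] et [OF y])
    have "al y \<bullet> E 3 y + ga y \<bullet> E 3 y = lam y * (u y + v y)"
      using *(2) [of "E 3 y"] by (simp add: s_E [OF y] c_eq [OF y] algebra_simps)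
    then have E3: "al y \<bullet> E 3 y + ga y \<bullet> E 3 y = lam y * (20 * N y - 1)" by (simp add: uv)
    have vals: "al y \<bullet> E 1 y = 0" "ga y \<bullet> E 1 y = 0" "al y \<bullet> E 2 y = 0" "ga y \<bullet> E 2 y = 0"
      "al y \<bullet> E 3 y = 5 * (N y * lam y)" "ga y \<bullet> E 3 y = (15 * N y - 1) * lam y"
      using E E3 connection_E(1) [OF y] by (simp_all add: algebra_simps)
    show "al y = (5 * (N y * lam y)) *\<^sub>R t3 y"
    proof (rule inner_eqI)
      show "al y \<bullet> X = ((5 * (N y * lam y)) *\<^sub>R t3 y) \<bullet> X" for X
        by (subst covector_expansion [OF y, of "al y"]) (simp add: vals)
    qed
    show "ga y = ((15 * N y - 1) * lam y) *\<^sub>R t3 y"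
    proof (rule inner_eqI)
      show "ga y \<bullet> X = (((15 * N y - 1) * lam y) *\<^sub>R t3 y) \<bullet> X" for X
        by (subst covector_expansion [OF y, of "ga y"]) (simp add: vals)
    qed
  qed
  define z where "z = n x * lam x"
  have d1: "cs x * (d1 x \<bullet> E 1 x) = - z * (9 - 10 * s x)" and d2: "sn x * (d2 x \<bullet> E 2 x) = z * (10 * s x - 1)"
    by (simp_all add: connection_E [OF x] z_def)
  have dt3: "dform t3 x (E 1 x) (E 2 x) = 8 * z - 1"
    using d1 d2 by (simp add: str6 [OF x] wedge_def x algebra_simps)
  note D' = D_mult [OF x] D_diff [OF x] smooth_on_mult smooth_on_diff smooth_on_const smooth_s' smooth_lam
    D_functions_of_s [OF x Ds [OF x]] Dlam [OF x]
  have "dform al x X Y = 5 * (N x * lam x) * dform t3 x X Y" for X Y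
  proof -
    have "dform al x X Y = dform (\<lambda>y. (5 * (N y * lam y)) *\<^sub>R t3 y) x X Y"
      by (rule dform_cong [OF U x sm(6) al])
    also have "\<dots> = 5 * (N x * lam x) * dform t3 x X Y"
      by (subst dform_scaleR [OF x], (intro smooth_intros U; fail)+) (simp add: D')
    finally show ?thesis .
  qed
  from this [of "E 1 x" "E 2 x"] have 1: "5 * (N x * lam x) * (8 * z - 1) = 3 * n x"
    by (simp add: dal [OF x] dt3) (simp add: wedge_def x n_def)
  have "dform ga x X Y = (15 * N x - 1) * lam x * dform t3 x X Y" for X Y
  proof -
    have "dform ga x X Y = dform (\<lambda>y. ((15 * N y - 1) * lam y) *\<^sub>R t3 y) x X Y"
      by (rule dform_cong [OF U x sm(7) ga])
    also have "\<dots> = (15 * N x - 1) * lam x * dform t3 x X Y"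
      by (subst dform_scaleR [OF x], (intro smooth_intros U; fail)+) (simp add: D')
    finally show ?thesis .
  qed
  from this [of "E 1 x" "E 2 x"]
  have 2: "(15 * N x - 1) * lam x * (8 * z - 1) = - n x + 2 * ((d1 x \<bullet> E 1 x) * (d2 x \<bullet> E 2 x))"
    by (simp add: dga [OF x] dt3) (simp add: wedge_def x n_def connection_E(2,3) [OF x])
  have nN: "n x * n x = N x" using n2 [OF x] by (simp add: power2_eq_square)
  have z2: "z\<^sup>2 = N x * (lam x)\<^sup>2" by (simp add: z_def power_mult_distrib n2 [OF x])
  show False
  proof (rule no_common_root)
    have "N x * (5 * z * (8 * z - 1)) = N x * 3"
      using 1 nN unfolding z_def by algebra
    then show "5 * z * (8 * z - 1) = 3" using n by simp
    show "2 * z\<^sup>2 * (1 - 20 * N x) = N x"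
      using L [OF x] unfolding z2 by algebra
    have "n x * ((d1 x \<bullet> E 1 x) * (d2 x \<bullet> E 2 x)) = - z\<^sup>2 * ((9 - 10 * s x) * (10 * s x - 1))"
      using d1 d2 unfolding n_def power2_eq_square by algebra
    also have "(9 - 10 * s x) * (10 * s x - 1) = 100 * N x - 9" by (simp add: N_def algebra_simps)
    finally have "n x * ((d1 x \<bullet> E 1 x) * (d2 x \<bullet> E 2 x)) = - z\<^sup>2 * (100 * N x - 9)" .
    then have "n x * ((15 * N x - 1) * lam x * (8 * z - 1)) = - N x - 2 * z\<^sup>2 * (100 * N x - 9)"
      unfolding 2 using nN by (simp add: algebra_simps)
    then show "z * (15 * N x - 1) * (8 * z - 1) = - N x - 2 * z\<^sup>2 * (100 * N x - 9)"
      by (simp add: z_def mult_ac)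
  qed
qed

end

section \<open>Quaternionic frames\<close>

definition imul :: "complex^4 \<Rightarrow> complex^4" where
  "imul v = \<i> *s v"

lemma inner4: "v \<bullet> w = Re (v $ 1) * Re (w $ 1) + Im (v $ 1) * Im (w $ 1)
  + Re (v $ 2) * Re (w $ 2) + Im (v $ 2) * Im (w $ 2)
  + Re (v $ 3) * Re (w $ 3) + Im (v $ 3) * Im (w $ 3)
  + Re (v $ 4) * Re (w $ 4) + Im (v $ 4) * Im (w $ 4)" for v w :: "complex^4"
  by (simp add: inner_vec_def sum_4 inner_complex_def)

lemma quaternion_relations:
  "imul (imul v) = - v" "jmul (jmul v) = - v" "kmul (kmul v) = - v"
  "imul (jmul v) = kmul v" "jmul (imul v) = - kmul v" "jmul (kmul v) = imul v"
  "kmul (jmul v) = - imul v" "kmul (imul v) = jmul v" "imul (kmul v) = - jmul v"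
  by (simp_all add: vec_eq_iff forall_4 imul_def kmul_def complex_eq_iff)

lemma quaternion_skew:
  "imul v \<bullet> w = - (v \<bullet> imul w)" "jmul v \<bullet> w = - (v \<bullet> jmul w)" "kmul v \<bullet> w = - (v \<bullet> kmul w)"
  by (simp_all add: inner4 imul_def kmul_def)

lemma quaternion_orthogonal:
  "v \<bullet> imul v = 0" "v \<bullet> jmul v = 0" "v \<bullet> kmul v = 0"
  by (simp_all add: inner4 imul_def kmul_def)

lemma quaternion_isometry:
  "imul v \<bullet> imul w = v \<bullet> w" "jmul v \<bullet> jmul w = v \<bullet> w" "kmul v \<bullet> kmul w = v \<bullet> w"
  by (simp_all add: quaternion_skew quaternion_relations)

lemma bounded_linear_quaternion:
  "bounded_linear imul" "bounded_linear jmul" "bounded_linear kmul"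
  by (auto intro!: linear_conv_bounded_linear [THEN iffD1] linearI
      simp: vec_eq_iff forall_4 imul_def kmul_def complex_eq_iff)

lemmas linear_quaternion = bounded_linear_quaternion [THEN bounded_linear.linear]

lemma smooth_on_quaternion [smooth_intros]:
  assumes "open S" "smooth_on S f"
  shows "smooth_on S (\<lambda>x. imul (f x))" "smooth_on S (\<lambda>x. jmul (f x))" "smooth_on S (\<lambda>x. kmul (f x))"
  using smooth_on_linear [OF _ assms] bounded_linear_quaternion by auto

text \<open>\<open>q\<close> and \<open>p\<close> are the rows of an element of Sp(2): together with
  their multiples by i, j, k they form an orthonormal basis of R^8.\<close>

definition sp_frame :: "complex^4 \<Rightarrow> complex^4 \<Rightarrow> bool" where
  "sp_frame q p \<longleftrightarrow> q \<bullet> q = 1 \<and> p \<bullet> p = 1 \<and>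
     p \<bullet> q = 0 \<and> p \<bullet> imul q = 0 \<and> p \<bullet> jmul q = 0 \<and> p \<bullet> kmul q = 0"

lemma herm_eq: "herm v w = Complex (v \<bullet> w) (v \<bullet> imul w)"
  by (simp add: complex_eq_iff inner_i_herm imul_def) (simp add: inner_herm)

text \<open>Complex Parseval identity. The vectors \<open>q\<close>, \<open>jmul q\<close>,
  \<open>p\<close>, \<open>jmul p\<close> are orthonormal for \<open>herm\<close>, and completeness
  follows because a one-sided inverse of a square matrix is two-sided.\<close>

lemma sp_frame_inner:
  assumes "sp_frame q p"
  shows "v \<bullet> w = (v \<bullet> q) * (w \<bullet> q) + (v \<bullet> imul q) * (w \<bullet> imul q)
    + (v \<bullet> jmul q) * (w \<bullet> jmul q) + (v \<bullet> kmul q) * (w \<bullet> kmul q)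
    + (v \<bullet> p) * (w \<bullet> p) + (v \<bullet> imul p) * (w \<bullet> imul p)
    + (v \<bullet> jmul p) * (w \<bullet> jmul p) + (v \<bullet> kmul p) * (w \<bullet> kmul p)"
proof -
  define e where "e = (\<chi> i::4. if i = 1 then q else if i = 2 then jmul q else if i = 3 then p else jmul p)"
  have e: "e $ 1 = q" "e $ 2 = jmul q" "e $ 3 = p" "e $ 4 = jmul p" by (simp_all add: e_def)
  define M :: "complex^4^4" where "M = (\<chi> a i. cnj (e $ i $ a))"
  have comm: "q \<bullet> p = 0" "imul q \<bullet> p = 0" "jmul q \<bullet> p = 0" "kmul q \<bullet> p = 0"
    using assms by (simp_all add: sp_frame_def inner_commute)
  have "herm (e $ i) (e $ j) = (if i = j then 1 else 0)" for i j
    using exhaust_4 [of i] exhaust_4 [of j] assms comm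
    by (auto simp: e herm_eq complex_eq_iff sp_frame_def quaternion_isometry quaternion_orthogonal
        quaternion_skew quaternion_relations)
  then have "e ** M = mat 1"
    by (simp add: matrix_matrix_mult_def mat_def M_def herm_def vec_eq_iff)
  then have "M ** e = mat 1" by (simp add: matrix_left_right_inverse)
  then have Me: "(\<Sum>i\<in>UNIV. cnj (e $ i $ a) * e $ i $ b) = (if a = b then 1 else 0)" for a b
    by (simp add: matrix_matrix_mult_def mat_def M_def vec_eq_iff)
  have "(\<Sum>i\<in>UNIV. herm v (e $ i) * cnj (herm w (e $ i)))
      = (\<Sum>i\<in>UNIV. \<Sum>a\<in>UNIV. \<Sum>b\<in>UNIV. v $ a * cnj (w $ b) * (cnj (e $ i $ a) * e $ i $ b))"
    by (simp add: herm_def sum_product mult_ac)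
  also have "\<dots> = (\<Sum>a\<in>UNIV. \<Sum>b\<in>UNIV. \<Sum>i\<in>UNIV. v $ a * cnj (w $ b) * (cnj (e $ i $ a) * e $ i $ b))"
    by (subst sum.swap, rule sum.cong [OF refl], rule sum.swap)
  also have "\<dots> = herm v w"
    unfolding sum_distrib_left [symmetric] Me herm_def by (simp add: if_distrib cong: if_cong)
  finally have "Re (herm v w) = Re (\<Sum>i\<in>UNIV. herm v (e $ i) * cnj (herm w (e $ i)))" by simp
  then show ?thesis by (simp add: sum_4 e herm_eq quaternion_relations)
qed

definition pull :: "(real^'n \<Rightarrow> 'b::real_inner) \<Rightarrow> (real^'n \<Rightarrow> 'b) \<Rightarrow> real^'n \<Rightarrow> real^'n::finite" where
  "pull q r x = (\<chi> i. D q x (axis i 1) \<bullet> r x)"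

lemma pull_inner:
  assumes "q differentiable at x"
  shows "pull q r x \<bullet> X = D q x X \<bullet> r x"
  using D_axis [OF assms, of X] by (simp add: pull_def inner_vec_def inner_sum_left mult.commute)

lemma smooth_on_pull [smooth_intros]:
  "open S \<Longrightarrow> smooth_on S q \<Longrightarrow> smooth_on S r \<Longrightarrow> smooth_on S (pull q r)"
  unfolding pull_def [abs_def] by (intro smooth_intros smooth_on_D)

text \<open>Exterior derivative of the one-form <dq, r>: the second derivatives of \<open>q\<close>
  cancel by symmetry, and only \<open>dq\<close> against \<open>dr\<close> remains.\<close>

lemma dform_pull:
  fixes q r :: "real^'n::finite \<Rightarrow> 'b::euclidean_space"
  assumes S: "open S" and x: "x \<in> S" and q: "smooth_on S q" and r: "smooth_on S r"
  shows "dform (pull q r) x X Y = D q x Y \<bullet> D r x X - D q x X \<bullet> D r x Y"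
proof -
  have "D (pull q r) x X \<bullet> Y = D (\<lambda>y. D q y Y) x X \<bullet> r x + D q x Y \<bullet> D r x X" for X Y
  proof -
    have "D (pull q r) x X \<bullet> Y = D (\<lambda>y. pull q r y \<bullet> Y) x X"
      using D_linear [OF x bounded_linear_inner_left smooth_on_pull [OF S q r]] by metis
    also have "\<dots> = D (\<lambda>y. D q y Y \<bullet> r y) x X"
      by (rule D_eq_on_open [OF S x])
        (auto intro!: smooth_intros S q r pull_inner smooth_on_differentiable [OF q])
    also have "\<dots> = D (\<lambda>y. D q y Y) x X \<bullet> r x + D q x Y \<bullet> D r x X"
      by (simp add: D_inner [OF x] smooth_on_D q r)
    finally show ?thesis .
  qed
  then show ?thesis using D_D_commute [OF S x q, of X Y] by (simp add: dform_def)
qed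

section \<open>Maurer-Cartan forms of Sp(2)\<close>

locale quaternionic_lift =
  fixes U :: "(real^3) set" and q :: "real^3 \<Rightarrow> complex^4"
  assumes U: "open U" and q [smooth_intros]: "smooth_on U q" and qq: "\<And>x. x \<in> U \<Longrightarrow> q x \<bullet> q x = 1"
begin

definition al where "al = pull q (\<lambda>x. imul (q x))"
definition be1 where "be1 = pull q (\<lambda>x. jmul (q x))"
definition be2 where "be2 = pull q (\<lambda>x. kmul (q x))"

lemma Dq: "x \<in> U \<Longrightarrow> D q x X \<bullet> imul (q x) = al x \<bullet> X" "x \<in> U \<Longrightarrow> D q x X \<bullet> jmul (q x) = be1 x \<bullet> X"
  "x \<in> U \<Longrightarrow> D q x X \<bullet> kmul (q x) = be2 x \<bullet> X"
  by (simp_all add: al_def be1_def be2_def pull_inner smooth_on_differentiable [OF q])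

lemma Dq_q: "x \<in> U \<Longrightarrow> D q x X \<bullet> q x = 0"
proof -
  assume x: "x \<in> U"
  have "D (\<lambda>x. q x \<bullet> q x) x X = 0" by (rule D_eq_0 [OF U x qq])
  then show ?thesis by (simp add: D_inner [OF x] q inner_commute)
qed

lemma smooth_forms [smooth_intros]: "smooth_on U al" "smooth_on U be1" "smooth_on U be2"
  unfolding al_def be1_def be2_def by (intro smooth_intros U)+

lemma D_quaternion:
  assumes x: "x \<in> U" and r: "smooth_on U r"
  shows "D (\<lambda>x. imul (r x)) x X = imul (D r x X)" "D (\<lambda>x. jmul (r x)) x X = jmul (D r x X)"
    "D (\<lambda>x. kmul (r x)) x X = kmul (D r x X)"
  using D_linear [OF x _ r] bounded_linear_quaternion by auto

lemma dal: "x \<in> U \<Longrightarrow> dform al x X Y = - 2 * (D q x X \<bullet> imul (D q x Y))"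
  unfolding al_def
  by (subst dform_pull [OF U], (simp add: smooth_intros U)+)
    (simp add: D_quaternion q inner_commute [of "D q x Y"] quaternion_skew)

end

locale quaternionic_frame = quaternionic_lift +
  fixes p :: "real^3 \<Rightarrow> complex^4"
  assumes p [smooth_intros]: "smooth_on U p" and frame: "\<And>x. x \<in> U \<Longrightarrow> sp_frame (q x) (p x)"
begin

text \<open>With \<open>al\<close>, \<open>be1\<close>, \<open>be2\<close> these are the ten
  components of the sp(2)-valued Maurer-Cartan form.\<close>

definition a1 where "a1 = pull q p"
definition a2 where "a2 = pull q (\<lambda>x. imul (p x))"
definition b1 where "b1 = pull q (\<lambda>x. jmul (p x))"
definition b2 where "b2 = pull q (\<lambda>x. kmul (p x))"
definition ga where "ga = pull p (\<lambda>x. imul (p x))"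
definition de1 where "de1 = pull p (\<lambda>x. jmul (p x))"
definition de2 where "de2 = pull p (\<lambda>x. kmul (p x))"

lemma smooth_forms' [smooth_intros]: "smooth_on U a1" "smooth_on U a2" "smooth_on U b1" "smooth_on U b2"
  "smooth_on U ga" "smooth_on U de1" "smooth_on U de2"
  unfolding a1_def a2_def b1_def b2_def ga_def de1_def de2_def by (intro smooth_intros U)+

lemma Dq': "x \<in> U \<Longrightarrow> D q x X \<bullet> p x = a1 x \<bullet> X" "x \<in> U \<Longrightarrow> D q x X \<bullet> imul (p x) = a2 x \<bullet> X"
  "x \<in> U \<Longrightarrow> D q x X \<bullet> jmul (p x) = b1 x \<bullet> X" "x \<in> U \<Longrightarrow> D q x X \<bullet> kmul (p x) = b2 x \<bullet> X"
  by (simp_all add: a1_def a2_def b1_def b2_def pull_inner smooth_on_differentiable [OF q])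

lemma Dp: "x \<in> U \<Longrightarrow> D p x X \<bullet> imul (p x) = ga x \<bullet> X" "x \<in> U \<Longrightarrow> D p x X \<bullet> jmul (p x) = de1 x \<bullet> X"
  "x \<in> U \<Longrightarrow> D p x X \<bullet> kmul (p x) = de2 x \<bullet> X" "x \<in> U \<Longrightarrow> D p x X \<bullet> p x = 0"
  "x \<in> U \<Longrightarrow> D p x X \<bullet> q x = - (a1 x \<bullet> X)" "x \<in> U \<Longrightarrow> D p x X \<bullet> imul (q x) = a2 x \<bullet> X"
  "x \<in> U \<Longrightarrow> D p x X \<bullet> jmul (q x) = b1 x \<bullet> X" "x \<in> U \<Longrightarrow> D p x X \<bullet> kmul (q x) = b2 x \<bullet> X"
proof -
  assume x: "x \<in> U"
  show "D p x X \<bullet> imul (p x) = ga x \<bullet> X" "D p x X \<bullet> jmul (p x) = de1 x \<bullet> X" "D p x X \<bullet> kmul (p x) = de2 x \<bullet> X"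
    by (simp_all add: ga_def de1_def de2_def pull_inner smooth_on_differentiable [OF p x])
  have "D (\<lambda>x. p x \<bullet> p x) x X = 0" by (rule D_eq_0 [OF U x]) (use frame in \<open>auto simp: sp_frame_def\<close>)
  then show "D p x X \<bullet> p x = 0" by (simp add: D_inner [OF x] p inner_commute)
  have *: "D p x X \<bullet> r x = - (p x \<bullet> D r x X)"
    if "smooth_on U r" "\<And>y. y \<in> U \<Longrightarrow> p y \<bullet> r y = 0" for r
  proof -
    have "D (\<lambda>x. p x \<bullet> r x) x X = 0" by (rule D_eq_0 [OF U x that(2)])
    then show ?thesis by (simp add: D_inner [OF x] p that(1) inner_commute)
  qed
  note ip = inner_commute [of "p x"]
  show "D p x X \<bullet> q x = - (a1 x \<bullet> X)"
    by (subst *) (use frame in \<open>auto simp: sp_frame_def q ip Dq' x\<close>)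
  show "D p x X \<bullet> imul (q x) = a2 x \<bullet> X"
    by (subst *) (use frame in \<open>auto simp: sp_frame_def q smooth_intros U D_quaternion x ip quaternion_skew Dq'\<close>)
  show "D p x X \<bullet> jmul (q x) = b1 x \<bullet> X"
    by (subst *) (use frame in \<open>auto simp: sp_frame_def q smooth_intros U D_quaternion x ip quaternion_skew Dq'\<close>)
  show "D p x X \<bullet> kmul (q x) = b2 x \<bullet> X"
    by (subst *) (use frame in \<open>auto simp: sp_frame_def q smooth_intros U D_quaternion x ip quaternion_skew Dq'\<close>)
qed

text \<open>By \<open>dform_pull\<close> each left side is an alternating product of derivatives of
  \<open>q\<close> and \<open>p\<close>, which Parseval expands into the forms themselves.\<close>

lemma structure_equations:
  assumes x: "x \<in> U"
  shows
  "dform al x X Y = 2 * wedge (be1 x) (be2 x) X Y + 2 * wedge (a1 x) (a2 x) X Y + 2 * wedge (b1 x) (b2 x) X Y" (is ?al)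
  "dform be1 x X Y = - 2 * wedge (al x) (be2 x) X Y + 2 * wedge (a1 x) (b1 x) X Y - 2 * wedge (a2 x) (b2 x) X Y" (is ?be1)
  "dform be2 x X Y = 2 * wedge (al x) (be1 x) X Y + 2 * wedge (a1 x) (b2 x) X Y + 2 * wedge (a2 x) (b1 x) X Y" (is ?be2)
  "dform a1 x X Y = wedge (ga x) (a2 x) X Y - wedge (al x) (a2 x) X Y
     - wedge (be1 x) (b1 x) X Y - wedge (be2 x) (b2 x) X Y + wedge (de1 x) (b1 x) X Y + wedge (de2 x) (b2 x) X Y" (is ?a1)
  "dform a2 x X Y = wedge (al x) (a1 x) X Y - wedge (ga x) (a1 x) X Y
     + wedge (be1 x) (b2 x) X Y - wedge (be2 x) (b1 x) X Y + wedge (de1 x) (b2 x) X Y - wedge (de2 x) (b1 x) X Y" (is ?a2)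
  "dform b1 x X Y = - wedge (al x) (b2 x) X Y - wedge (ga x) (b2 x) X Y
     + wedge (be1 x) (a1 x) X Y + wedge (be2 x) (a2 x) X Y - wedge (de1 x) (a1 x) X Y + wedge (de2 x) (a2 x) X Y" (is ?b1)
  "dform b2 x X Y = wedge (al x) (b1 x) X Y + wedge (ga x) (b1 x) X Y
     + wedge (be2 x) (a1 x) X Y - wedge (be1 x) (a2 x) X Y - wedge (de1 x) (a2 x) X Y - wedge (de2 x) (a1 x) X Y" (is ?b2)
  "dform ga x X Y = - 2 * wedge (a1 x) (a2 x) X Y + 2 * wedge (b1 x) (b2 x) X Y + 2 * wedge (de1 x) (de2 x) X Y" (is ?ga)
  "dform de1 x X Y = - 2 * wedge (ga x) (de2 x) X Y - 2 * wedge (a1 x) (b1 x) X Y - 2 * wedge (a2 x) (b2 x) X Y" (is ?de1)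
  "dform de2 x X Y = 2 * wedge (ga x) (de1 x) X Y - 2 * wedge (a1 x) (b2 x) X Y + 2 * wedge (a2 x) (b1 x) X Y" (is ?de2)
proof -
  have skew: "imul v \<bullet> q x = - (v \<bullet> imul (q x))" "jmul v \<bullet> q x = - (v \<bullet> jmul (q x))" "kmul v \<bullet> q x = - (v \<bullet> kmul (q x))"
    "imul v \<bullet> p x = - (v \<bullet> imul (p x))" "jmul v \<bullet> p x = - (v \<bullet> jmul (p x))" "kmul v \<bullet> p x = - (v \<bullet> kmul (p x))"
    "\<And>w. imul v \<bullet> imul w = v \<bullet> w" "\<And>w. jmul v \<bullet> jmul w = v \<bullet> w" "\<And>w. kmul v \<bullet> kmul w = v \<bullet> w"
    "\<And>w. imul v \<bullet> jmul w = - (v \<bullet> kmul w)" "\<And>w. imul v \<bullet> kmul w = v \<bullet> jmul w"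
    "\<And>w. jmul v \<bullet> imul w = v \<bullet> kmul w" "\<And>w. jmul v \<bullet> kmul w = - (v \<bullet> imul w)"
    "\<And>w. kmul v \<bullet> imul w = - (v \<bullet> jmul w)" "\<And>w. kmul v \<bullet> jmul w = v \<bullet> imul w" for v
    by (simp_all add: quaternion_skew quaternion_relations)
  note facts = Dq [OF x] Dq' [OF x] Dp [OF x] Dq_q [OF x] D_quaternion [OF x q] D_quaternion [OF x p]
  note e = sp_frame_inner [OF frame [OF x]]
  have P: "dform (pull y r) x X Y = D y x Y \<bullet> D r x X - D y x X \<bullet> D r x Y"
    if "smooth_on U y" "smooth_on U r" for y r :: "real^3 \<Rightarrow> complex^4" and X Y
    by (rule dform_pull [OF U x that])
  show ?al unfolding al_def
    by (subst P, (intro smooth_intros U)+, subst (1 2) e, simp add: facts skew, simp add: wedge_def)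
  show ?be1 unfolding be1_def
    by (subst P, (intro smooth_intros U)+, subst (1 2) e, simp add: facts skew, simp add: wedge_def)
  show ?be2 unfolding be2_def
    by (subst P, (intro smooth_intros U)+, subst (1 2) e, simp add: facts skew, simp add: wedge_def)
  show ?a1 unfolding a1_def
    by (subst P, (intro smooth_intros U)+, subst (1 2) e, simp add: facts skew, simp add: wedge_def)
  show ?a2 unfolding a2_def
    by (subst P, (intro smooth_intros U)+, subst (1 2) e, simp add: facts skew, simp add: wedge_def)
  show ?b1 unfolding b1_def
    by (subst P, (intro smooth_intros U)+, subst (1 2) e, simp add: facts skew, simp add: wedge_def)
  show ?b2 unfolding b2_def
    by (subst P, (intro smooth_intros U)+, subst (1 2) e, simp add: facts skew, simp add: wedge_def)
  show ?ga unfolding ga_def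
    by (subst P, (intro smooth_intros U)+, subst (1 2) e, simp add: facts skew, simp add: wedge_def)
  show ?de1 unfolding de1_def
    by (subst P, (intro smooth_intros U)+, subst (1 2) e, simp add: facts skew, simp add: wedge_def)
  show ?de2 unfolding de2_def
    by (subst P, (intro smooth_intros U)+, subst (1 2) e, simp add: facts skew, simp add: wedge_def)
qed

end

section \<open>Lifts of Lagrangian immersions\<close>

lemma sqrt2_mult: "sqrt 2 * (sqrt 2 * y) = 2 * y"
  by (simp add: mult.assoc [symmetric])

text \<open>\<open>d (d w) = 0\<close>, evaluated on constant vector fields.\<close>

lemma dform_closed:
  fixes w :: "real^'n::finite \<Rightarrow> real^'n"
  assumes S: "open S" and x: "x \<in> S" and w: "smooth_on S w"
  shows "D (\<lambda>y. dform w y Y Z) x X + D (\<lambda>y. dform w y Z X) x Y + D (\<lambda>y. dform w y X Y) x Z = 0"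
proof -
  have D1: "D (\<lambda>y. dform w y Y Z) x X = D (\<lambda>y. D w y Y) x X \<bullet> Z - D (\<lambda>y. D w y Z) x X \<bullet> Y" for X Y Z
    unfolding dform_def
    by (simp add: D_diff [OF x] D_inner [OF x] smooth_on_inner S smooth_on_D w smooth_on_const)
  show ?thesis
    unfolding D1 using D_D_commute [OF S x w] by (metis (no_types, lifting) add_diff_eq diff_add_cancel diff_self add.commute)
qed

lemma D_wedge_cyclic:
  fixes u w :: "real^'n::finite \<Rightarrow> real^'n"
  assumes S: "open S" and x: "x \<in> S" and u: "smooth_on S u" and w: "smooth_on S w"
  shows "D (\<lambda>y. wedge (u y) (w y) Y Z) x X + D (\<lambda>y. wedge (u y) (w y) Z X) x Y + D (\<lambda>y. wedge (u y) (w y) X Y) x Z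
    = dform u x X Y * (w x \<bullet> Z) + dform u x Y Z * (w x \<bullet> X) + dform u x Z X * (w x \<bullet> Y)
    - (dform w x X Y * (u x \<bullet> Z) + dform w x Y Z * (u x \<bullet> X) + dform w x Z X * (u x \<bullet> Y))"
proof -
  have D1: "D (\<lambda>y. wedge (u y) (w y) Y Z) x X = (D u x X \<bullet> Y) * (w x \<bullet> Z) + (u x \<bullet> Y) * (D w x X \<bullet> Z)
     - ((D u x X \<bullet> Z) * (w x \<bullet> Y) + (u x \<bullet> Z) * (D w x X \<bullet> Y))" for X Y Z
    unfolding wedge_def
    by (simp add: D_diff [OF x] D_mult [OF x] D_inner [OF x] smooth_on_inner smooth_on_mult S u w smooth_on_const)
  show ?thesis unfolding D1 dform_def by (simp add: algebra_simps)
qed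

lemma smooth_on_D_field:
  fixes q :: "real^'n::finite \<Rightarrow> 'b::real_normed_vector" and E :: "real^'n \<Rightarrow> real^'n"
  assumes S: "open S" and q: "smooth_on S q" and E: "smooth_on S E"
  shows "smooth_on S (\<lambda>x. D q x (E x))"
proof (rule smooth_on_cong [OF S])
  show "(\<Sum>i\<in>UNIV. E x $ i *\<^sub>R D q x (axis i 1)) = D q x (E x)" if "x \<in> S" for x
    using D_axis [OF smooth_on_differentiable [OF q that]] by metis
  show "smooth_on S (\<lambda>x. \<Sum>i\<in>UNIV. E x $ i *\<^sub>R D q x (axis i 1))"
    by (intro smooth_intros S E smooth_on_D q)
qed

text \<open>The conditions on the immersion are phrased with \<open>dq\<close> instead of horizontal
  lifts. In \<open>metric\<close> the vertical part is removed and the part in \<open>D1\<close> is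
  counted once rather than twice. In \<open>lagr\<close> the coefficient 3 is 2 for taking the
  \<open>D1\<close> part out of the doubled term, plus 1 for its own opposite sign under
  \<open>J\<close>.\<close>

locale lagrangian_lift = quaternionic_lift +
  fixes h :: "real^3 \<Rightarrow> real^3^3" and K :: real
  assumes U_ne: "U \<noteq> {}"
    and metric: "\<And>x X Y. x \<in> U \<Longrightarrow> X \<bullet> (h x *v Y) = 2 * (D q x X \<bullet> D q x Y)
      - 2 * (al x \<bullet> X) * (al x \<bullet> Y) - (be1 x \<bullet> X) * (be1 x \<bullet> Y) - (be2 x \<bullet> X) * (be2 x \<bullet> Y)"
    and lagr: "\<And>x X Y. x \<in> U \<Longrightarrow> 2 * (D q x X \<bullet> imul (D q x Y)) + 3 * wedge (be1 x) (be2 x) X Y = 0"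
    and pos: "\<And>x X. x \<in> U \<Longrightarrow> X \<noteq> 0 \<Longrightarrow> X \<bullet> (h x *v X) > 0"
    and curv: "\<And>x X Y. x \<in> U \<Longrightarrow>
      metric_at h x X X * metric_at h x Y Y - (metric_at h x X Y)\<^sup>2 \<noteq> 0 \<Longrightarrow>
      metric_at h x (curvature h x X Y Y) X =
      K * (metric_at h x X X * metric_at h x Y Y - (metric_at h x X Y)\<^sup>2)"

locale adapted_lift = lagrangian_lift +
  fixes sn cs :: "real^3 \<Rightarrow> real" and t1 t2 E1 E2 :: "real^3 \<Rightarrow> real^3"
  assumes sm [smooth_intros]: "smooth_on U sn" "smooth_on U cs" "smooth_on U t1" "smooth_on U t2" "smooth_on U E2"
    and unit: "\<And>x. x \<in> U \<Longrightarrow> (sn x)\<^sup>2 + (cs x)\<^sup>2 = 1"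
    and cs_pos: "\<And>x. x \<in> U \<Longrightarrow> cs x > 0"
    and be1: "\<And>x. x \<in> U \<Longrightarrow> be1 x = cs x *\<^sub>R t1 x"
    and be2: "\<And>x. x \<in> U \<Longrightarrow> be2 x = sn x *\<^sub>R t2 x"
    and h_E: "\<And>x X. x \<in> U \<Longrightarrow> X \<bullet> (h x *v E1 x) = t1 x \<bullet> X" "\<And>x X. x \<in> U \<Longrightarrow> X \<bullet> (h x *v E2 x) = t2 x \<bullet> X"
    and t_E: "\<And>x. x \<in> U \<Longrightarrow> t1 x \<bullet> E1 x = 1" "\<And>x. x \<in> U \<Longrightarrow> t1 x \<bullet> E2 x = 0"
      "\<And>x. x \<in> U \<Longrightarrow> t2 x \<bullet> E1 x = 0" "\<And>x. x \<in> U \<Longrightarrow> t2 x \<bullet> E2 x = 1"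
begin

definition w2 where
  "w2 x = D q x (E2 x) - (al x \<bullet> E2 x) *\<^sub>R imul (q x) - (be1 x \<bullet> E2 x) *\<^sub>R jmul (q x) - (be2 x \<bullet> E2 x) *\<^sub>R kmul (q x)"

text \<open>The frame vector is built from the \<open>D2\<close> part of \<open>dq (E2)\<close>, of
  length cos theta / sqrt 2, because that of \<open>E1\<close> has length sin theta / sqrt 2 and may
  vanish. The factor is chosen so that \<open>imul p\<close> is the normalized
  \<open>w2\<close>.\<close>

definition p where "p x = (- sqrt 2 / cs x) *\<^sub>R imul (w2 x)"

lemma smooth_p: "smooth_on U p"
proof -
  have "cs x \<noteq> 0" if "x \<in> U" for x using cs_pos [OF that] by simp
  then show ?thesis
    unfolding p_def [abs_def] w2_def [abs_def]
    by (intro smooth_intros U smooth_on_D_field)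
qed

lemma w2_q:
  assumes x: "x \<in> U"
  shows "w2 x \<bullet> q x = 0" "w2 x \<bullet> imul (q x) = 0" "w2 x \<bullet> jmul (q x) = 0" "w2 x \<bullet> kmul (q x) = 0"
  using Dq [OF x] Dq_q [OF x] qq [OF x]
  by (simp_all add: w2_def inner_diff_left quaternion_isometry quaternion_orthogonal quaternion_skew
      quaternion_relations)

text \<open>The first equation is the metric, the second the Lagrangian condition, each with second
  argument \<open>E2\<close>.\<close>

lemma Dq_w2:
  assumes x: "x \<in> U"
  shows "2 * (D q x X \<bullet> w2 x) = (cs x)\<^sup>2 * (t2 x \<bullet> X)"
    "2 * (D q x X \<bullet> imul (w2 x)) = - sn x * cs x * (t1 x \<bullet> X)"
proof -
  have "D q x X \<bullet> w2 x = D q x X \<bullet> D q x (E2 x) - (al x \<bullet> X) * (al x \<bullet> E2 x)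
      - (be1 x \<bullet> X) * (be1 x \<bullet> E2 x) - (be2 x \<bullet> X) * (be2 x \<bullet> E2 x)"
    by (simp add: w2_def inner_diff_right Dq [OF x] mult.commute)
  then have "2 * (D q x X \<bullet> w2 x) = t2 x \<bullet> X - (be1 x \<bullet> X) * (be1 x \<bullet> E2 x) - (be2 x \<bullet> X) * (be2 x \<bullet> E2 x)"
    using metric [OF x, of X "E2 x"] unfolding h_E [OF x] by simp
  also have "\<dots> = (1 - (sn x)\<^sup>2) * (t2 x \<bullet> X)"
    by (simp add: be1 [OF x] be2 [OF x] t_E [OF x] power2_eq_square algebra_simps)
  also have "1 - (sn x)\<^sup>2 = (cs x)\<^sup>2" using unit [OF x] by simp
  finally show "2 * (D q x X \<bullet> w2 x) = (cs x)\<^sup>2 * (t2 x \<bullet> X)" .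
  have "D q x X \<bullet> imul (w2 x) = D q x X \<bullet> imul (D q x (E2 x)) + (be2 x \<bullet> E2 x) * (be1 x \<bullet> X)
      - (be1 x \<bullet> E2 x) * (be2 x \<bullet> X)"
    by (simp add: w2_def linear_diff [OF linear_quaternion(1)] linear_cmul [OF linear_quaternion(1)]
        quaternion_relations inner_diff_right inner_add_right Dq [OF x] Dq_q [OF x] mult.commute)
  then show "2 * (D q x X \<bullet> imul (w2 x)) = - sn x * cs x * (t1 x \<bullet> X)"
    using lagr [OF x, of X "E2 x"]
    by (simp add: be1 [OF x] be2 [OF x] t_E [OF x] wedge_def algebra_simps)
qed

lemma frame: "x \<in> U \<Longrightarrow> sp_frame (q x) (p x)"
proof -
  assume x: "x \<in> U"
  have "q x \<bullet> w2 x = 0" "imul (q x) \<bullet> w2 x = 0" "jmul (q x) \<bullet> w2 x = 0" "kmul (q x) \<bullet> w2 x = 0"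
    using w2_q [OF x] by (simp_all only: inner_commute [of _ "w2 x"])
  then have "w2 x \<bullet> w2 x = D q x (E2 x) \<bullet> w2 x"
    by (subst (1) w2_def) (simp add: inner_diff_left)
  then have "2 * (w2 x \<bullet> w2 x) = (cs x)\<^sup>2" using Dq_w2(1) [OF x, of "E2 x"] by (simp add: t_E [OF x])
  then have "p x \<bullet> p x = 1"
    using cs_pos [OF x] by (simp add: p_def quaternion_isometry field_simps power2_eq_square sqrt2_mult)
  moreover have "p x \<bullet> q x = 0" "p x \<bullet> imul (q x) = 0" "p x \<bullet> jmul (q x) = 0" "p x \<bullet> kmul (q x) = 0"
    using w2_q [OF x] by (simp_all add: p_def quaternion_skew quaternion_relations)
  ultimately show ?thesis
    using qq [OF x] by (simp add: sp_frame_def)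
qed

sublocale quaternionic_frame U q p
  by unfold_locales (use smooth_p frame in auto)

lemma a_eq:
  assumes x: "x \<in> U"
  shows "a1 x = (sn x / sqrt 2) *\<^sub>R t1 x" "a2 x = (cs x / sqrt 2) *\<^sub>R t2 x"
proof -
  have c: "cs x \<noteq> 0" using cs_pos [OF x] by simp
  show "a1 x = (sn x / sqrt 2) *\<^sub>R t1 x"
  proof (rule inner_eqI)
    fix X
    have "a1 x \<bullet> X = (- sqrt 2 / cs x) * (D q x X \<bullet> imul (w2 x))"
      unfolding Dq' [OF x, symmetric] by (simp add: p_def)
    also have "\<dots> = (sn x / sqrt 2) * (t1 x \<bullet> X)"
      using Dq_w2(2) [OF x, of X] c by (simp add: field_simps sqrt2_mult)
    finally show "a1 x \<bullet> X = ((sn x / sqrt 2) *\<^sub>R t1 x) \<bullet> X" by simp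
  qed
  show "a2 x = (cs x / sqrt 2) *\<^sub>R t2 x"
  proof (rule inner_eqI)
    fix X
    have "a2 x \<bullet> X = (sqrt 2 / cs x) * (D q x X \<bullet> w2 x)"
      unfolding Dq' [OF x, symmetric]
      by (simp add: p_def linear_cmul [OF linear_quaternion(1)] linear_neg [OF linear_quaternion(1)] quaternion_relations)
    also have "\<dots> = (cs x / sqrt 2) * (t2 x \<bullet> X)"
      using Dq_w2(1) [OF x, of X] c by (simp add: field_simps power2_eq_square sqrt2_mult)
    finally show "a2 x \<bullet> X = ((cs x / sqrt 2) *\<^sub>R t2 x) \<bullet> X" by simp
  qed
qed

lemma metric_frame:
  assumes x: "x \<in> U"
  shows "X \<bullet> (h x *v Y) = (t1 x \<bullet> X) * (t1 x \<bullet> Y) + (t2 x \<bullet> X) * (t2 x \<bullet> Y)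
    + 2 * ((b1 x \<bullet> X) * (b1 x \<bullet> Y) + (b2 x \<bullet> X) * (b2 x \<bullet> Y))"
proof -
  have c: "cs x * cs x = 1 - sn x * sn x" using unit [OF x] by (simp add: power2_eq_square)
  have c2: "cs x * (cs x * z) = z - sn x * (sn x * z)" for z
    using c by algebra
  have "X \<bullet> (h x *v Y) = (be1 x \<bullet> X) * (be1 x \<bullet> Y) + (be2 x \<bullet> X) * (be2 x \<bullet> Y)
    + 2 * ((a1 x \<bullet> X) * (a1 x \<bullet> Y) + (a2 x \<bullet> X) * (a2 x \<bullet> Y) + (b1 x \<bullet> X) * (b1 x \<bullet> Y) + (b2 x \<bullet> X) * (b2 x \<bullet> Y))"
    unfolding metric [OF x]
    by (subst sp_frame_inner [OF frame [OF x]]) (simp add: Dq [OF x] Dq' [OF x] Dq_q [OF x])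
  then show ?thesis
    by (simp add: be1 [OF x] be2 [OF x] a_eq [OF x] field_simps sqrt2_mult c c2)
qed

text \<open>\<open>t1\<close> and \<open>t2\<close> already account for the unit length of
  \<open>E1\<close> and \<open>E2\<close>, so the squares of \<open>b1\<close> and \<open>b2\<close>
  on them vanish.\<close>

lemma b_E:
  assumes x: "x \<in> U"
  shows "b1 x \<bullet> E1 x = 0" "b2 x \<bullet> E1 x = 0" "b1 x \<bullet> E2 x = 0" "b2 x \<bullet> E2 x = 0"
proof -
  have *: "u = 0 \<and> v = 0" if "1 = 1 + 2 * (u * u + v * v)" for u v :: real
  proof -
    have "u * u + v * v = 0" using that by algebra
    then show ?thesis by simp
  qed
  show "b1 x \<bullet> E1 x = 0" "b2 x \<bullet> E1 x = 0" "b1 x \<bullet> E2 x = 0" "b2 x \<bullet> E2 x = 0"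
    using * [of "b1 x \<bullet> E1 x" "b2 x \<bullet> E1 x"] * [of "b1 x \<bullet> E2 x" "b2 x \<bullet> E2 x"]
      metric_frame [OF x, of "E1 x" "E1 x"] metric_frame [OF x, of "E2 x" "E2 x"]
    unfolding h_E [OF x] t_E [OF x] mult_1_left mult_zero_left add_0_right add_0_left by blast+
qed

lemma dal_eq: "x \<in> U \<Longrightarrow> dform al x X Y = 3 * wedge (be1 x) (be2 x) X Y"
  using dal [of x X Y] lagr [of x X Y] by simp

text \<open>The phase of the third coframe element is fixed by \<open>d (d al) = 0\<close>.\<close>
lemma b1_0:
  assumes x: "x \<in> U"
  shows "b1 x = 0"
proof (rule inner_eqI)
  fix X
  let ?Y = "E1 x" and ?Z = "E2 x"
  have eq: "D (\<lambda>y. dform al y Y Z) x X = 3 * D (\<lambda>y. wedge (be1 y) (be2 y) Y Z) x X" for X Y Z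
  proof -
    have w: "smooth_on U (\<lambda>y. wedge (be1 y) (be2 y) Y Z)"
      unfolding wedge_def by (intro smooth_intros U)
    have "D (\<lambda>y. 3 * wedge (be1 y) (be2 y) Y Z) x X = D (\<lambda>y. dform al y Y Z) x X"
      by (rule D_eq_on_open [OF U x]) (auto simp: dal_eq intro!: smooth_intros w U)
    then show ?thesis by (simp add: D_mult [OF x smooth_on_const w])
  qed
  have "3 * (D (\<lambda>y. wedge (be1 y) (be2 y) ?Y ?Z) x X + D (\<lambda>y. wedge (be1 y) (be2 y) ?Z X) x ?Y
      + D (\<lambda>y. wedge (be1 y) (be2 y) X ?Y) x ?Z) = 0"
    using dform_closed [OF U x smooth_forms(1), of ?Y ?Z X] unfolding eq by simp
  then have "dform be1 x X ?Y * (be2 x \<bullet> ?Z) + dform be1 x ?Y ?Z * (be2 x \<bullet> X) + dform be1 x ?Z X * (be2 x \<bullet> ?Y)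
    - (dform be2 x X ?Y * (be1 x \<bullet> ?Z) + dform be2 x ?Y ?Z * (be1 x \<bullet> X) + dform be2 x ?Z X * (be1 x \<bullet> ?Y)) = 0"
    unfolding D_wedge_cyclic [OF U x smooth_forms(2,3)] by simp
  moreover define r where "r = 1 / sqrt 2"
  moreover have a: "a1 x = (sn x * r) *\<^sub>R t1 x" "a2 x = (cs x * r) *\<^sub>R t2 x"
    by (simp_all add: a_eq [OF x] r_def)
  moreover note v = structure_equations [OF x] wedge_def be1 [OF x] be2 [OF x] a t_E [OF x] b_E [OF x]
  have "dform be1 x X ?Y = 2 * sn x * (al x \<bullet> ?Y) * (t2 x \<bullet> X) - 2 * r * sn x * (b1 x \<bullet> X)"
    "dform be1 x ?Y ?Z = - 2 * sn x * (al x \<bullet> ?Y)"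
    "dform be2 x ?Y ?Z = - 2 * cs x * (al x \<bullet> ?Z)"
    "dform be2 x ?Z X = 2 * cs x * (al x \<bullet> ?Z) * (t1 x \<bullet> X) + 2 * r * cs x * (b1 x \<bullet> X)"
    by (simp_all add: v)
  \<comment> \<open>All terms with \<open>al\<close> cancel; \<open>b1\<close> survives once with
    \<open>sn^2\<close> and once with \<open>cs^2\<close>.\<close>
  ultimately have "2 * r * (((sn x)\<^sup>2 + (cs x)\<^sup>2) * (b1 x \<bullet> X)) = 0"
    by (simp add: be1 [OF x] be2 [OF x] t_E [OF x] power2_eq_square algebra_simps)
  then show "b1 x \<bullet> X = 0 \<bullet> X" by (simp add: unit [OF x] r_def)
qed

definition t3 where "t3 x = sqrt 2 *\<^sub>R b2 x"

lemma b2_eq: "b2 x = (1 / sqrt 2) *\<^sub>R t3 x"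
  by (simp add: t3_def)

lemma adapted_coframe: "adapted_coframe U sn cs t1 t2 t3 al ga de1 de2 h K"
proof -
  have m: "X \<bullet> (h x *v Y) = (t1 x \<bullet> X) * (t1 x \<bullet> Y) + (t2 x \<bullet> X) * (t2 x \<bullet> Y) + (t3 x \<bullet> X) * (t3 x \<bullet> Y)"
    if x: "x \<in> U" for x X Y
    by (simp add: metric_frame [OF x] b1_0 [OF x] t3_def sqrt2_mult mult_ac)
  have cong: "dform (\<lambda>y. f y *\<^sub>R v y) x X Y = r * dform w x X Y"
    if x: "x \<in> U" and "smooth_on U w" "\<And>y. y \<in> U \<Longrightarrow> r *\<^sub>R w y = f y *\<^sub>R v y" for f v w x X Y and r :: real
  proof -
    have "dform (\<lambda>y. r *\<^sub>R w y) x X Y = dform (\<lambda>y. f y *\<^sub>R v y) x X Y"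
      by (rule dform_cong [OF U x]) (use that in \<open>auto intro!: smooth_intros U\<close>)
    then show ?thesis by (simp add: dform_const_scaleR [OF x that(2)])
  qed
  note w = wedge_def be1 be2 a_eq b1_0 b2_eq
  show ?thesis
  proof
    show "smooth_on U t3" unfolding t3_def [abs_def] by (intro smooth_intros U)
    fix x X Y assume x: "x \<in> U"
    show "X = 0" if "t1 x \<bullet> X = 0" "t2 x \<bullet> X = 0" "t3 x \<bullet> X = 0"
      using pos [OF x, of X] that by (auto simp: m [OF x])
    show "dform (\<lambda>y. cs y *\<^sub>R t1 y) x X Y =
      - 2 * sn x * wedge (al x) (t2 x) X Y - cs x * wedge (t2 x) (t3 x) X Y"
      by (subst cong [OF x smooth_forms(2), of 1])
        (simp_all add: structure_equations [OF x] w x field_simps sqrt2_mult)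
    show "dform (\<lambda>y. sn y *\<^sub>R t2 y) x X Y =
      2 * cs x * wedge (al x) (t1 x) X Y + sn x * wedge (t1 x) (t3 x) X Y"
      by (subst cong [OF x smooth_forms(3), of 1])
        (simp_all add: structure_equations [OF x] w x field_simps sqrt2_mult)
    show "dform (\<lambda>y. sn y *\<^sub>R t1 y) x X Y = - cs x * (wedge (al x) (t2 x) X Y - wedge (ga x) (t2 x) X Y)
      - sn x * wedge (t2 x) (t3 x) X Y + wedge (de2 x) (t3 x) X Y"
      by (subst cong [OF x smooth_forms'(1), of "sqrt 2"])
        (simp_all add: structure_equations [OF x] w x field_simps sqrt2_mult)
    show "dform (\<lambda>y. cs y *\<^sub>R t2 y) x X Y = sn x * (wedge (al x) (t1 x) X Y - wedge (ga x) (t1 x) X Y)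
      + cs x * wedge (t1 x) (t3 x) X Y + wedge (de1 x) (t3 x) X Y"
      by (subst cong [OF x smooth_forms'(2), of "sqrt 2"])
        (simp_all add: structure_equations [OF x] w x field_simps sqrt2_mult)
    have "dform b1 x X Y = 0"
      unfolding dform_def using D_eq_0 [OF U x b1_0] by simp
    then have "2 * sqrt 2 * (wedge (al x) (t3 x) X Y + wedge (ga x) (t3 x) X Y
      - (- sn x * wedge (de1 x) (t1 x) X Y + cs x * wedge (de2 x) (t2 x) X Y)) = 0"
      unfolding structure_equations [OF x] by (simp add: w x field_simps sqrt2_mult)
    then show "wedge (al x) (t3 x) X Y + wedge (ga x) (t3 x) X Y =
      - sn x * wedge (de1 x) (t1 x) X Y + cs x * wedge (de2 x) (t2 x) X Y"
      by simp
    show "dform t3 x X Y = - wedge (t1 x) (t2 x) X Y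
      - cs x * wedge (de1 x) (t2 x) X Y - sn x * wedge (de2 x) (t1 x) X Y"
    proof -
      have c: "cs x * (cs x * z) = z - sn x * (sn x * z)" for z
        using unit [OF x] by algebra
      have "dform t3 x X Y = sqrt 2 * dform b2 x X Y"
        unfolding t3_def [abs_def] by (rule dform_const_scaleR [OF x smooth_forms'(4)])
      also have "\<dots> = - wedge (t1 x) (t2 x) X Y
        - cs x * wedge (de1 x) (t2 x) X Y - sn x * wedge (de2 x) (t1 x) X Y"
        unfolding structure_equations [OF x] by (simp add: w x field_simps sqrt2_mult c)
      finally show ?thesis .
    qed
    show "dform al x X Y = 3 * sn x * cs x * wedge (t1 x) (t2 x) X Y"
      by (simp add: dal_eq [OF x] w x algebra_simps)
    show "dform ga x X Y = - sn x * cs x * wedge (t1 x) (t2 x) X Y + 2 * wedge (de1 x) (de2 x) X Y"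
      by (simp add: structure_equations [OF x] w x field_simps sqrt2_mult)
    show "dform de1 x X Y = - 2 * wedge (ga x) (de2 x) X Y - cs x * wedge (t2 x) (t3 x) X Y"
      by (simp add: structure_equations [OF x] w x field_simps sqrt2_mult)
    show "dform de2 x X Y = 2 * wedge (ga x) (de1 x) X Y - sn x * wedge (t1 x) (t3 x) X Y"
      by (simp add: structure_equations [OF x] w x field_simps sqrt2_mult)
    show "h x $ i $ j = t1 x $ i * t1 x $ j + t2 x $ i * t2 x $ j + t3 x $ i * t3 x $ j" for i j
      using m [OF x, of "axis i 1" "axis j 1"]
      by (simp add: inner_axis inner_axis' matrix_vector_mul_component)
  qed (use U U_ne smooth_forms smooth_forms' sm unit curv in auto)
qed

end

section \<open>Adapted coframes from the inverse metric\<close>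

context lagrangian_lift
begin

definition hinv :: "real^3 \<Rightarrow> real^3 \<Rightarrow> real^3" where
  "hinv x c = (SOME X. h x *v X = c)"

lemma h_sym: "x \<in> U \<Longrightarrow> X \<bullet> (h x *v Y) = Y \<bullet> (h x *v X)"
  by (simp add: metric inner_commute mult.commute)

lemma h_nondeg: "x \<in> U \<Longrightarrow> h x *v X = 0 \<Longrightarrow> X = 0"
  using pos [of x X] by auto

lemma h_rows_nondeg:
  assumes "x \<in> U" "\<And>i. h x $ i \<bullet> Y = 0"
  shows "Y = 0"
  by (rule h_nondeg [OF assms(1)]) (simp add: vec_eq_iff matrix_vector_mul_component assms(2))

lemma h_hinv: "x \<in> U \<Longrightarrow> h x *v hinv x c = c"
proof -
  assume x: "x \<in> U"
  obtain X where "\<And>i. h x $ i \<bullet> X = c $ i"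
    by (rule rows_solve [of "\<lambda>i. h x $ i" "\<lambda>i. c $ i", OF h_rows_nondeg [OF x]]) blast+
  then have "h x *v X = c" by (simp add: matrix_vector_mul_component vec_eq_iff)
  then show ?thesis unfolding hinv_def by (rule someI)
qed

lemma hinv_eqI: "x \<in> U \<Longrightarrow> h x *v X = c \<Longrightarrow> hinv x c = X"
  using h_nondeg [of x "hinv x c - X"] by (simp add: matrix_vector_mult_diff_distrib h_hinv)

lemma hinv_linear:
  assumes x: "x \<in> U"
  shows "hinv x (r *\<^sub>R c) = r *\<^sub>R hinv x c" "hinv x (c + d) = hinv x c + hinv x d"
    "hinv x (c - d) = hinv x c - hinv x d"
  by (rule hinv_eqI [OF x], simp add: matrix_vector_mult_scaleR matrix_vector_right_distrib
      matrix_vector_mult_diff_distrib h_hinv [OF x])+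

lemma hinv_sym: "x \<in> U \<Longrightarrow> c \<bullet> hinv x d = d \<bullet> hinv x c"
  using h_sym [of x "hinv x c" "hinv x d"] by (simp add: h_hinv inner_commute)

lemma hinv_pos: "x \<in> U \<Longrightarrow> c \<noteq> 0 \<Longrightarrow> c \<bullet> hinv x c > 0"
proof -
  assume x: "x \<in> U" and c: "c \<noteq> 0"
  have "h x *v 0 = 0" by simp
  then have "hinv x c \<noteq> 0" using h_hinv [OF x, of c] c by auto
  then show ?thesis using pos [OF x, of "hinv x c"] by (simp add: h_hinv [OF x] inner_commute)
qed

lemma smooth_h: "smooth_on U (\<lambda>x. h x $ i $ j)"
proof (rule smooth_on_cong [OF U])
  show "2 * (D q x (axis i 1) \<bullet> D q x (axis j 1)) - 2 * (al x $ i) * (al x $ j)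
    - (be1 x $ i) * (be1 x $ j) - (be2 x $ i) * (be2 x $ j) = h x $ i $ j" if x: "x \<in> U" for x
    using metric [OF x, of "axis i 1" "axis j 1"]
    by (simp add: inner_axis inner_axis' matrix_vector_mul_component)
  show "smooth_on U (\<lambda>x. 2 * (D q x (axis i 1) \<bullet> D q x (axis j 1)) - 2 * (al x $ i) * (al x $ j)
    - (be1 x $ i) * (be1 x $ j) - (be2 x $ i) * (be2 x $ j))"
    by (intro smooth_intros U smooth_on_D)
qed

lemma smooth_hinv [smooth_intros]:
  assumes c: "smooth_on U c"
  shows "smooth_on U (\<lambda>x. hinv x (c x))"
proof (rule smooth_on_solve [OF U])
  show "smooth_on U (\<lambda>x. h x $ a)" for a
  proof (rule smooth_on_cong [OF U])
    show "smooth_on U (\<lambda>x. \<chi> j. h x $ a $ j)" by (intro smooth_intros U smooth_h)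
  qed (simp add: vec_eq_iff)
  show "smooth_on U (\<lambda>x. c x $ a)" for a by (intro smooth_intros U c)
  show "Y = 0" if "x \<in> U" "\<And>a. h x $ a \<bullet> Y = 0" for x Y
    by (rule h_rows_nondeg [OF that])
  show "h x $ a \<bullet> hinv x (c x) = c x $ a" if "x \<in> U" for x a
    using h_hinv [OF that] by (simp add: matrix_vector_mul_component [symmetric])
qed

text \<open>Gram matrix of \<open>be1\<close>, \<open>be2\<close> for the inverse metric. Once its
  trace is known to be 1, diagonalizing it produces cos^2 theta and sin^2 theta.\<close>

definition G11 where "G11 x = be1 x \<bullet> hinv x (be1 x)"
definition G12 where "G12 x = be1 x \<bullet> hinv x (be2 x)"
definition G22 where "G22 x = be2 x \<bullet> hinv x (be2 x)"

lemma smooth_G [smooth_intros]: "smooth_on U G11" "smooth_on U G12" "smooth_on U G22"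
  unfolding G11_def [abs_def] G12_def [abs_def] G22_def [abs_def] by (intro smooth_intros U)+

lemma sp_frame_exists:
  assumes "q0 \<bullet> q0 = 1"
  obtains p0 where "sp_frame q0 p0"
proof -
  have "dim {q0, imul q0, jmul q0, kmul q0} \<le> card {q0, imul q0, jmul q0, kmul q0}"
    by (rule dim_le_card') simp
  also have "\<dots> \<le> 4" by (rule card_insert_le_m1; simp)+
  also have "4 < DIM(complex^4)" by simp
  finally obtain r where r: "r \<noteq> 0" "\<And>y. y \<in> span {q0, imul q0, jmul q0, kmul q0} \<Longrightarrow> orthogonal r y"
    using orthogonal_to_subspace_exists by blast
  have "sp_frame q0 (r /\<^sub>R norm r)"
    using r(1) r(2) [OF span_base] assms by (simp add: sp_frame_def orthogonal_def dot_square_norm power2_eq_square)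
  then show ?thesis using that by blast
qed

text \<open>In a unitary frame of the horizontal space the three complex coframe components of a Lagrangian
  immersion form a matrix \<open>M\<close> with \<open>M\<^sup>* M = h\<close>, hence \<open>M h\<^sup>-\<^sup>1 M\<^sup>* = 1\<close>.\<close>
lemma G_trace:
  assumes x: "x \<in> U"
  shows "G11 x + G22 x = 1"
proof -
  obtain p0 where p0: "sp_frame (q x) p0" using sp_frame_exists [OF qq [OF x]] .
  define a where "a r = pull q (\<lambda>_. r) x" for r
  have "D q x X \<bullet> r = a r \<bullet> X" for r X
    by (simp add: a_def pull_inner smooth_on_differentiable [OF q x])
  note a = this [of _ p0] this [of _ "imul p0"] this [of _ "jmul p0"] this [of _ "kmul p0"]
  let ?a1 = "a p0" and ?a2 = "a (imul p0)" and ?b1 = "a (jmul p0)" and ?b2 = "a (kmul p0)"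
  have h: "X \<bullet> (h x *v Y) = (be1 x \<bullet> X) * (be1 x \<bullet> Y) + (be2 x \<bullet> X) * (be2 x \<bullet> Y)
    + 2 * ((?a1 \<bullet> X) * (?a1 \<bullet> Y) + (?a2 \<bullet> X) * (?a2 \<bullet> Y) + (?b1 \<bullet> X) * (?b1 \<bullet> Y) + (?b2 \<bullet> X) * (?b2 \<bullet> Y))" for X Y
    unfolding metric [OF x]
    by (subst sp_frame_inner [OF p0]) (simp add: Dq [OF x] Dq_q [OF x] a)
  have l: "wedge (be1 x) (be2 x) X Y = 2 * wedge ?a1 ?a2 X Y + 2 * wedge ?b1 ?b2 X Y" for X Y
  proof -
    have sk: "imul v \<bullet> q x = - (v \<bullet> imul (q x))" "imul v \<bullet> p0 = - (v \<bullet> imul p0)"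
      "imul v \<bullet> imul w = v \<bullet> w" "imul v \<bullet> jmul w = - (v \<bullet> kmul w)" "imul v \<bullet> kmul w = v \<bullet> jmul w" for v w
      by (simp_all add: quaternion_skew quaternion_relations)
    have "D q x X \<bullet> imul (D q x Y) = - (wedge (be1 x) (be2 x) X Y + wedge ?a1 ?a2 X Y + wedge ?b1 ?b2 X Y)"
      by (subst sp_frame_inner [OF p0])
        (simp add: sk Dq [OF x] Dq_q [OF x] a wedge_def)
    then show ?thesis using lagr [OF x, of X Y] by simp
  qed
  \<comment> \<open>The sign of \<open>be2\<close> reflects that \<open>J\<close> acts as -i on
    \<open>D1\<close>; the factors sqrt 2 reflect the doubled metric on \<open>D2\<close>.\<close>
  define M :: "complex^3^3" where "M = (\<chi> k i. if k = 1 then Complex (be1 x $ i) (- be2 x $ i)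
    else if k = 2 then Complex (sqrt 2 * ?a1 $ i) (sqrt 2 * ?a2 $ i)
    else Complex (sqrt 2 * ?b1 $ i) (sqrt 2 * ?b2 $ i))"
  define M' :: "complex^3^3" where "M' = (\<chi> i k. cnj (M $ k $ i))"
  define H :: "complex^3^3" where "H = (\<chi> i j. complex_of_real (h x $ i $ j))"
  define c :: "complex^3" where "c = (\<chi> i. Complex (hinv x (be1 x) $ i) (hinv x (be2 x) $ i))"
  have M'M: "M' ** M = H"
  proof -
    have "(M' ** M) $ i $ j = H $ i $ j" for i j
      using h [of "axis i 1" "axis j 1"] l [of "axis i 1" "axis j 1"]
      by (simp add: matrix_matrix_mult_def M'_def M_def H_def sum_3 complex_eq_iff wedge_def
          inner_axis inner_axis' matrix_vector_mul_component algebra_simps sqrt2_mult)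
    then show ?thesis by (simp add: vec_eq_iff)
  qed
  have HC: "H *v (\<chi> i. Complex (u $ i) (v $ i)) = (\<chi> i. Complex ((h x *v u) $ i) ((h x *v v) $ i))" for u v
    by (simp add: H_def matrix_vector_mult_def vec_eq_iff complex_eq_iff)
  have "y = 0" if "H *v y = 0" for y
  proof -
    define u where "u = (\<chi> i. Re (y $ i))"
    define v where "v = (\<chi> i. Im (y $ i))"
    have y: "y = (\<chi> i. Complex (u $ i) (v $ i))" by (simp add: u_def v_def vec_eq_iff)
    have "h x *v u = 0" "h x *v v = 0"
      using that unfolding y HC by (simp_all add: vec_eq_iff complex_eq_iff)
    then have "u = 0" "v = 0" using h_nondeg [OF x] by auto
    then show "y = 0" by (simp add: y vec_eq_iff complex_eq_iff)
  qed
  then obtain N where N: "N ** H = mat 1" using matrix_left_invertible_ker [of H] by blast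
  then have "(N ** M') ** M = mat 1" by (simp add: matrix_mul_assoc [symmetric] M'M)
  then have MN: "M ** (N ** M') = mat 1" by (simp add: matrix_left_right_inverse)
  \<comment> \<open>\<open>c\<close> is the inverse of \<open>H\<close> applied to the first column
    of \<open>M'\<close>, so \<open>M *v c\<close> is the first column of the identity. The real
    part of its first entry is \<open>G11 + G22\<close>.\<close>
  have "M *v c = axis 1 1"
  proof -
    have "H *v c = M' *v axis 1 1"
    proof -
      have "(M' *v axis 1 1) $ i = M' $ i $ 1" for i
        by (simp add: matrix_vector_mult_def axis_def sum_3)
      then show ?thesis
        unfolding c_def HC h_hinv [OF x] by (simp add: M'_def M_def vec_eq_iff complex_eq_iff)
    qed
    then have "N *v (H *v c) = N *v (M' *v axis 1 1)" by simp
    then have "c = (N ** M') *v axis 1 1" by (simp add: matrix_vector_mul_assoc N)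
    then show ?thesis by (simp add: matrix_vector_mul_assoc MN)
  qed
  then have "Re ((M *v c) $ 1) = 1" by (simp add: axis_def)
  then show ?thesis
    by (simp add: M_def c_def matrix_vector_mult_def G11_def G22_def inner_vec_def sum.distrib [symmetric])
qed

text \<open>When \<open>G12\<close> vanishes, normalizing \<open>be1\<close> and \<open>be2\<close>
  already gives orthonormal covectors, smooth because \<open>G11\<close> and \<open>G22\<close> are
  positive. Equality of the two is the angle pi/4.\<close>

lemma no_regular:
  assumes G12: "\<And>x. x \<in> U \<Longrightarrow> G12 x = 0" and G22: "\<And>x. x \<in> U \<Longrightarrow> G22 x > 0"
    and cases: "(\<forall>x\<in>U. G22 x < G11 x) \<or> (\<forall>x\<in>U. G22 x = G11 x)"
  shows False
proof -
  have G11: "G11 x > 0" if "x \<in> U" for x using cases G22 [OF that] that by force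
  define cs where "cs x = sqrt (G11 x)" for x
  define sn where "sn x = sqrt (G22 x)" for x
  define t1 where "t1 x = (1 / cs x) *\<^sub>R be1 x" for x
  define t2 where "t2 x = (1 / sn x) *\<^sub>R be2 x" for x
  have cs: "cs x > 0" and sn: "sn x > 0" if "x \<in> U" for x
    using G11 [OF that] G22 [OF that] by (simp_all add: cs_def sn_def)
  have sm: "smooth_on U cs" "smooth_on U sn"
    unfolding cs_def [abs_def] sn_def [abs_def] by (intro smooth_intros U G11 G22; assumption)+
  have smt: "smooth_on U t1" "smooth_on U t2"
    unfolding t1_def [abs_def] t2_def [abs_def]
    by (intro smooth_intros U sm; use cs sn in fastforce)+
  have "adapted_lift U q h K sn cs t1 t2 (\<lambda>x. hinv x (t1 x)) (\<lambda>x. hinv x (t2 x))"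
  proof (intro adapted_lift.intro adapted_lift_axioms.intro)
    show "lagrangian_lift U q h K" by (rule lagrangian_lift_axioms)
    show "smooth_on U (\<lambda>x. hinv x (t2 x))" by (intro smooth_intros smt)
    fix x assume x: "x \<in> U"
    have sq: "(cs x)\<^sup>2 = G11 x" "(sn x)\<^sup>2 = G22 x" "cs x * cs x = G11 x" "sn x * sn x = G22 x"
      using G11 [OF x] G22 [OF x] by (simp_all add: cs_def sn_def)
    show "(sn x)\<^sup>2 + (cs x)\<^sup>2 = 1" using G_trace [OF x] by (simp add: sq)
    show "cs x > 0" by (rule cs [OF x])
    show "be1 x = cs x *\<^sub>R t1 x" "be2 x = sn x *\<^sub>R t2 x"
      using cs [OF x] sn [OF x] by (simp_all add: t1_def t2_def)
    show "X \<bullet> (h x *v hinv x (t1 x)) = t1 x \<bullet> X" "X \<bullet> (h x *v hinv x (t2 x)) = t2 x \<bullet> X" for X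
      by (simp_all add: h_hinv [OF x] inner_commute)
    show "t1 x \<bullet> hinv x (t1 x) = 1" "t1 x \<bullet> hinv x (t2 x) = 0" "t2 x \<bullet> hinv x (t2 x) = 1"
      using G11 [OF x] G22 [OF x] G12 [OF x]
      by (simp_all add: t1_def t2_def hinv_linear [OF x] G11_def [symmetric] G12_def [symmetric]
          G22_def [symmetric] sq)
    then show "t2 x \<bullet> hinv x (t1 x) = 0" using hinv_sym [OF x] by metis
  qed (rule sm smt)+
  then interpret A: adapted_lift U q h K sn cs t1 t2 "\<lambda>x. hinv x (t1 x)" "\<lambda>x. hinv x (t2 x)" .
  interpret C: adapted_coframe U sn cs t1 t2 A.t3 al A.ga A.de1 A.de2 h K by (rule A.adapted_coframe)
  from cases show False
  proof
    assume "\<forall>x\<in>U. G22 x = G11 x"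
    then show False by (intro C.no_diagonal) (simp add: cs_def sn_def)
  next
    assume less: "\<forall>x\<in>U. G22 x < G11 x"
    interpret Gn: generic_coframe U sn cs t1 t2 A.t3 al A.ga A.de1 A.de2 h K
      by unfold_locales (use sn less in \<open>auto simp: cs_def sn_def\<close>)
    show False by (rule Gn.no_generic)
  qed
qed

text \<open>Here \<open>be2 = 0\<close> does not determine \<open>t2\<close>; a constant covector,
  made orthogonal to \<open>be1\<close> by Gram-Schmidt and normalized, takes its place.\<close>

lemma no_vertical:
  assumes G22: "\<And>x. x \<in> U \<Longrightarrow> G22 x = 0"
    and nu: "\<And>x. x \<in> U \<Longrightarrow> \<nu> - (\<nu> \<bullet> hinv x (be1 x)) *\<^sub>R be1 x \<noteq> 0"
  shows False
proof -
  have be2: "be2 x = 0" if "x \<in> U" for x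
    using hinv_pos [OF that, of "be2 x"] G22 [OF that] by (auto simp: G22_def)
  have G11: "G11 x = 1" if "x \<in> U" for x using G_trace [OF that] G22 [OF that] by simp
  define u where "u x = \<nu> - (\<nu> \<bullet> hinv x (be1 x)) *\<^sub>R be1 x" for x
  define m where "m x = u x \<bullet> hinv x (u x)" for x
  have m: "m x > 0" if "x \<in> U" for x
    using hinv_pos [OF that nu [OF that]] by (simp add: m_def u_def)
  define t2 where "t2 x = (1 / sqrt (m x)) *\<^sub>R u x" for x
  have smu: "smooth_on U u" unfolding u_def [abs_def] by (intro smooth_intros U)
  have smm: "smooth_on U m" unfolding m_def [abs_def] by (intro smooth_intros U smu)
  have smt: "smooth_on U t2" unfolding t2_def [abs_def]
    by (intro smooth_intros U smu smm m; use m in fastforce)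
  have "adapted_lift U q h K (\<lambda>x. 0) (\<lambda>x. 1) be1 t2 (\<lambda>x. hinv x (be1 x)) (\<lambda>x. hinv x (t2 x))"
  proof (intro adapted_lift.intro adapted_lift_axioms.intro)
    show "lagrangian_lift U q h K" by (rule lagrangian_lift_axioms)
    show "smooth_on U (\<lambda>x. hinv x (t2 x))" by (intro smooth_intros smt)
    show "smooth_on U t2" by (rule smt)
    fix x assume x: "x \<in> U"
    show "be2 x = 0 *\<^sub>R t2 x" by (simp add: be2 [OF x])
    show "X \<bullet> (h x *v hinv x (be1 x)) = be1 x \<bullet> X" "X \<bullet> (h x *v hinv x (t2 x)) = t2 x \<bullet> X" for X
      by (simp_all add: h_hinv [OF x] inner_commute)
    show 1: "be1 x \<bullet> hinv x (be1 x) = 1" using G11 [OF x] by (simp add: G11_def)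
    have "be1 x \<bullet> hinv x (u x) = 0"
      by (simp add: u_def hinv_linear [OF x] inner_diff_right 1 hinv_sym [OF x, of "be1 x" \<nu>])
    then show 2: "be1 x \<bullet> hinv x (t2 x) = 0"
      by (simp add: t2_def hinv_linear [OF x])
    show "t2 x \<bullet> hinv x (be1 x) = 0" using 2 hinv_sym [OF x] by metis
    have "sqrt (m x) * sqrt (m x) = m x" using m [OF x] by simp
    then show "t2 x \<bullet> hinv x (t2 x) = 1"
      using m [OF x] by (simp add: t2_def hinv_linear [OF x] m_def [symmetric])
  qed (simp_all add: smooth_intros U)
  then interpret A: adapted_lift U q h K "\<lambda>x. 0" "\<lambda>x. 1" be1 t2 "\<lambda>x. hinv x (be1 x)" "\<lambda>x. hinv x (t2 x)" .
  interpret C: adapted_coframe U "\<lambda>x. 0" "\<lambda>x. 1" be1 t2 A.t3 al A.ga A.de1 A.de2 h K by (rule A.adapted_coframe)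
  show False by (rule C.no_zero) simp_all
qed

end

section \<open>Local lifts and gauge\<close>

lemma open_pos:
  assumes "open S" "smooth_on S r"
  shows "open {x \<in> S. (0::real) < r x}"
  using continuous_open_preimage [OF smooth_on_continuous [OF assms(2)] assms(1), of "{0<..}"]
  by (simp add: vimage_def Int_def)

lemma smooth_on_Re_Im [smooth_intros]:
  assumes "open S" "smooth_on S u"
  shows "smooth_on S (\<lambda>x. Re (u x))" "smooth_on S (\<lambda>x. Im (u x))"
  using smooth_on_linear [OF bounded_linear_Re assms] smooth_on_linear [OF bounded_linear_Im assms] by auto

lemma smooth_on_cnj [smooth_intros]:
  "open S \<Longrightarrow> smooth_on S u \<Longrightarrow> smooth_on S (\<lambda>x. cnj (u x))"
  by (rule smooth_on_linear [OF bounded_linear_cnj])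

lemma smooth_on_Complex [smooth_intros]:
  assumes S: "open S" and "smooth_on S a" "smooth_on S b"
  shows "smooth_on S (\<lambda>x. Complex (a x) (b x))"
proof (rule smooth_on_cong [OF S])
  show "smooth_on S (\<lambda>x. a x *\<^sub>R 1 + b x *\<^sub>R \<i>)" by (intro smooth_intros assms)
qed (simp add: complex_eq_iff)

lemma bounded_bilinear_smult: "bounded_bilinear (\<lambda>(c::complex) (v::complex^'n::finite). c *s v)"
proof (rule bilinear_conv_bounded_bilinear [THEN iffD1])
  show "bilinear (\<lambda>(c::complex) (v::complex^'n). c *s v)"
    unfolding bilinear_def by (auto intro!: linearI simp: vec_eq_iff algebra_simps)
qed

lemmas smooth_on_smult [smooth_intros] = smooth_on_bilinear [OF bounded_bilinear_smult]

text \<open>Half-angle formula. The root again has positive real part, so the construction can be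
  iterated to reach a fourth root.\<close>

lemma smooth_unit_sqrt:
  fixes u :: "'a::euclidean_space \<Rightarrow> complex"
  assumes S: "open S" and u: "smooth_on S u"
    and unit: "\<And>x. x \<in> S \<Longrightarrow> cmod (u x) = 1" and pos: "\<And>x. x \<in> S \<Longrightarrow> Re (u x) > 0"
  obtains v where "smooth_on S v" "\<And>x. x \<in> S \<Longrightarrow> (v x)\<^sup>2 = u x"
    "\<And>x. x \<in> S \<Longrightarrow> cmod (v x) = 1" "\<And>x. x \<in> S \<Longrightarrow> Re (v x) > 0"
proof -
  define r where "r x = sqrt (2 * (1 + Re (u x)))" for x
  define v where "v x = Complex (r x / 2) (Im (u x) / r x)" for x
  have r: "r x > 0" "(r x)\<^sup>2 = 2 * (1 + Re (u x))" if "x \<in> S" for x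
    using pos [OF that] by (simp_all add: r_def)
  have smr: "smooth_on S r"
    unfolding r_def [abs_def] by (intro smooth_intros S u) (use pos in fastforce)
  have smv: "smooth_on S v"
    unfolding v_def [abs_def] using r(1) by (intro smooth_intros S u smr) force+
  have sq: "(v x)\<^sup>2 = u x" if x: "x \<in> S" for x
  proof -
    have n: "(Re (u x))\<^sup>2 + (Im (u x))\<^sup>2 = 1"
      using unit [OF x] by (simp add: cmod_power2 [symmetric])
    have "r x * r x * (r x * r x) - 4 * (Im (u x))\<^sup>2 = 4 * (r x * r x) * Re (u x)"
      using r(2) [OF x] n by algebra
    then have "r x * r x / 4 - Im (u x) * Im (u x) / (r x * r x) = Re (u x)"
      using r(1) [OF x] by (simp add: field_simps power2_eq_square)
    then show ?thesis
      using r(1) [OF x] by (simp add: complex_eq_iff v_def power2_eq_square)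
  qed
  have "cmod (v x) = 1" if x: "x \<in> S" for x
  proof -
    have "(cmod (v x))\<^sup>2 = 1\<^sup>2" using unit [OF x] sq [OF x] by (metis norm_power one_power2)
    then show ?thesis by (rule power2_eq_imp_eq) auto
  qed
  moreover have "Re (v x) > 0" if "x \<in> S" for x using r(1) [OF that] by (simp add: v_def)
  ultimately show thesis using that [OF smv sq] by blast
qed

text \<open>\<open>curv\<close> is the curvature hypothesis with its denominator cleared, restricted
  to a nonzero Gram determinant so that it follows before \<open>h\<close> is known to be positive
  definite.\<close>

locale lagrangian_map =
  fixes V :: "(real^3) set" and F :: "real^3 \<Rightarrow> complex^4^4" and h :: "real^3 \<Rightarrow> real^3^3" and K :: real
  assumes V: "open V" "V \<noteq> {}" and F: "smooth_on V F" and F_CP3: "\<And>x. x \<in> V \<Longrightarrow> F x \<in> CP3"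
    and inj: "\<And>x. x \<in> V \<Longrightarrow> inj (D F x)"
    and lagr: "\<And>x X Y. x \<in> V \<Longrightarrow> g (F x) (D F x X) (J (F x) (D F x Y)) = 0"
    and metric: "\<And>x i j. x \<in> V \<Longrightarrow> h x $ i $ j = g (F x) (D F x (axis i 1)) (D F x (axis j 1))"
    and curv: "\<And>x X Y. x \<in> V \<Longrightarrow>
      metric_at h x X X * metric_at h x Y Y - (metric_at h x X Y)\<^sup>2 \<noteq> 0 \<Longrightarrow>
      metric_at h x (curvature h x X Y Y) X =
      K * (metric_at h x X X * metric_at h x Y Y - (metric_at h x X Y)\<^sup>2)"
begin

definition is_lift :: "(real^3) set \<Rightarrow> (real^3 \<Rightarrow> complex^4) \<Rightarrow> bool" where
  "is_lift U q \<longleftrightarrow> open U \<and> U \<noteq> {} \<and> U \<subseteq> V \<and> smooth_on U q \<and> (\<forall>x\<in>U. q x \<in> S7 \<and> hopf (q x) = F x)"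

lemma is_lift_subset: "is_lift U q \<Longrightarrow> open W \<Longrightarrow> W \<subseteq> U \<Longrightarrow> W \<noteq> {} \<Longrightarrow> is_lift W q"
  unfolding is_lift_def using smooth_on_subset by blast

text \<open>A fixed vector over \<open>x0\<close> is projected onto the line of \<open>F x\<close>
  by the matrix \<open>F x\<close> itself and then normalized.\<close>

lemma lift_exists:
  obtains U q where "is_lift U q"
proof -
  obtain x0 where x0: "x0 \<in> V" using V by blast
  obtain q0 where q0: "q0 \<in> S7" "hopf q0 = F x0" using F_CP3 [OF x0] by (auto simp: CP3_def)
  define w where "w x = (\<chi> a. \<Sum>b\<in>UNIV. F x $ a $ b * q0 $ b)" for x
  have smw: "smooth_on V w" unfolding w_def [abs_def] by (intro smooth_intros V F)
  have w: "w x = herm q0 r *s r" if "hopf r = F x" for x r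
    by (simp add: w_def that [symmetric] hopf_def herm_def vec_eq_iff sum_distrib_left mult_ac)
  define U where "U = {x \<in> V. 0 < w x \<bullet> w x}"
  have U: "open U" unfolding U_def by (intro open_pos smooth_intros V smw)
  have "w x0 = q0" using w [OF q0(2)] herm_self [OF q0(1)] by simp
  then have "x0 \<in> U" using x0 q0(1) by (auto simp: U_def)
  define q where "q x = (1 / sqrt (w x \<bullet> w x)) *\<^sub>R w x" for x
  have sm: "smooth_on U q"
  proof -
    have "smooth_on U w" using smooth_on_subset [OF smw] by (auto simp: U_def)
    then show ?thesis
      unfolding q_def [abs_def] by (intro smooth_intros U) (auto simp: U_def)
  qed
  have "q x \<in> S7 \<and> hopf (q x) = F x" if x: "x \<in> U" for x
  proof -
    obtain r where r: "r \<in> S7" "hopf r = F x" using F_CP3 [of x] x by (auto simp: CP3_def U_def)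
    have m: "sqrt (w x \<bullet> w x) = norm (w x)" "norm (w x) > 0" using x by (auto simp: U_def norm_eq_sqrt_inner)
    have qS: "q x \<in> S7" using m by (simp add: q_def)
    define k where "k = 1 / norm (w x)"
    define c where "c = complex_of_real k * herm q0 r"
    have "q x = k *\<^sub>R (herm q0 r *s r)"
      unfolding w [OF r(2), symmetric] by (simp add: q_def m k_def)
    then have qc: "q x = c *s r"
      by (simp only: c_def vec_eq_iff vector_scaleR_component vector_smult_component)
        (simp add: scaleR_conv_of_real)
    have "herm (q x) (q x) = c * cnj c * herm r r" unfolding qc herm_smult by simp
    then have "c * cnj c = 1" using herm_self [OF qS] herm_self [OF r(1)] by simp
    then have "cmod c = 1 \<or> cmod c = - 1"
      by (simp add: complex_norm_square [symmetric] power2_eq_1_iff flip: of_real_power)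
    then have "cmod c = 1" using norm_ge_zero [of c] by linarith
    then have "hopf r = hopf (q x)" using hopf_eq_iff [OF r(1) qS] qc by blast
    then show ?thesis using qS r(2) by simp
  qed
  then have "is_lift U q" using U sm \<open>x0 \<in> U\<close> by (auto simp: is_lift_def U_def)
  then show ?thesis using that by blast
qed

lemma lagrangian_lift:
  assumes "is_lift U q"
  shows "lagrangian_lift U q h K"
proof -
  have U: "open U" "U \<noteq> {}" "U \<subseteq> V" and q: "smooth_on U q"
    and qF: "\<And>x. x \<in> U \<Longrightarrow> q x \<in> S7" "\<And>x. x \<in> U \<Longrightarrow> hopf (q x) = F x"
    using assms by (auto simp: is_lift_def)
  interpret Q: quaternionic_lift U q
    by unfold_locales (use U q qF in \<open>auto simp: dot_square_norm\<close>)
  have DF: "D F x X = dhopf (q x) (D q x X)" if x: "x \<in> U" for x X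
  proof -
    have "(hopf has_derivative dhopf (q x)) (at (q x))"
      unfolding dhopf_def using has_derivative_hopf by (auto simp: frechet_derivative_works [symmetric] differentiable_def)
    from has_derivative_compose [OF smooth_D [OF q x] this]
    have *: "((\<lambda>y. hopf (q y)) has_derivative (\<lambda>X. dhopf (q x) (D q x X))) (at x)" .
    have "(F has_derivative (\<lambda>X. dhopf (q x) (D q x X))) (at x)"
      by (rule has_derivative_transform_within_open [OF * U(1) x]) (rule qF)
    then show ?thesis by (simp add: D_unique)
  qed
  \<comment> \<open>\<open>v1\<close> and \<open>v2\<close> are the parts of \<open>dq X\<close>
    over \<open>D1\<close> and \<open>D2\<close>, once the vertical part \<open>al\<close> is
    removed.\<close>
  define v1 where "v1 x X = (Q.be1 x \<bullet> X) *\<^sub>R jmul (q x) + (Q.be2 x \<bullet> X) *\<^sub>R kmul (q x)" for x X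
  define v2 where "v2 x X = D q x X - (Q.al x \<bullet> X) *\<^sub>R imul (q x) - v1 x X" for x X
  have qc: "q x \<bullet> imul (q x) = 0" "q x \<bullet> jmul (q x) = 0" "q x \<bullet> kmul (q x) = 0"
    "imul (q x) \<bullet> q x = 0" "jmul (q x) \<bullet> q x = 0" "kmul (q x) \<bullet> q x = 0" for x
    by (simp_all add: quaternion_orthogonal inner_commute [of _ "q x"])
  note qi = quaternion_isometry quaternion_orthogonal quaternion_skew quaternion_relations
  have DFv: "D F x X = dhopf (q x) (v1 x X + v2 x X)" if x: "x \<in> U" for x X
  proof -
    have "dhopf (q x) ((Q.al x \<bullet> X) *\<^sub>R imul (q x)) = 0"
    proof (subst dhopf_eq_0_iff [OF qF(1) [OF x]])
      show "(Q.al x \<bullet> X) *\<^sub>R imul (q x) \<in> tangent_S7 (q x)" by (simp add: tangent_S7_def qc)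
      show "(Q.al x \<bullet> X) *\<^sub>R imul (q x) \<in> span {\<i> *s q x}" by (simp add: imul_def span_base span_scale)
    qed
    then show ?thesis
      using dhopf_add [of "q x" "v1 x X + v2 x X" "(Q.al x \<bullet> X) *\<^sub>R imul (q x)"]
      by (simp add: DF [OF x] v2_def)
  qed
  let ?v = "\<lambda>x a b w. a *\<^sub>R jmul (q x) + b *\<^sub>R kmul (q x) + w"
  have v1s: "a *\<^sub>R jmul (q x) + b *\<^sub>R kmul (q x) \<in> span {jmul (q x), kmul (q x)}" for a b x
    by (intro span_add span_scale span_base) auto
  have v2i: "v2 x X \<bullet> q x = 0" "v2 x X \<bullet> imul (q x) = 0" "v2 x X \<bullet> jmul (q x) = 0" "v2 x X \<bullet> kmul (q x) = 0"
    if x: "x \<in> U" for x X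
    by (simp_all add: v2_def v1_def inner_diff_left inner_add_left qi qc Q.Dq [OF x] Q.Dq_q [OF x] Q.qq [OF x])
  have v2i': "q x \<bullet> v2 x X = 0" "imul (q x) \<bullet> v2 x X = 0" "jmul (q x) \<bullet> v2 x X = 0" "kmul (q x) \<bullet> v2 x X = 0"
    if x: "x \<in> U" for x X
    using v2i [OF x] by (simp_all only: inner_commute [of _ "v2 x X"])
  have "imul (v2 x X) \<bullet> q x = 0" "imul (v2 x X) \<bullet> imul (q x) = 0"
    "imul (v2 x X) \<bullet> jmul (q x) = 0" "imul (v2 x X) \<bullet> kmul (q x) = 0" if x: "x \<in> U" for x X
    using v2i [OF x] by (simp_all add: quaternion_skew quaternion_relations)
  then have v2j: "q x \<bullet> imul (v2 x X) = 0" "imul (q x) \<bullet> imul (v2 x X) = 0"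
    "jmul (q x) \<bullet> imul (v2 x X) = 0" "kmul (q x) \<bullet> imul (v2 x X) = 0" if x: "x \<in> U" for x X
    using x by (simp_all only: inner_commute [of _ "imul (v2 x X)"])
  have perp: "w \<bullet> u = 0" if "w \<bullet> imul (q x) = 0" "w \<bullet> jmul (q x) = 0" "w \<bullet> kmul (q x) = 0"
    "u \<in> span {\<i> *s q x, jmul (q x), kmul (q x)}" for w u x
  proof -
    have "orthogonal w u"
      by (rule orthogonal_to_span [OF that(4)]) (use that(1-3) in \<open>auto simp: orthogonal_def imul_def\<close>)
    then show ?thesis by (simp add: orthogonal_def)
  qed
  have gv: "g (F x) (dhopf (q x) (?v x a b w)) (dhopf (q x) (?v x a' b' w'))
    = a * a' + b * b' + 2 * (w \<bullet> w')"
    if x: "x \<in> U" and "w \<bullet> q x = 0" "w \<bullet> imul (q x) = 0" "w \<bullet> jmul (q x) = 0" "w \<bullet> kmul (q x) = 0"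
      "w' \<bullet> q x = 0" "w' \<bullet> imul (q x) = 0" "w' \<bullet> jmul (q x) = 0" "w' \<bullet> kmul (q x) = 0"
    for x a b a' b' w w'
  proof -
    have "g (hopf (q x)) (dhopf (q x) (?v x a b w)) (dhopf (q x) (?v x a' b' w'))
      = (a *\<^sub>R jmul (q x) + b *\<^sub>R kmul (q x)) \<bullet> (a' *\<^sub>R jmul (q x) + b' *\<^sub>R kmul (q x)) + 2 * (w \<bullet> w')"
    proof (rule g_hopf [OF qF(1) [OF x] v1s v1s])
      show "w \<in> tangent_S7 (q x)" "w' \<in> tangent_S7 (q x)" using that by (simp_all add: tangent_S7_def)
    qed (rule perp [OF that(3-5)] perp [OF that(7-9)], assumption)+
    also have "\<dots> = a * a' + b * b' + 2 * (w \<bullet> w')"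
      by (simp add: inner_add_left inner_add_right qi Q.qq [OF x] qc)
    finally show ?thesis by (simp add: qF(2) [OF x])
  qed
  have gDF: "g (F x) (D F x X) (D F x Y) = 2 * (D q x X \<bullet> D q x Y)
      - 2 * (Q.al x \<bullet> X) * (Q.al x \<bullet> Y) - (Q.be1 x \<bullet> X) * (Q.be1 x \<bullet> Y) - (Q.be2 x \<bullet> X) * (Q.be2 x \<bullet> Y)"
    if x: "x \<in> U" for x X Y
  proof -
    have "v2 x X \<bullet> v2 x Y = D q x X \<bullet> v2 x Y"
      by (subst (1) v2_def) (simp add: v1_def inner_diff_left inner_add_left v2i' [OF x])
    also have "\<dots> = D q x X \<bullet> D q x Y - (Q.al x \<bullet> X) * (Q.al x \<bullet> Y)
        - (Q.be1 x \<bullet> X) * (Q.be1 x \<bullet> Y) - (Q.be2 x \<bullet> X) * (Q.be2 x \<bullet> Y)"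
      by (simp add: v2_def v1_def inner_diff_right inner_add_right Q.Dq [OF x])
    finally show ?thesis
      unfolding DFv [OF x] v1_def by (subst gv [OF x]) (simp_all add: v2i [OF x])
  qed
  have hXY: "X \<bullet> (h x *v Y) = g (F x) (D F x X) (D F x Y)" if x: "x \<in> U" for x X Y
  proof -
    note exp = D_axis [OF smooth_on_differentiable [OF q x]]
    have hij: "h x $ i $ j = 2 * (D q x (axis i 1) \<bullet> D q x (axis j 1))
      - 2 * (Q.al x $ i * Q.al x $ j) - Q.be1 x $ i * Q.be1 x $ j - Q.be2 x $ i * Q.be2 x $ j" for i j
      using metric [of x i j] x U gDF [OF x] by (auto simp: inner_axis)
    have "D q x X \<bullet> D q x Y = (\<Sum>i\<in>UNIV. \<Sum>j\<in>UNIV. X $ i * Y $ j * (D q x (axis i 1) \<bullet> D q x (axis j 1)))"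
      by (subst exp [of X], subst exp [of Y], simp add: inner_sum_left inner_sum_right mult_ac sum_distrib_left)
        (rule sum.swap)
    moreover have "X \<bullet> (h x *v Y) = (\<Sum>i\<in>UNIV. \<Sum>j\<in>UNIV. X $ i * Y $ j * h x $ i $ j)"
      by (simp add: inner_vec_def matrix_vector_mult_def sum_distrib_left mult_ac)
    ultimately show ?thesis
      unfolding gDF [OF x] hij
      by (simp add: right_diff_distrib sum_subtractf double_sum_inner
          mult.left_commute [of _ 2] sum_distrib_left [symmetric])
  qed
  show ?thesis
  proof
    show "U \<noteq> {}" by (rule U)
    fix x X Y assume x: "x \<in> U"
    then have xV: "x \<in> V" using U by blast
    show "X \<bullet> (h x *v Y) = 2 * (D q x X \<bullet> D q x Y)
      - 2 * (Q.al x \<bullet> X) * (Q.al x \<bullet> Y) - (Q.be1 x \<bullet> X) * (Q.be1 x \<bullet> Y) - (Q.be2 x \<bullet> X) * (Q.be2 x \<bullet> Y)"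
      by (simp add: hXY [OF x] gDF [OF x])
    show "metric_at h x (curvature h x X Y Y) X =
      K * (metric_at h x X X * metric_at h x Y Y - (metric_at h x X Y)\<^sup>2)"
      if "metric_at h x X X * metric_at h x Y Y - (metric_at h x X Y)\<^sup>2 \<noteq> 0"
      by (rule curv [OF xV that])
    show "X \<bullet> (h x *v X) > 0" if "X \<noteq> 0"
    proof (rule ccontr)
      have *: "X \<bullet> (h x *v X) = (Q.be1 x \<bullet> X) * (Q.be1 x \<bullet> X) + (Q.be2 x \<bullet> X) * (Q.be2 x \<bullet> X) + 2 * (v2 x X \<bullet> v2 x X)"
        unfolding hXY [OF x] DFv [OF x] v1_def by (subst gv [OF x]) (simp_all add: v2i [OF x])
      assume "\<not> X \<bullet> (h x *v X) > 0"
      moreover have "(Q.be1 x \<bullet> X) * (Q.be1 x \<bullet> X) \<ge> 0" "(Q.be2 x \<bullet> X) * (Q.be2 x \<bullet> X) \<ge> 0" "v2 x X \<bullet> v2 x X \<ge> 0"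
        by simp_all
      ultimately have "(Q.be1 x \<bullet> X) * (Q.be1 x \<bullet> X) = 0" "(Q.be2 x \<bullet> X) * (Q.be2 x \<bullet> X) = 0" "v2 x X \<bullet> v2 x X = 0"
        unfolding * by linarith+
      then have "v1 x X + v2 x X = 0" by (simp add: v1_def)
      then have "D F x X = D F x 0"
        unfolding DF [OF x, of 0] linear_0 [OF linear_frechet_derivative [OF smooth_on_differentiable [OF q x]]]
        by (simp add: DFv [OF x])
      then show False using inj [OF xV] that by (auto dest: injD)
    qed
    have "g (F x) (D F x X) (J (F x) (D F x Y)) =
       (Q.be1 x \<bullet> X) * (Q.be2 x \<bullet> Y) - (Q.be2 x \<bullet> X) * (Q.be1 x \<bullet> Y) + 2 * (v2 x X \<bullet> imul (v2 x Y))"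
    proof -
      have "J (hopf (q x)) (dhopf (q x) (v1 x Y + v2 x Y)) = dhopf (q x) (- (\<i> *s v1 x Y) + \<i> *s v2 x Y)"
        by (rule J_hopf [OF qF(1) [OF x]])
          (simp_all add: v1_def v1s tangent_S7_def v2i [OF x] perp [OF v2i(2-4) [OF x]])
      also have "- (\<i> *s v1 x Y) + \<i> *s v2 x Y =
          (Q.be2 x \<bullet> Y) *\<^sub>R jmul (q x) + (- (Q.be1 x \<bullet> Y)) *\<^sub>R kmul (q x) + imul (v2 x Y)"
        unfolding imul_def [symmetric] v1_def
        by (simp add: linear_add [OF linear_quaternion(1)] linear_cmul [OF linear_quaternion(1)] quaternion_relations)
      finally have Je: "J (F x) (D F x Y) = dhopf (q x)
          ((Q.be2 x \<bullet> Y) *\<^sub>R jmul (q x) + (- (Q.be1 x \<bullet> Y)) *\<^sub>R kmul (q x) + imul (v2 x Y))"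
        by (simp only: qF(2) [OF x] DFv [OF x])
      show ?thesis
        unfolding Je unfolding DFv [OF x, of X] v1_def [of x X]
        by (subst gv [OF x]) (simp_all add: v2i [OF x] quaternion_skew quaternion_relations)
    qed
    moreover have "v2 x X \<bullet> imul (v2 x Y) = D q x X \<bullet> imul (D q x Y)
      + (Q.be1 x \<bullet> X) * (Q.be2 x \<bullet> Y) - (Q.be2 x \<bullet> X) * (Q.be1 x \<bullet> Y)"
    proof -
      have "v2 x X \<bullet> imul (v2 x Y) = D q x X \<bullet> imul (v2 x Y)"
        by (subst (1) v2_def)
          (simp add: v1_def inner_diff_left inner_add_left v2j [OF x])
      also have "\<dots> = D q x X \<bullet> imul (D q x Y)
        + (Q.be1 x \<bullet> X) * (Q.be2 x \<bullet> Y) - (Q.be2 x \<bullet> X) * (Q.be1 x \<bullet> Y)"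
        by (simp add: v2_def v1_def linear_diff [OF linear_quaternion(1)] linear_add [OF linear_quaternion(1)]
            linear_cmul [OF linear_quaternion(1)] quaternion_relations inner_diff_right inner_add_right
            Q.Dq [OF x] Q.Dq_q [OF x] algebra_simps)
      finally show ?thesis .
    qed
    ultimately show "2 * (D q x X \<bullet> imul (D q x Y)) + 3 * wedge (Q.be1 x) (Q.be2 x) X Y = 0"
      using lagr [OF xV, of X Y] by (simp add: wedge_def algebra_simps)
  qed
qed

end

lemma (in quaternionic_lift) herm_Dq:
  assumes x: "x \<in> U"
  shows "herm (D q x X) (jmul (q x)) = Complex (be1 x \<bullet> X) (be2 x \<bullet> X)"
  by (simp add: herm_eq quaternion_relations Dq [OF x])

section \<open>Normalizing the phase of the lift\<close>

context lagrangian_map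
begin

text \<open>Replacing \<open>q\<close> by \<open>\<rho> q\<close> multiplies \<open>zz q\<close> by \<open>\<rho>\<^sup>4\<close>, and \<open>|zz q| = cos (2 \<theta>)\<close>.\<close>
definition zz :: "(real^3 \<Rightarrow> complex^4) \<Rightarrow> real^3 \<Rightarrow> complex" where
  "zz q x = Complex (lagrangian_lift.G11 q h x - lagrangian_lift.G22 q h x) (2 * lagrangian_lift.G12 q h x)"

lemma smooth_zz:
  assumes "is_lift U q"
  shows "smooth_on U (zz q)"
proof -
  interpret L: lagrangian_lift U q h K by (rule lagrangian_lift [OF assms])
  show ?thesis unfolding zz_def [abs_def] by (intro smooth_intros L.U L.smooth_G)
qed

text \<open>The complex form \<open>be1 + i be2\<close> is \<open>herm (dq, jmul q)\<close>. As
  \<open>jmul\<close> is antilinear, both arguments contribute a factor rho, and the derivative of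
  rho drops out by orthogonality. \<open>zz\<close> is the bilinear square of this form for the
  inverse metric.\<close>

lemma gauge_change:
  assumes q: "is_lift U q" and W: "open W" "W \<noteq> {}" "W \<subseteq> U"
    and rho: "smooth_on W \<rho>" "\<And>x. x \<in> W \<Longrightarrow> cmod (\<rho> x) = 1"
  shows "is_lift W (\<lambda>x. \<rho> x *s q x)" "\<And>x. x \<in> W \<Longrightarrow> zz (\<lambda>x. \<rho> x *s q x) x = \<rho> x ^ 4 * zz q x"
proof -
  let ?q = "\<lambda>x. \<rho> x *s q x"
  have qW: "is_lift W q" using is_lift_subset [OF q W(1,3,2)] .
  then have sq: "smooth_on W q" and V: "W \<subseteq> V" and qS: "\<And>x. x \<in> W \<Longrightarrow> q x \<in> S7 \<and> hopf (q x) = F x"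
    by (auto simp: is_lift_def)
  show lift: "is_lift W ?q"
    unfolding is_lift_def
  proof (intro conjI ballI)
    show "smooth_on W ?q" by (intro smooth_intros W rho sq)
    fix x assume x: "x \<in> W"
    have "\<rho> x * cnj (\<rho> x) = 1" using rho(2) [OF x] by (metis complex_norm_square of_real_1 power_one)
    then have "herm (?q x) (?q x) = herm (q x) (q x)"
      by (simp add: herm_smult mult.assoc [symmetric] mult.commute [of "cnj (\<rho> x)"])
    then have "?q x \<bullet> ?q x = q x \<bullet> q x" by (simp add: inner_herm)
    then show *: "?q x \<in> S7" using qS [OF x] by (simp add: norm_eq_sqrt_inner)
    have "hopf (q x) = hopf (?q x)"
      using hopf_eq_iff [of "q x" "?q x"] qS [OF x] * rho(2) [OF x] by blast
    then show "hopf (?q x) = F x" using qS [OF x] by simp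
  qed (use W V in auto)
  interpret L: lagrangian_lift W q h K by (rule lagrangian_lift [OF qW])
  interpret L': lagrangian_lift W ?q h K by (rule lagrangian_lift [OF lift])
  fix x assume x: "x \<in> W"
  define w where "w = (\<rho> x)\<^sup>2"
  have be: "Complex (L'.be1 x \<bullet> X) (L'.be2 x \<bullet> X) = w * Complex (L.be1 x \<bullet> X) (L.be2 x \<bullet> X)" for X
  proof -
    have "D ?q x X = \<rho> x *s D q x X + D \<rho> x X *s q x"
      by (rule D_bilinear [OF x bounded_bilinear_smult rho(1) sq])
    then have "herm (D ?q x X) (jmul (?q x)) = \<rho> x * (\<rho> x * herm (D q x X) (jmul (q x)) + D \<rho> x X * herm (q x) (jmul (q x)))"
      by (simp add: jmul_smult herm_add herm_smult algebra_simps)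
    moreover have "herm (q x) (jmul (q x)) = 0" using herm_commute [of "q x" "jmul (q x)"] by (simp add: herm_jmul)
    ultimately show ?thesis
      unfolding L'.herm_Dq [OF x] L.herm_Dq [OF x] by (simp add: w_def power2_eq_square)
  qed
  have be1: "L'.be1 x = Re w *\<^sub>R L.be1 x - Im w *\<^sub>R L.be2 x"
    by (rule inner_eqI) (use be in \<open>simp add: complex_eq_iff inner_diff_left\<close>)
  have be2: "L'.be2 x = Im w *\<^sub>R L.be1 x + Re w *\<^sub>R L.be2 x"
    by (rule inner_eqI) (use be in \<open>simp add: complex_eq_iff inner_add_left\<close>)
  note lin = L.hinv_linear [OF x] inner_diff_left inner_add_left inner_diff_right inner_add_right
    L.G11_def [symmetric] L.G12_def [symmetric] L.G22_def [symmetric]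
    L.hinv_sym [OF x, of "L.be2 x" "L.be1 x"]
  have G: "L'.G11 x = (Re w)\<^sup>2 * L.G11 x - 2 * Re w * Im w * L.G12 x + (Im w)\<^sup>2 * L.G22 x"
    "L'.G12 x = Re w * Im w * L.G11 x + ((Re w)\<^sup>2 - (Im w)\<^sup>2) * L.G12 x - Re w * Im w * L.G22 x"
    "L'.G22 x = (Im w)\<^sup>2 * L.G11 x + 2 * Re w * Im w * L.G12 x + (Re w)\<^sup>2 * L.G22 x"
    unfolding L'.G11_def L'.G12_def L'.G22_def be1 be2
    by (simp_all add: lin power2_eq_square algebra_simps)
  have "zz ?q x = w\<^sup>2 * zz q x"
    by (simp add: zz_def G complex_eq_iff power2_eq_square algebra_simps)
  then show "zz ?q x = \<rho> x ^ 4 * zz q x" by (simp add: w_def power_mult [symmetric])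
qed

text \<open>A constant rotation first makes \<open>zz\<close> positive at \<open>x0\<close>. On the
  neighbourhood where its real part stays positive, two successive square roots provide a smooth
  fourth root of the inverse phase.\<close>

lemma gauge_fixing:
  assumes q: "is_lift U q" and x0: "x0 \<in> U" and z0: "zz q x0 \<noteq> 0"
  obtains W q' where "is_lift W q'" "x0 \<in> W" "W \<subseteq> U"
    "\<And>x. x \<in> W \<Longrightarrow> zz q' x = complex_of_real (cmod (zz q x))"
proof -
  have U: "open U" "U \<noteq> {}" using q by (auto simp: is_lift_def)
  define c where "c = csqrt (csqrt (cnj (zz q x0) / cmod (zz q x0)))"
  have c4: "c ^ 4 = cnj (zz q x0) / cmod (zz q x0)"
  proof -
    have "c ^ 4 = (c\<^sup>2)\<^sup>2" by (simp add: power_mult [symmetric])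
    then show ?thesis by (simp add: c_def)
  qed
  have "cmod c ^ 4 = 1" using z0 by (simp add: norm_power [symmetric] c4 norm_divide)
  then have c: "cmod c = 1" using power_eq_imp_eq_base [of "cmod c" 4 1] by simp
  define q1 where "q1 x = c *s q x" for x
  have q1: "is_lift U q1" and z1: "\<And>x. x \<in> U \<Longrightarrow> zz q1 x = c ^ 4 * zz q x"
    unfolding q1_def [abs_def] using gauge_change [OF q U order_refl smooth_on_const c] by auto
  have z1n: "cmod (zz q1 x) = cmod (zz q x)" if "x \<in> U" for x
    by (simp add: z1 [OF that] norm_mult norm_power c)
  define W where "W = {x \<in> U. 0 < Re (zz q1 x)}"
  have W: "open W" "W \<subseteq> U"
    unfolding W_def by (intro open_pos smooth_intros U smooth_zz q1) auto
  have "zz q1 x0 = complex_of_real (cmod (zz q x0))"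
  proof -
    have "cnj (zz q x0) * zz q x0 = complex_of_real ((cmod (zz q x0))\<^sup>2)"
      by (simp only: complex_norm_square mult.commute)
    then show ?thesis using z0 by (simp add: z1 [OF x0] c4 power2_eq_square)
  qed
  then have x0W: "x0 \<in> W" using x0 z0 by (simp add: W_def)
  have q1W: "is_lift W q1" using is_lift_subset [OF q1 W] x0W by blast
  define u where "u x = (1 / sqrt ((Re (zz q1 x))\<^sup>2 + (Im (zz q1 x))\<^sup>2)) *\<^sub>R cnj (zz q1 x)" for x
  have m: "sqrt ((Re (zz q1 x))\<^sup>2 + (Im (zz q1 x))\<^sup>2) = cmod (zz q1 x)" for x
    by (simp add: cmod_def)
  have mp: "cmod (zz q1 x) > 0" "(Re (zz q1 x))\<^sup>2 + (Im (zz q1 x))\<^sup>2 > 0" if "x \<in> W" for x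
    using that by (auto simp: W_def sum_power2_gt_zero_iff)
  have smu: "smooth_on W u"
    unfolding u_def [abs_def] using mp
    by (intro smooth_intros W smooth_zz q1W) (auto simp: sum_power2_gt_zero_iff)
  have u1: "cmod (u x) = 1" "Re (u x) > 0" if "x \<in> W" for x
    using mp [OF that] that by (auto simp: u_def m W_def)
  obtain v where v: "smooth_on W v" "\<And>x. x \<in> W \<Longrightarrow> (v x)\<^sup>2 = u x"
    "\<And>x. x \<in> W \<Longrightarrow> cmod (v x) = 1" "\<And>x. x \<in> W \<Longrightarrow> Re (v x) > 0"
    using smooth_unit_sqrt [OF W(1) smu u1] by metis
  obtain r where r: "smooth_on W r" "\<And>x. x \<in> W \<Longrightarrow> (r x)\<^sup>2 = v x" "\<And>x. x \<in> W \<Longrightarrow> cmod (r x) = 1"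
    using smooth_unit_sqrt [OF W(1) v(1,3,4)] by metis
  have Wne: "W \<noteq> {}" using x0W by blast
  have gc: "is_lift W (\<lambda>x. r x *s q1 x)" "\<And>x. x \<in> W \<Longrightarrow> zz (\<lambda>x. r x *s q1 x) x = r x ^ 4 * zz q1 x"
    by (rule gauge_change [OF q1W W(1) Wne order_refl r(1) r(3)]; assumption)+
  show ?thesis
  proof (rule that [OF gc(1) x0W W(2)])
    fix x assume x: "x \<in> W"
    then have xU: "x \<in> U" using W by blast
    have "r x ^ 4 = ((r x)\<^sup>2)\<^sup>2" by (simp add: power_mult [symmetric])
    then have "r x ^ 4 = u x" by (simp add: r(2) [OF x] v(2) [OF x])
    then have "zz (\<lambda>x. r x *s q1 x) x = u x * zz q1 x" using gc(2) [OF x] by simp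
    also have "\<dots> = (1 / cmod (zz q1 x)) *\<^sub>R (cnj (zz q1 x) * zz q1 x)" by (simp add: u_def m)
    also have "cnj (zz q1 x) * zz q1 x = complex_of_real ((cmod (zz q1 x))\<^sup>2)"
      by (simp only: complex_norm_square mult.commute)
    also have "(1 / cmod (zz q1 x)) *\<^sub>R complex_of_real ((cmod (zz q1 x))\<^sup>2) = complex_of_real (cmod (zz q1 x))"
      using mp(1) [OF x] by (simp add: scaleR_conv_of_real power2_eq_square)
    finally show "zz (\<lambda>x. r x *s q1 x) x = complex_of_real (cmod (zz q x))"
      by (simp add: z1n [OF xU])
  qed
qed

text \<open>\<open>m\<close> is cos^2 (2 theta). A value strictly between 0 and 1 gives the generic
  case near that point; otherwise \<open>m\<close> takes one extreme value near any chosen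
  point.\<close>

theorem no_constant_curvature: False
proof -
  obtain U q where q: "is_lift U q" using lift_exists .
  have U: "open U" "U \<noteq> {}" using q by (auto simp: is_lift_def)
  define m where "m x = (Re (zz q x))\<^sup>2 + (Im (zz q x))\<^sup>2" for x
  have smm: "smooth_on U m" unfolding m_def [abs_def] by (intro smooth_intros U smooth_zz q)
  have mz: "m x = (cmod (zz q x))\<^sup>2" for x by (simp add: m_def cmod_power2)
  show False
  proof (cases "\<exists>x\<in>U. 0 < m x \<and> m x < 1")
    case True
    then obtain x0 where x0: "x0 \<in> U" "0 < m x0" "m x0 < 1" by blast
    then have "zz q x0 \<noteq> 0" by (auto simp: mz)
    then obtain W q' where W: "is_lift W q'" "x0 \<in> W" "W \<subseteq> U"
      "\<And>x. x \<in> W \<Longrightarrow> zz q' x = complex_of_real (cmod (zz q x))"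
      using gauge_fixing [OF q x0(1)] by metis
    have oW: "open W" using W(1) by (simp add: is_lift_def)
    define W' where "W' = {x \<in> W. 0 < m x * (1 - m x)}"
    have oW': "open W'"
      unfolding W'_def by (intro open_pos oW smooth_intros smooth_on_subset [OF smm W(3)])
    have "x0 \<in> W'" using x0 W(2) by (simp add: W'_def)
    then have q': "is_lift W' q'" using is_lift_subset [OF W(1) oW'] by (auto simp: W'_def)
    interpret L: lagrangian_lift W' q' h K by (rule lagrangian_lift [OF q'])
    have G: "L.G12 x = 0" "L.G11 x - L.G22 x = cmod (zz q x)" "0 < cmod (zz q x)" "cmod (zz q x) < 1"
      if "x \<in> W'" for x
    proof -
      have "x \<in> W" "0 < m x * (1 - m x)" using that by (auto simp: W'_def)
      then show "L.G12 x = 0" "L.G11 x - L.G22 x = cmod (zz q x)"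
        using W(4) [of x] by (simp_all add: zz_def complex_eq_iff)
      have "m x \<ge> 0" by (simp add: mz)
      with \<open>0 < m x * (1 - m x)\<close> have "m x > 0" "m x < 1" by (auto simp: zero_less_mult_iff)
      then show "0 < cmod (zz q x)" "cmod (zz q x) < 1"
        by (auto simp: mz power2_less_1_iff abs_square_less_1)
    qed
    show False
    proof (rule L.no_regular)
      show "L.G12 x = 0" if "x \<in> W'" for x using G [OF that] by simp
      show "L.G22 x > 0" if "x \<in> W'" for x using G [OF that] L.G_trace [OF that] by simp
      have "L.G22 x < L.G11 x" if "x \<in> W'" for x using G(2,3) [OF that] by linarith
      then show "(\<forall>x\<in>W'. L.G22 x < L.G11 x) \<or> (\<forall>x\<in>W'. L.G22 x = L.G11 x)" by blast
    qed
  next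
    case False
    obtain x0 where x0: "x0 \<in> U" using U by blast
    show False
    proof (cases "m x0 = 0")
      case True
      \<comment> \<open>Values strictly between 0 and 1 are excluded, so on this open set
        \<open>m\<close> vanishes identically. There \<open>G12 = 0\<close> holds for any
        phase.\<close>
      define W where "W = {x \<in> U. 0 < 1 - m x}"
      have oW: "open W" unfolding W_def by (intro open_pos U smooth_intros smm)
      have "x0 \<in> W" using x0 True by (simp add: W_def)
      then have qW: "is_lift W q" using is_lift_subset [OF q oW] by (auto simp: W_def)
      interpret L: lagrangian_lift W q h K by (rule lagrangian_lift [OF qW])
      have "zz q x = 0" if "x \<in> W" for x
      proof -
        have "m x \<ge> 0" by (simp add: mz)
        then have "m x = 0" using that False by (auto simp: W_def not_less)
        then show ?thesis by (simp add: mz)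
      qed
      then have G: "L.G12 x = 0" "L.G22 x = L.G11 x" if "x \<in> W" for x
        using that by (auto simp: zz_def complex_eq_iff)
      show False
        by (rule L.no_regular) (use G L.G_trace in force)+
    next
      case m0: False
      then have "zz q x0 \<noteq> 0" by (auto simp: mz)
      then obtain W q' where W: "is_lift W q'" "x0 \<in> W" "W \<subseteq> U"
        "\<And>x. x \<in> W \<Longrightarrow> zz q' x = complex_of_real (cmod (zz q x))"
        using gauge_fixing [OF q x0] by metis
      interpret L: lagrangian_lift W q' h K by (rule lagrangian_lift [OF W(1)])
      \<comment> \<open>Orthogonality is Euclidean and required at \<open>x0\<close> only; it makes
        the Gram-Schmidt vector \<open>u\<close> nonzero there, hence nearby.\<close>
      obtain \<nu> where nu: "\<nu> \<noteq> 0" "orthogonal \<nu> (L.be1 x0)"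
        using orthogonal_to_vector_exists [of "L.be1 x0"] by (auto simp: orthogonal_commute)
      define u where "u x = \<nu> - (\<nu> \<bullet> L.hinv x (L.be1 x)) *\<^sub>R L.be1 x" for x
      have smu: "smooth_on W u" unfolding u_def [abs_def] by (intro smooth_intros L.U L.smooth_hinv L.smooth_forms)
      have smW: "smooth_on W m" by (rule smooth_on_subset [OF smm W(3)])
      define W' where "W' = {x \<in> W. 0 < m x * (u x \<bullet> u x)}"
      have oW': "open W'" unfolding W'_def by (intro open_pos L.U smooth_intros smu smW)
      have "u x0 \<bullet> \<nu> = \<nu> \<bullet> \<nu>"
        using nu(2) by (simp add: u_def inner_diff_left inner_diff_right orthogonal_def inner_commute)
      then have "u x0 \<noteq> 0" using nu(1) by auto
      moreover have "m x0 > 0" using m0 by (simp add: mz)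
      ultimately have "x0 \<in> W'" using W(2) by (simp add: W'_def)
      then have q': "is_lift W' q'" using is_lift_subset [OF W(1) oW'] by (auto simp: W'_def)
      interpret L': lagrangian_lift W' q' h K by (rule lagrangian_lift [OF q'])
      show False
      proof (rule L'.no_vertical)
        fix x assume x: "x \<in> W'"
        then have xW: "x \<in> W" and xU: "x \<in> U" and mu: "0 < m x * (u x \<bullet> u x)" using W(3) by (auto simp: W'_def)
        have "m x \<ge> 0" "u x \<bullet> u x \<ge> 0" by (simp_all add: mz)
        then have "m x > 0" "u x \<noteq> 0" using mu by (auto simp: zero_less_mult_iff)
        \<comment> \<open>Intermediate values being excluded, \<open>m >= 1\<close> follows; with
          trace 1 and \<open>G22 >= 0\<close> this leaves \<open>G22 = 0\<close>.\<close>
        then have "m x \<ge> 1" using False xU by force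
        then have "cmod (zz q x) \<ge> 1" by (simp add: mz abs_square_le_1 one_le_power)
          (metis abs_norm_cancel abs_le_square_iff abs_one one_power2)
        moreover have "L'.G11 x - L'.G22 x = cmod (zz q x)"
          using W(4) [OF xW] by (simp add: zz_def complex_eq_iff)
        moreover have "L'.G22 x \<ge> 0"
          using L'.hinv_pos [OF x, of "L'.be2 x"] by (cases "L'.be2 x = 0") (auto simp: L'.G22_def)
        ultimately show "L'.G22 x = 0" using L'.G_trace [OF x] by linarith
        show "\<nu> - (\<nu> \<bullet> L'.hinv x (L'.be1 x)) *\<^sub>R L'.be1 x \<noteq> 0"
          using \<open>u x \<noteq> 0\<close> by (simp add: u_def)
      qed
    qed
  qed
qed

end

theorem theorem6p14:
  fixes T :: "'m topology" and A :: "(3, 'm) atlas" and f :: "'m \<Rightarrow> complex^4^4"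
  shows "\<not> (lagrangian_submanifold T A f \<and> constant_sectional_curvature A (induced_metric f))"
proof
  assume *: "lagrangian_submanifold T A f \<and> constant_sectional_curvature A (induced_metric f)"
  then have imm: "immersed_submanifold T A f" by (simp add: lagrangian_submanifold_def)
  then have top: "topspace T = (\<Union>(V, \<psi>)\<in>A. \<psi> ` V)" "topspace T \<noteq> {}" "f ` topspace T \<subseteq> CP3"
    unfolding immersed_submanifold_def smooth_manifold_def by blast+
  have "(\<Union>(V, \<psi>)\<in>A. \<psi> ` V) \<noteq> {}" using top(1,2) by (simp only: not_False_eq_True)
  then obtain V \<psi> where V: "(V, \<psi>) \<in> A" "V \<noteq> {}" by force
  obtain c where c: "\<And>x X Y. x \<in> V \<Longrightarrow> X \<noteq> Y \<Longrightarrow> independent {X, Y} \<Longrightarrow>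
      sectional_curvature (induced_metric f \<psi>) x X Y = c"
    using * V(1) unfolding constant_sectional_curvature_def by fast
  have "lagrangian_map V (f \<circ> \<psi>) (induced_metric f \<psi>) c"
  proof
    show "open V" using imm V(1) by (auto simp: immersed_submanifold_def smooth_manifold_def)
    show "V \<noteq> {}" by (rule V)
    show "smooth_on V (f \<circ> \<psi>)" using imm V(1) by (auto simp: immersed_submanifold_def)
    fix x assume x: "x \<in> V"
    have "\<psi> x \<in> topspace T" unfolding top(1) using V(1) x by auto
    then show "(f \<circ> \<psi>) x \<in> CP3" using top(3) by auto
    show "inj (D (f \<circ> \<psi>) x)" using imm V(1) x by (auto simp: immersed_submanifold_def)
    show "g ((f \<circ> \<psi>) x) (D (f \<circ> \<psi>) x X) (J ((f \<circ> \<psi>) x) (D (f \<circ> \<psi>) x Y)) = 0" for X Y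
      using * V(1) x unfolding lagrangian_submanifold_def by fastforce
    show "induced_metric f \<psi> x $ i $ j
      = g ((f \<circ> \<psi>) x) (D (f \<circ> \<psi>) x (axis i 1)) (D (f \<circ> \<psi>) x (axis j 1))" for i j
      by (simp add: induced_metric_def)
    let ?h = "induced_metric f \<psi>"
    fix X Y
    let ?d = "metric_at ?h x X X * metric_at ?h x Y Y - (metric_at ?h x X Y)\<^sup>2"
    assume d: "?d \<noteq> 0"
    \<comment> \<open>A nonzero Gram determinant makes \<open>X\<close> and \<open>Y\<close>
      independent, so the hypothesis on sectional curvature applies and its denominator can be
      cleared.\<close>
    have "Y \<noteq> 0" using d by (auto simp: metric_at_def)
    moreover have "X \<notin> span {Y}"
    proof
      assume "X \<in> span {Y}"
      then obtain k where "X = k *\<^sub>R Y" by (auto simp: span_singleton)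
      then show False using d by (simp add: metric_at_def matrix_vector_mult_scaleR power2_eq_square)
    qed
    moreover have "X \<noteq> Y" using \<open>X \<notin> span {Y}\<close> span_base by blast
    ultimately have "sectional_curvature ?h x X Y = c"
      by (intro c [OF x]) (auto simp: independent_insert)
    then show "metric_at ?h x (curvature ?h x X Y Y) X = c * ?d"
      using d by (simp add: sectional_curvature_def field_simps)
  qed
  then show False by (rule lagrangian_map.no_constant_curvature)
qed

end
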